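(* Let $E\subset\widehat G$ be a band, $\Gamma\subset G$ a closed co-compact subgroup, and $\eta_1,\dots,\eta_n\in\operatorname{Aut}(G)$. The samples $\mathcal X=\{\eta_j\lambda:\lambda\in\Gamma\}_{1\le j\le n}$ are tight on the band $E$ with constant $K$ if and only if, for each $j\in\{1,2,\dots,n\}$, the samples $\{\eta_j\lambda:\lambda\in\Gamma\}$ are tight on $E$ with constant $K_j$. In this case, $K_j=\frac1{s(\eta_j\Gamma)}$ and $K=\sum_{j=1}^nK_j$.
   Context: $G$ is a second countable locally compact abelian group with dual $\widehat G$ and Haar measure $\mu_G$; $\widehat f(\gamma)=\int_Gf(x)\overline{\gamma(x)}\,d\mu_G(x)$, and $\mu_{\widehat G}$ is normalized so that Plancherel holds. $(T_\lambda f)(x)=f(x-\lambda)$. $\operatorname{Aut}(G)$ is the set of bi-continuous group automorphisms of $G$. $\Gamma$ carries a Haar measure $\mu_\Gamma$, and $\eta_j\Gamma$ carries the image of $\mu_\Gamma$ under $\lambda\mapsto\eta_j\lambda$. For a closed co-compact subgroup $\Lambda$ with Haar measure $\mu_\Lambda$, $\mu_{G/\Lambda}$ is normalized by Weil's formula $\int_Gf\,d\mu_G=\int_{G/\Lambda}\int_\Lambda f(x+\lambda)\,d\mu_\Lambda(\lambda)\,d\mu_{G/\Lambda}(\dot x)$, and $s(\Lambda)=\mu_{G/\Lambda}(G/\Lambda)$. A band is a measurable set $E\subset\widehat G$ of finite Haar measure. $V_E=\{f\in L^2(G):\operatorname{supp}\widehat f\subset E\}$, and $\psi_E\in L^2(G)$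 is given by $\widehat{\psi_E}=\chi_E$, the indicator function of $E$; elements $f\in V_E$ satisfy $f(\lambda)=\langle f,T_\lambda\psi_E\rangle$. The sampling transform of $\mathcal X=\{\eta_j\lambda:\lambda\in\Gamma\}_{1\le j\le n}$ is $\mathcal T_{\mathcal X}:V_E\to\bigoplus_{j=1}^nL^2(\Gamma)$, $f\mapsto(\lambda\mapsto f(\eta_j\lambda))_{j}$. The samples form a set of sampling for $E$ if $\mathcal T_{\mathcal X}$ is bounded above and below, and a set of sampling is called tight on $E$ with constant $K$ if $$\|\mathcal T_{\mathcal X}f\|^2=\sum_{j=1}^n\int_\Gamma|f(\eta_j\lambda)|^2\,d\mu_\Gamma(\lambda)=K\|f\|^2\quad\text{for all }f\in V_E.$$ Tightness of a single set $\{\eta_j\lambda:\lambda\in\Gamma\}$ is the case of one index.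
   Formalization: The formulas for the constants K_j and K are stated only for bands E of positive Haar measure, since for a null band V_E = {0} and every number is a tightness constant; the equivalence is stated for all bands. *)

theory Defs
  imports "HOL-Analysis.Analysis" "HOL-Library.Set_Algebras"
begin

section \<open>Haar measures\<close>

definition borel_of :: "'a topology \<Rightarrow> 'a measure" where
  "borel_of T = sigma (topspace T) {U. openin T U}"

text \<open>
  One definition serves \<open>G\<close>, its closed subgroups, its quotients and its dual: \<open>T\<close> is the
  group topology (its topspace is the group) and \<open>mul\<close> the group operation.
  All these groups are second countable and locally compact Hausdorff, so Borel measures that
  are finite on compact sets are automatically regular and regularity is not listed.
\<close>

definition haar_measure :: "'a topology \<Rightarrow> ('a \<Rightarrow> 'a \<Rightarrow> 'a) \<Rightarrow> 'a measure \<Rightarrow> bool" where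
  "haar_measure T mul M \<longleftrightarrow>
     sets M = sets (borel_of T) \<and>
     (\<forall>a\<in>topspace T. \<forall>A\<in>sets M. emeasure M (mul a ` A) = emeasure M A) \<and>
     (\<forall>C. compactin T C \<longrightarrow> emeasure M C < \<infinity>) \<and>
     (\<forall>U. openin T U \<and> U \<noteq> {} \<longrightarrow> emeasure M U > 0)"

section \<open>Subgroups, quotients, automorphisms\<close>

definition closed_subgroup :: "'g::topological_ab_group_add set \<Rightarrow> bool" where
  "closed_subgroup H \<longleftrightarrow>
     closed H \<and> 0 \<in> H \<and> (\<forall>x\<in>H. \<forall>y\<in>H. x + y \<in> H) \<and> (\<forall>x\<in>H. - x \<in> H)"

definition cosets :: "'g::topological_ab_group_add set \<Rightarrow> 'g set set" where
  "cosets H = range (\<lambda>x. (+) x ` H)"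

text \<open>The preimage in \<open>G\<close> of a set \<open>U\<close> of cosets is \<open>\<Union>U\<close>.\<close>

definition quotient_topology :: "'g::topological_ab_group_add set \<Rightarrow> 'g set topology" where
  "quotient_topology H = topology (\<lambda>U. U \<subseteq> cosets H \<and> open {x. (+) x ` H \<in> U})"

lemma openin_quotient_topology:
  "openin (quotient_topology H) U \<longleftrightarrow> U \<subseteq> cosets H \<and> open {x. (+) x ` H \<in> U}"
proof -
  have "istopology (\<lambda>U. U \<subseteq> cosets H \<and> open {x. (+) x ` H \<in> U})"
    unfolding istopology_def
  proof (intro conjI allI impI)
    fix S T
    assume "S \<subseteq> cosets H \<and> open {x. (+) x ` H \<in> S}" "T \<subseteq> cosets H \<and> open {x. (+) x ` H \<in> T}"
    then show "S \<inter> T \<subseteq> cosets H" "open {x. (+) x ` H \<in> S \<inter> T}"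
      by (auto simp: open_Collect_conj)
  next
    fix \<K>
    assume *: "\<forall>U\<in>\<K>. U \<subseteq> cosets H \<and> open {x. (+) x ` H \<in> U}"
    then show "\<Union>\<K> \<subseteq> cosets H" by blast
    have "{x. (+) x ` H \<in> \<Union>\<K>} = (\<Union>U\<in>\<K>. {x. (+) x ` H \<in> U})" by blast
    then show "open {x. (+) x ` H \<in> \<Union>\<K>}" using * by auto
  qed
  then show ?thesis
    by (simp add: quotient_topology_def topology_inverse')
qed

lemma topspace_quotient_topology: "topspace (quotient_topology H) = cosets H"
proof
  show "topspace (quotient_topology H) \<subseteq> cosets H"
    by (auto simp: topspace_def openin_quotient_topology)
  have "openin (quotient_topology H) (cosets H)"
    by (simp add: openin_quotient_topology cosets_def)
  then show "cosets H \<subseteq> topspace (quotient_topology H)"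
    by (rule openin_subset)
qed

definition co_compact :: "'g::topological_ab_group_add set \<Rightarrow> bool" where
  "co_compact H \<longleftrightarrow> compact_space (quotient_topology H)"

definition topological_aut :: "('g::topological_ab_group_add \<Rightarrow> 'g) \<Rightarrow> bool" where
  "topological_aut \<eta> \<longleftrightarrow>
     (\<forall>x y. \<eta> (x + y) = \<eta> x + \<eta> y) \<and> bij \<eta> \<and>
     continuous_on UNIV \<eta> \<and> continuous_on UNIV (inv \<eta>)"

definition image_measure ::
    "('g::topological_ab_group_add \<Rightarrow> 'g) \<Rightarrow> 'g set \<Rightarrow> 'g measure \<Rightarrow> 'g measure" where
  "image_measure \<eta> H \<mu>H = distr \<mu>H (borel_of (top_of_set (\<eta> ` H))) \<eta>"

text \<open>
  The Haar measure on \<open>G/H\<close> normalized by Weil's formula, which is stated for all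
  \<open>f \<in> L\<^sup>1(G)\<close>.  The inner integral depends only on the coset, since \<open>\<mu>H\<close> is
  invariant, so the choice of a representative is immaterial.
\<close>

definition weil_measure ::
    "'g::topological_ab_group_add measure \<Rightarrow> 'g set \<Rightarrow> 'g measure \<Rightarrow> 'g set measure \<Rightarrow> bool" where
  "weil_measure \<mu>G H \<mu>H Q \<longleftrightarrow>
     haar_measure (quotient_topology H) (+) Q \<and>
     (\<forall>f :: 'g \<Rightarrow> complex. integrable \<mu>G f \<longrightarrow>
        (AE c in Q. integrable \<mu>H (\<lambda>h. f ((SOME x. x \<in> c) + h))) \<and>
        integrable Q (\<lambda>c. \<integral>h. f ((SOME x. x \<in> c) + h) \<partial>\<mu>H) \<and>
        (\<integral>x. f x \<partial>\<mu>G) = (\<integral>c. (\<integral>h. f ((SOME x. x \<in> c) + h) \<partial>\<mu>H) \<partial>Q))"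

section \<open>The dual group and the Fourier transform\<close>

definition characters :: "('g::topological_ab_group_add \<Rightarrow> complex) set" where
  "characters = {\<gamma>. continuous_on UNIV \<gamma> \<and> (\<forall>x. cmod (\<gamma> x) = 1) \<and>
                     (\<forall>x y. \<gamma> (x + y) = \<gamma> x * \<gamma> y)}"

text \<open>The compact-open topology.\<close>

definition dual_topology :: "('g::topological_ab_group_add \<Rightarrow> complex) topology" where
  "dual_topology =
     subtopology (topology_generated_by {{\<gamma>. \<gamma> ` C \<subseteq> U} | C U. compact C \<and> open U}) characters"

definition dual_haar_measure ::
    "('g::topological_ab_group_add \<Rightarrow> complex) measure \<Rightarrow> bool" where
  "dual_haar_measure M \<longleftrightarrow> haar_measure dual_topology (\<lambda>\<gamma> \<gamma>' x. \<gamma> x * \<gamma>' x) M"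

text \<open>Elements of \<open>L\<^sup>2\<close> are represented by functions; equality is almost everywhere.\<close>

definition L2 :: "'a measure \<Rightarrow> ('a \<Rightarrow> complex) set" where
  "L2 M = {f \<in> borel_measurable M. integrable M (\<lambda>x. (cmod (f x))\<^sup>2)}"

definition L2_norm_sq :: "'a measure \<Rightarrow> ('a \<Rightarrow> complex) \<Rightarrow> real" where
  "L2_norm_sq M f = (\<integral>x. (cmod (f x))\<^sup>2 \<partial>M)"

definition fourier ::
    "'g measure \<Rightarrow> ('g \<Rightarrow> complex) \<Rightarrow> ('g \<Rightarrow> complex) \<Rightarrow> complex" where
  "fourier \<mu>G f \<gamma> = (\<integral>x. f x * cnj (\<gamma> x) \<partial>\<mu>G)"

definition plancherel_normalized ::
    "'g measure \<Rightarrow> ('g \<Rightarrow> complex) measure \<Rightarrow> bool" where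
  "plancherel_normalized \<mu>G \<mu>D \<longleftrightarrow>
     (\<forall>f. integrable \<mu>G f \<and> f \<in> L2 \<mu>G \<longrightarrow>
        fourier \<mu>G f \<in> L2 \<mu>D \<and> L2_norm_sq \<mu>D (fourier \<mu>G f) = L2_norm_sq \<mu>G f)"

text \<open>
  \<open>F\<close> represents the Fourier transform of \<open>f \<in> L\<^sup>2(G)\<close>, i.e. the value at \<open>f\<close> of the
  continuous extension of the Fourier transform from \<open>L\<^sup>1 \<inter> L\<^sup>2\<close> to \<open>L\<^sup>2\<close>.
\<close>

definition has_fourier_L2 ::
    "'g measure \<Rightarrow> ('g \<Rightarrow> complex) measure \<Rightarrow> ('g \<Rightarrow> complex) \<Rightarrow> (('g \<Rightarrow> complex) \<Rightarrow> complex) \<Rightarrow> bool"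
  where
  "has_fourier_L2 \<mu>G \<mu>D f F \<longleftrightarrow>
     f \<in> L2 \<mu>G \<and> F \<in> L2 \<mu>D \<and>
     (\<exists>u :: nat \<Rightarrow> 'g \<Rightarrow> complex.
        (\<forall>k. integrable \<mu>G (u k) \<and> u k \<in> L2 \<mu>G) \<and>
        (\<lambda>k. L2_norm_sq \<mu>G (\<lambda>x. u k x - f x)) \<longlonglongrightarrow> 0 \<and>
        (\<lambda>k. L2_norm_sq \<mu>D (\<lambda>\<gamma>. fourier \<mu>G (u k) \<gamma> - F \<gamma>)) \<longlonglongrightarrow> 0)"

section \<open>Bands and sampling\<close>

definition band :: "('g \<Rightarrow> complex) measure \<Rightarrow> ('g \<Rightarrow> complex) set \<Rightarrow> bool" where
  "band \<mu>D E \<longleftrightarrow> E \<in> sets \<mu>D \<and> emeasure \<mu>D E < \<infinity>"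

definition band_limited ::
    "'g measure \<Rightarrow> ('g \<Rightarrow> complex) measure \<Rightarrow> ('g \<Rightarrow> complex) set \<Rightarrow> ('g \<Rightarrow> complex) set" where
  "band_limited \<mu>G \<mu>D E =
     {f. \<exists>F. has_fourier_L2 \<mu>G \<mu>D f F \<and> (AE \<gamma> in \<mu>D. \<gamma> \<notin> E \<longrightarrow> F \<gamma> = 0)}"

text \<open>
  A band-limited element of \<open>L\<^sup>2(G)\<close> has a continuous representative, unique because Haar
  measure charges every nonempty open set; point values are those of this representative.
  At \<open>x\<close> it takes the value \<open>\<langle>f, T\<^sub>x \<psi>\<^sub>E\<rangle>\<close>, where the Fourier transform of \<open>\<psi>\<^sub>E\<close>
  is the indicator function of \<open>E\<close>.
\<close>

definition continuous_rep ::
    "'g::topological_space measure \<Rightarrow> ('g \<Rightarrow> complex) \<Rightarrow> 'g \<Rightarrow> complex" where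
  "continuous_rep \<mu>G f = (THE g. continuous_on UNIV g \<and> (AE x in \<mu>G. g x = f x))"

definition sampling_transform ::
    "'g::topological_space measure \<Rightarrow> (nat \<Rightarrow> 'g \<Rightarrow> 'g) \<Rightarrow> ('g \<Rightarrow> complex) \<Rightarrow> nat \<Rightarrow> 'g \<Rightarrow> complex"
  where
  "sampling_transform \<mu>G \<eta> f j x = continuous_rep \<mu>G f (\<eta> j x)"

text \<open>
  In the next two definitions \<open>J\<close> is the finite set of indices used, so that \<open>J = {1..n}\<close> gives
  the whole family \<open>\<eta>\<^sub>1, \<dots>, \<eta>\<^sub>n\<close> and \<open>J = {j}\<close> the single set of samples of \<open>\<eta>\<^sub>j\<close>.
\<close>

definition set_of_sampling ::
    "'g::topological_space measure \<Rightarrow> ('g \<Rightarrow> complex) measure \<Rightarrow> 'g measure \<Rightarrow>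
     ('g \<Rightarrow> complex) set \<Rightarrow> (nat \<Rightarrow> 'g \<Rightarrow> 'g) \<Rightarrow> nat set \<Rightarrow> bool" where
  "set_of_sampling \<mu>G \<mu>D \<mu>\<Gamma> E \<eta> J \<longleftrightarrow>
     (\<forall>f\<in>band_limited \<mu>G \<mu>D E. \<forall>j\<in>J. sampling_transform \<mu>G \<eta> f j \<in> L2 \<mu>\<Gamma>) \<and>
     (\<exists>A>0. \<exists>B>0. \<forall>f\<in>band_limited \<mu>G \<mu>D E.
        A * L2_norm_sq \<mu>G f \<le> (\<Sum>j\<in>J. L2_norm_sq \<mu>\<Gamma> (sampling_transform \<mu>G \<eta> f j)) \<and>
        (\<Sum>j\<in>J. L2_norm_sq \<mu>\<Gamma> (sampling_transform \<mu>G \<eta> f j)) \<le> B * L2_norm_sq \<mu>G f)"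

definition tight_sampling ::
    "'g::topological_space measure \<Rightarrow> ('g \<Rightarrow> complex) measure \<Rightarrow> 'g measure \<Rightarrow>
     ('g \<Rightarrow> complex) set \<Rightarrow> (nat \<Rightarrow> 'g \<Rightarrow> 'g) \<Rightarrow> nat set \<Rightarrow> real \<Rightarrow> bool" where
  "tight_sampling \<mu>G \<mu>D \<mu>\<Gamma> E \<eta> J K \<longleftrightarrow>
     set_of_sampling \<mu>G \<mu>D \<mu>\<Gamma> E \<eta> J \<and>
     (\<forall>f\<in>band_limited \<mu>G \<mu>D E.
        (\<Sum>j\<in>J. L2_norm_sq \<mu>\<Gamma> (sampling_transform \<mu>G \<eta> f j)) = K * L2_norm_sq \<mu>G f)"

end

theory Submission
  imports Defs
begin

text \<open>
  Fix a band-limited \<open>f\<close> with continuous representative \<open>g\<close>, and let \<open>N\<close> be the squared norm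
  of \<open>f\<close>.  Each automorphism \<open>\<eta>\<^sub>j\<close> gives a closed co-compact subgroup \<open>H\<^sub>j = \<eta>\<^sub>j\<Gamma>\<close>, of covolume
  \<open>s\<^sub>j\<close> say, and a function
  \<open>S\<^sub>j(x) = \<integral> |g(x + h)|\<^sup>2 dh\<close> (integral over \<open>H\<^sub>j\<close>), the periodization of \<open>|g|\<^sup>2\<close>, which is
  \<open>H\<^sub>j\<close>-periodic and whose value at \<open>x\<close> is the squared norm of the \<open>j\<close>-th samples of a
  translate of \<open>f\<close>.  Translates of band-limited functions are band-limited with the same norm, so
  tightness with constant \<open>K\<close> says that \<open>\<Sum>\<^sub>j S\<^sub>j(x) = K N\<close> for every \<open>x\<close>.  The claim is that this
  forces every \<open>S\<^sub>j\<close> to be constant, equal to \<open>N/s\<^sub>j\<close>.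

  Two evaluations of means do this.  First, Weil's formula shows that the mean of \<open>S\<^sub>j\<close> over \<open>G/H\<^sub>j\<close>
  is \<open>N/s\<^sub>j\<close>.  Averaging successively with Bruhat functions of
  the \<open>H\<^sub>j\<close> replaces every \<open>S\<^sub>j\<close> by its mean and leaves constants alone, hence \<open>K N = \<Sum>\<^sub>j N/s\<^sub>j\<close>
  (\<open>constant_sum_eq_sum_of_means\<close>, \<open>mean_functional\<close>).  Secondly, integrate
  \<open>\<Sum>\<^sub>j S\<^sub>j = K N\<close> against \<open>|g|\<^sup>2\<close> over \<open>G\<close>: as \<open>S\<^sub>j\<close> is periodic, Weil's formula turns
  \<open>\<integral> S\<^sub>j |g|\<^sup>2\<close> into \<open>\<integral> S\<^sub>j\<^sup>2\<close> over \<open>G/H\<^sub>j\<close>, so that the variances of the \<open>S\<^sub>j\<close> over their quotients add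
  up to \<open>K N\<^sup>2 - \<Sum>\<^sub>j N\<^sup>2/s\<^sub>j = 0\<close> (\<open>variance_of_periodization\<close>).  Hence each \<open>S\<^sub>j\<close> is almost
  everywhere \<open>N/s\<^sub>j\<close>.  By Fatou's lemma \<open>S\<^sub>j\<close> is lower semicontinuous, which upgrades this to
  \<open>S\<^sub>j \<le> N/s\<^sub>j\<close> everywhere, and equality follows because the sums agree
  (\<open>constant_sum_imp_constant_periodizations\<close>).  At \<open>x = 0\<close> this is tightness of each single set
  with constant \<open>1/s\<^sub>j\<close>; the converse is summation over \<open>j\<close>.

  Besides the invariance under translations, harmonic analysis enters in two places.
  Band-limited functions must have continuous representatives, and when \<open>E\<close> is not null there must
  be a nonzero band-limited function, since otherwise the constants would not be determined.  Both follow from one estimate: if \<open>F\<close> is square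
  integrable and vanishes off a band, and \<open>g(x) = \<integral> F(\<gamma>) \<gamma>(x) d\<gamma>\<close>, then the distance in \<open>L\<^sup>2(G)\<close> of
  any \<open>u \<in> L\<^sup>1 \<inter> L\<^sup>2\<close> from \<open>g\<close> is at most that of its Fourier transform from \<open>F\<close>
  (\<open>inverse_fourier_error\<close>).  For the existence of nonzero functions one also needs that the closure of
  the set of Fourier transforms is stable under restriction to Borel sets of characters
  (\<open>fourier_closure_indicator\<close>).  It is stable under multiplication by \<open>\<gamma> \<mapsto> \<gamma>(a)\<close>, because this
  corresponds to translation, and the evaluations generate the Borel sets of the dual group.
\<close>

section \<open>Haar measures on closed subgroups\<close>

lemma space_borel_of [simp]: "space (borel_of T) = topspace T"
  unfolding borel_of_def by (rule space_measure_of) (auto dest: openin_subset)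

lemma sets_borel_of: "sets (borel_of T) = sigma_sets (topspace T) {U. openin T U}"
  unfolding borel_of_def by (rule sets_measure_of) (auto dest: openin_subset)

lemma openin_in_borel_of: "openin T U \<Longrightarrow> U \<in> sets (borel_of T)"
  by (auto simp: sets_borel_of)

lemma closedin_in_borel_of:
  assumes "closedin T C" shows "C \<in> sets (borel_of T)"
proof -
  have "topspace T - C \<in> sets (borel_of T)"
    using assms by (intro openin_in_borel_of) (simp add: closedin_def)
  then have "space (borel_of T) - (topspace T - C) \<in> sets (borel_of T)" by (rule sets.compl_sets)
  then show ?thesis using closedin_subset[OF assms] by (simp add: double_diff)
qed

lemma sets_borel_of_euclidean: "sets (borel_of euclidean) = sets (borel :: 'a::topological_space measure)"
  unfolding sets_borel_of by (simp add: borel_def)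

lemma continuous_map_measurable:
  assumes "sets M = sets (borel_of T)" "continuous_map T euclidean f"
  shows "f \<in> borel_measurable M"
proof (rule borel_measurableI)
  fix S :: "'b set" assume "open S"
  have "space M = topspace T" using sets_eq_imp_space_eq[OF assms(1)] by simp
  then have "f -` S \<inter> space M = {x \<in> topspace T. f x \<in> S}" by auto
  moreover have "openin T {x \<in> topspace T. f x \<in> S}"
    using assms(2) \<open>open S\<close> openin_continuous_map_preimage by fastforce
  ultimately show "f -` S \<inter> space M \<in> sets M"
    using assms(1) openin_in_borel_of by metis
qed

lemma haar_measure_space: "haar_measure T mul M \<Longrightarrow> space M = topspace T"
  using sets_eq_imp_space_eq[of M "borel_of T"] by (simp add: haar_measure_def)

lemma locally_compact_countable_cover:
  assumes "locally_compact_space (euclidean :: 'g::{t2_space,second_countable_topology} topology)"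
  obtains A K :: "nat \<Rightarrow> 'g::{t2_space,second_countable_topology} set"
  where "\<And>i. open (A i)" "\<And>i. compact (K i)" "\<And>i. A i \<subseteq> K i" "(\<Union>i. A i) = UNIV"
proof -
  have "\<forall>x::'g. \<exists>U K. open U \<and> compact K \<and> x \<in> U \<and> U \<subseteq> K"
    using assms unfolding locally_compact_space_def by simp
  then obtain U K where UK: "\<And>x::'g. open (U x)" "\<And>x. compact (K x)" "\<And>x. x \<in> U x" "\<And>x. U x \<subseteq> K x"
    unfolding choice_iff by blast
  obtain \<F> where \<F>: "\<F> \<subseteq> range U" "countable \<F>" "\<Union>\<F> = \<Union>(range U)"
    using Lindelof[of "range U"] UK(1) by blast
  have all: "\<Union>\<F> = UNIV" using \<F>(3) UK(3) by auto
  then have ne: "\<F> \<noteq> {}" by auto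
  define A where "A = from_nat_into \<F>"
  have A: "A i \<in> range U" for i
    using from_nat_into[OF ne] \<F>(1) A_def by blast
  then have "\<forall>i. \<exists>y. A i = U y" by auto
  from choice[OF this] obtain y where y: "\<And>i. A i = U (y i)" by auto
  show thesis
  proof (rule that[of A "\<lambda>i. K (y i)"])
    show "open (A i)" "compact (K (y i))" "A i \<subseteq> K (y i)" for i
      using UK y by auto
    have "(\<Union>i. A i) = \<Union>\<F>" using range_from_nat_into[OF ne \<F>(2)] A_def by simp
    then show "(\<Union>i. A i) = UNIV" using all by simp
  qed
qed

lemma haar_measure_sigma_finite:
  fixes H :: "'g::{topological_ab_group_add,t2_space,second_countable_topology} set"
  assumes lc: "locally_compact_space (euclidean :: 'g topology)"
    and "closed H" and haar: "haar_measure (top_of_set H) mul M"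
  shows "sigma_finite_measure M"
proof -
  obtain A K :: "nat \<Rightarrow> 'g set"
    where *: "\<And>i. open (A i)" "\<And>i. compact (K i)" "\<And>i. A i \<subseteq> K i" "(\<Union>i. A i) = UNIV"
    using locally_compact_countable_cover[OF lc] by blast
  have sets: "sets M = sets (borel_of (top_of_set H))" and sp: "space M = H"
    using haar haar_measure_space[OF haar] by (auto simp: haar_measure_def)
  have cl: "compactin (top_of_set H) (H \<inter> K i)" for i
    using *(2) \<open>closed H\<close> by (auto simp: compactin_subtopology intro: closed_Int_compact)
  have op: "H \<inter> A i \<in> sets M" for i
    unfolding sets using *(1) by (intro openin_in_borel_of) (auto simp: openin_open_Int)
  have clm: "H \<inter> K i \<in> sets M" for i
    unfolding sets using *(2) by (intro closedin_in_borel_of) (simp add: closedin_closed_Int compact_imp_closed)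
  have fin: "emeasure M (H \<inter> A i) \<noteq> \<infinity>" for i
  proof -
    have "emeasure M (H \<inter> A i) \<le> emeasure M (H \<inter> K i)"
      using *(3)[of i] clm by (intro emeasure_mono) auto
    also have "\<dots> < \<infinity>" using cl haar by (simp add: haar_measure_def)
    finally show ?thesis by simp
  qed
  show ?thesis
  proof
    have "(\<Union>i. H \<inter> A i) = space M" using *(4) sp by blast
    then show "\<exists>B. countable B \<and> B \<subseteq> sets M \<and> \<Union>B = space M \<and> (\<forall>a\<in>B. emeasure M a \<noteq> \<infinity>)"
      using op fin by (intro exI[of _ "range (\<lambda>i. H \<inter> A i)"]) auto
  qed
qed

lemma translate_image_eq_vimage: "(+) a ` A = (+) (- a :: 'a::ab_group_add) -` A"
proof (intro set_eqI iffI)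
  fix x assume "x \<in> (+) (- a) -` A"
  then have "- a + x \<in> A" by simp
  moreover have "x = a + (- a + x)" by simp
  ultimately show "x \<in> (+) a ` A" by (rule rev_image_eqI)
qed auto

lemma
  fixes H :: "'g::{topological_ab_group_add,t2_space,second_countable_topology} set"
  assumes sub: "closed_subgroup H" and sets: "sets M = sets (borel_of (top_of_set H))" and a: "a \<in> H"
  shows subgroup_translate_measurable: "(+) a \<in> measurable M M"
    and subgroup_translate_image: "A \<in> sets M \<Longrightarrow> (+) a ` A \<in> sets M"
proof -
  have sp: "space M = H" using sets_eq_imp_space_eq[OF sets] by simp
  have tr: "(+) b \<in> measurable M M" if b: "b \<in> H" for b
  proof (rule measurable_sigma_sets)
    show "sets M = sigma_sets H {U. openin (top_of_set H) U}"
      unfolding sets sets_borel_of by simp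
    show "{U. openin (top_of_set H) U} \<subseteq> Pow H" by (auto dest: openin_imp_subset)
    show "(+) b \<in> space M \<rightarrow> H" using b sub sp by (auto simp: closed_subgroup_def)
    fix U assume "U \<in> {U. openin (top_of_set H) U}"
    then obtain V where V: "open V" "U = H \<inter> V" by (auto simp: openin_open)
    have "(+) b -` U \<inter> space M = H \<inter> (+) b -` V"
      using V b sub sp by (auto simp: closed_subgroup_def)
    moreover have "open ((+) b -` V)"
      by (intro open_vimage V continuous_intros)
    ultimately show "(+) b -` U \<inter> space M \<in> sets M"
      unfolding sets using openin_open_Int openin_in_borel_of by metis
  qed
  show "(+) a \<in> measurable M M" by (rule tr[OF a])
  have am: "- a \<in> H" using a sub by (auto simp: closed_subgroup_def)
  assume A: "A \<in> sets M"
  have "(+) a ` A \<subseteq> H"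
    using sets.sets_into_space[OF A] a sub unfolding sp closed_subgroup_def by blast
  then have "(+) (- a) -` A \<inter> space M = (+) a ` A"
    unfolding sp translate_image_eq_vimage by blast
  then show "(+) a ` A \<in> sets M" using measurable_sets[OF tr[OF am] A] by simp
qed

lemma haar_measure_invariant:
  fixes H :: "'g::{topological_ab_group_add,t2_space,second_countable_topology} set"
  assumes sub: "closed_subgroup H" and haar: "haar_measure (top_of_set H) (+) M" and a: "a \<in> H"
    and f: "f \<in> borel_measurable borel"
  shows "(\<integral>\<^sup>+h. f (a + h) \<partial>M) = (\<integral>\<^sup>+h. f h \<partial>M)"
proof -
  have sets: "sets M = sets (borel_of (top_of_set H))" and sp: "space M = H"
    using haar haar_measure_space[OF haar] by (auto simp: haar_measure_def)
  have id: "(\<lambda>x. x) \<in> borel_measurable M"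
    by (rule continuous_map_measurable[OF sets]) (simp add: continuous_map_iff_continuous)
  have tr: "(+) a \<in> measurable M M" by (rule subgroup_translate_measurable[OF sub sets a])
  have "distr M M ((+) a) = M"
  proof (rule measure_eqI)
    fix A assume "A \<in> sets (distr M M ((+) a))"
    then have A: "A \<in> sets M" by simp
    then have AH: "A \<subseteq> H" using sets.sets_into_space sp by blast
    have am: "- a \<in> H" using a sub by (auto simp: closed_subgroup_def)
    have "(+) (- a) ` A \<subseteq> H" using AH am sub unfolding closed_subgroup_def by blast
    then have "(+) a -` A \<inter> space M = (+) (- a) ` A"
      unfolding sp translate_image_eq_vimage by auto
    then have "emeasure (distr M M ((+) a)) A = emeasure M ((+) (- a) ` A)"
      using A tr by (simp add: emeasure_distr)
    also have "\<dots> = emeasure M A"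
      using haar am A by (auto simp: haar_measure_def)
    finally show "emeasure (distr M M ((+) a)) A = emeasure M A" .
  qed simp
  then have "(\<integral>\<^sup>+h. f h \<partial>M) = (\<integral>\<^sup>+h. f h \<partial>distr M M ((+) a))" by simp
  also have "\<dots> = (\<integral>\<^sup>+h. f (a + h) \<partial>M)"
    using measurable_compose[OF id f] by (intro nn_integral_distr[OF tr]) simp
  finally show ?thesis by simp
qed

section \<open>Weil's formula for nonnegative functions\<close>

text \<open>
  Periodizations take values in \<open>[0,\<infinity>]\<close>. This makes them total, and all manipulations before
  the variance argument free of integrability conditions.
\<close>

definition periodize :: "'g::ab_group_add measure \<Rightarrow> ('g \<Rightarrow> ennreal) \<Rightarrow> 'g \<Rightarrow> ennreal" where
  "periodize \<nu> f x = (\<integral>\<^sup>+h. f (x + h) \<partial>\<nu>)"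

locale haar_group =
  fixes \<mu>G :: "'g::{topological_ab_group_add, t2_space, second_countable_topology} measure"
  assumes locally_compact: "locally_compact_space (euclidean :: 'g topology)"
    and haar: "haar_measure euclidean (+) \<mu>G"
begin

lemma sets_G [simp, measurable_cong]: "sets \<mu>G = sets borel"
  using haar by (simp add: haar_measure_def sets_borel_of_euclidean)

lemma space_G [simp]: "space \<mu>G = UNIV"
  using sets_eq_imp_space_eq[OF sets_G] by simp

sublocale sigma_finite_measure \<mu>G
  using haar_measure_sigma_finite[OF locally_compact, of UNIV] haar by simp

lemma nn_integral_translate:
  "f \<in> borel_measurable borel \<Longrightarrow> (\<integral>\<^sup>+x. f (a + x) \<partial>\<mu>G) = (\<integral>\<^sup>+x. f x \<partial>\<mu>G)"
  using haar_measure_invariant[of UNIV \<mu>G a f] haar by (simp add: closed_subgroup_def)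

end

locale weil_subgroup = haar_group \<mu>G
  for \<mu>G :: "'g::{topological_ab_group_add, t2_space, second_countable_topology} measure" +
  fixes H :: "'g set" and \<nu> :: "'g measure" and Q :: "'g set measure"
  assumes subgroup: "closed_subgroup H"
    and co_compact: "co_compact H"
    and haar_H: "haar_measure (top_of_set H) (+) \<nu>"
    and weil: "weil_measure \<mu>G H \<nu> Q"
begin

abbreviation rep :: "'g set \<Rightarrow> 'g" where "rep c \<equiv> (SOME x. x \<in> c)"

lemma sets_\<nu>: "sets \<nu> = sets (borel_of (top_of_set H))"
  using haar_H by (simp add: haar_measure_def)

lemma space_\<nu> [simp]: "space \<nu> = H"
  using haar_measure_space[OF haar_H] by simp

lemma inclusion_measurable: "(\<lambda>x. x) \<in> measurable \<nu> borel"
  by (rule continuous_map_measurable[OF sets_\<nu>]) simp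

lemma shift_measurable:
  assumes [measurable]: "f \<in> borel_measurable borel"
  shows "(\<lambda>h. f (x + h)) \<in> borel_measurable \<nu>"
  by (rule measurable_compose[OF inclusion_measurable]) measurable

sublocale H: sigma_finite_measure \<nu>
  using haar_measure_sigma_finite[OF locally_compact _ haar_H] subgroup
  by (simp add: closed_subgroup_def)

lemma haar_Q: "haar_measure (quotient_topology H) (+) Q"
  using weil by (simp add: weil_measure_def)

lemma sets_Q: "sets Q = sets (borel_of (quotient_topology H))"
  using haar_Q by (simp add: haar_measure_def)

lemma space_Q [simp]: "space Q = cosets H"
  using haar_measure_space[OF haar_Q] by (simp add: topspace_quotient_topology)

lemma rep_coset: "\<exists>h\<in>H. rep ((+) x ` H) = x + h"
proof -
  have "rep ((+) x ` H) \<in> (+) x ` H"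
    using subgroup by (intro someI_ex[of "\<lambda>y. y \<in> (+) x ` H"]) (auto simp: closed_subgroup_def)
  then show ?thesis by auto
qed

lemma periodize_measurable [measurable]:
  assumes [measurable]: "f \<in> borel_measurable borel"
  shows "periodize \<nu> f \<in> borel_measurable borel"
proof -
  note inclusion_measurable [measurable]
  show ?thesis unfolding periodize_def by measurable
qed

lemma periodize_add:
  assumes [measurable]: "f \<in> borel_measurable borel" and h: "h \<in> H"
  shows "periodize \<nu> f (x + h) = periodize \<nu> f x"
  unfolding periodize_def
  using haar_measure_invariant[OF subgroup haar_H h, of "\<lambda>y. f (x + y)"]
  by (simp add: add.assoc)

lemma periodize_mono: "(\<And>x. f x \<le> g x) \<Longrightarrow> periodize \<nu> f x \<le> periodize \<nu> g x"
  unfolding periodize_def by (intro nn_integral_mono) auto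

text \<open>
  The inner integral of Weil's formula, as a function of the coset, is only known to agree
  almost everywhere with a measurable function \<open>m\<close>. Providing such an \<open>m\<close> lets monotone
  convergence be applied to the outer integral.
\<close>

lemma weil_nn_integral_bounded:
  assumes [measurable]: "f \<in> borel_measurable borel" and B: "\<And>x. f x \<le> ennreal B" "0 \<le> B"
    and fin: "(\<integral>\<^sup>+x. f x \<partial>\<mu>G) < \<infinity>"
  obtains m where "m \<in> borel_measurable Q" "AE c in Q. periodize \<nu> f (rep c) = m c"
    "(\<integral>\<^sup>+x. f x \<partial>\<mu>G) = (\<integral>\<^sup>+c. m c \<partial>Q)"
proof -
  define r where "r x = enn2real (f x)" for x
  have [measurable]: "r \<in> borel_measurable borel" unfolding r_def by measurable
  have rG: "r \<in> borel_measurable \<mu>G" by measurable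
  have fr: "f x = ennreal (r x)" for x
    using B(1)[of x] unfolding r_def by (metis ennreal_enn2real ennreal_less_top le_less_trans)
  have r0: "0 \<le> r x" for x by (simp add: r_def)
  have int: "integrable \<mu>G r"
    using fin fr r0 rG by (intro integrableI_nonneg) auto
  let ?F = "\<lambda>x. complex_of_real (r x)"
  let ?m = "\<lambda>c. \<integral>h. r (rep c + h) \<partial>\<nu>"
  have "integrable \<mu>G ?F" using int by simp
  then have W: "AE c in Q. integrable \<nu> (\<lambda>h. ?F (rep c + h))"
      "integrable Q (\<lambda>c. \<integral>h. ?F (rep c + h) \<partial>\<nu>)"
      "(\<integral>x. ?F x \<partial>\<mu>G) = (\<integral>c. (\<integral>h. ?F (rep c + h) \<partial>\<nu>) \<partial>Q)"
    using weil unfolding weil_measure_def by blast+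
  have mF: "(\<integral>h. ?F (rep c + h) \<partial>\<nu>) = complex_of_real (?m c)" for c by simp
  have im: "integrable Q ?m"
    using W(2) unfolding mF complex_of_real_integrable_eq .
  have eq: "(\<integral>x. r x \<partial>\<mu>G) = (\<integral>c. ?m c \<partial>Q)"
    using W(3) unfolding mF by (simp only: integral_complex_of_real of_real_eq_iff)
  have m0: "0 \<le> ?m c" for c using r0 by (intro Bochner_Integration.integral_nonneg) auto
  show thesis
  proof (rule that[of "\<lambda>c. ennreal (?m c)"])
    show "(\<lambda>c. ennreal (?m c)) \<in> borel_measurable Q"
      using im by (auto dest: borel_measurable_integrable)
    show "AE c in Q. periodize \<nu> f (rep c) = ennreal (?m c)"
      using W(1)
    proof eventually_elim
      case (elim c)
      then have "integrable \<nu> (\<lambda>h. r (rep c + h))"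
        unfolding complex_of_real_integrable_eq .
      then show ?case
        unfolding periodize_def fr using r0 by (intro nn_integral_eq_integral) auto
    qed
    have "(\<integral>\<^sup>+x. f x \<partial>\<mu>G) = ennreal (\<integral>x. r x \<partial>\<mu>G)"
      unfolding fr using int r0 by (intro nn_integral_eq_integral) auto
    also have "\<dots> = (\<integral>\<^sup>+c. ennreal (?m c) \<partial>Q)"
      unfolding eq using im m0 by (intro nn_integral_eq_integral[symmetric]) auto
    finally show "(\<integral>\<^sup>+x. f x \<partial>\<mu>G) = (\<integral>\<^sup>+c. ennreal (?m c) \<partial>Q)" .
  qed
qed

text \<open>
  Weil's formula without integrability hypothesis: truncate \<open>f\<close> in height and to sets of
  finite measure, and pass to the limit in both integrals by monotone convergence.
\<close>

lemma weil_nn_integral: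
  assumes f [measurable]: "f \<in> borel_measurable borel"
  shows "(\<integral>\<^sup>+x. f x \<partial>\<mu>G) = (\<integral>\<^sup>+c. periodize \<nu> f (rep c) \<partial>Q)"
proof -
  obtain A :: "nat \<Rightarrow> 'g set" where A: "range A \<subseteq> sets \<mu>G" "(\<Union>i. A i) = space \<mu>G"
      "\<And>i. emeasure \<mu>G (A i) \<noteq> \<infinity>" "incseq A"
    using sigma_finite_incseq by blast
  have [measurable]: "A i \<in> sets borel" for i using A(1) by auto
  define F where "F k x = min (f x) (of_nat k) * indicator (A k) x" for k x
  have F [measurable]: "F k \<in> borel_measurable borel" for k unfolding F_def by measurable
  have inc: "incseq F"
  proof (rule incseq_SucI, rule le_funI)
    fix k x
    have "indicator (A k) x \<le> (indicator (A (Suc k)) x :: ennreal)"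
      using A(4) by (auto simp: incseq_Suc_iff split: split_indicator)
    moreover have "min (f x) (of_nat k) \<le> min (f x) (of_nat (Suc k))"
      by (intro min.mono) (auto simp del: of_nat_Suc)
    ultimately show "F k x \<le> F (Suc k) x" unfolding F_def by (intro mult_mono) auto
  qed
  have sup: "(SUP k. F k x) = f x" for x
  proof (rule LIMSEQ_unique[OF LIMSEQ_SUP])
    show "incseq (\<lambda>k. F k x)" using inc by (auto simp: incseq_def le_fun_def)
    obtain k0 where k0: "x \<in> A k0" using A(2) by auto
    have "(\<lambda>k. min (f x) (of_nat k)) \<longlonglongrightarrow> min (f x) \<infinity>"
      by (intro tendsto_min tendsto_const) (simp add: of_nat_tendsto_top_ennreal)
    moreover have "\<forall>\<^sub>F k in sequentially. min (f x) (of_nat k) = F k x"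
    proof (rule eventually_sequentiallyI[of k0])
      fix k assume "k0 \<le> k"
      then have "x \<in> A k" using k0 A(4) by (auto simp: incseq_def)
      then show "min (f x) (of_nat k) = F k x" by (simp add: F_def)
    qed
    ultimately show "(\<lambda>k. F k x) \<longlonglongrightarrow> f x"
      by (auto dest: Lim_transform_eventually)
  qed
  have "\<forall>k. \<exists>m. m \<in> borel_measurable Q \<and> (AE c in Q. periodize \<nu> (F k) (rep c) = m c) \<and>
      (\<integral>\<^sup>+x. F k x \<partial>\<mu>G) = (\<integral>\<^sup>+c. m c \<partial>Q)"
  proof
    fix k
    have "(\<integral>\<^sup>+x. F k x \<partial>\<mu>G) \<le> (\<integral>\<^sup>+x. of_nat k * indicator (A k) x \<partial>\<mu>G)"
      unfolding F_def by (intro nn_integral_mono mult_right_mono) auto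
    also have "\<dots> = of_nat k * emeasure \<mu>G (A k)" by (intro nn_integral_cmult_indicator) auto
    also have "\<dots> < \<infinity>"
      using A(3)[of k] by (auto simp: ennreal_mult_less_top less_top ennreal_of_nat_eq_real_of_nat)
    finally have fin: "(\<integral>\<^sup>+x. F k x \<partial>\<mu>G) < \<infinity>" .
    have "F k x \<le> ennreal (of_nat k)" for x
      unfolding F_def by (auto simp: ennreal_of_nat_eq_real_of_nat split: split_indicator)
    from weil_nn_integral_bounded[OF F this _ fin]
    show "\<exists>m. m \<in> borel_measurable Q \<and> (AE c in Q. periodize \<nu> (F k) (rep c) = m c) \<and>
      (\<integral>\<^sup>+x. F k x \<partial>\<mu>G) = (\<integral>\<^sup>+c. m c \<partial>Q)" by (metis of_nat_0_le_iff)
  qed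
  from choice[OF this] obtain m where m: "\<And>k. m k \<in> borel_measurable Q"
    "\<And>k. AE c in Q. periodize \<nu> (F k) (rep c) = m k c"
    "\<And>k. (\<integral>\<^sup>+x. F k x \<partial>\<mu>G) = (\<integral>\<^sup>+c. m k c \<partial>Q)" by blast
  have ae: "AE c in Q. \<forall>k. periodize \<nu> (F k) (rep c) = m k c"
    unfolding AE_all_countable using m(2) by blast
  have per: "periodize \<nu> f x = (SUP k. periodize \<nu> (F k) x)" for x
    unfolding periodize_def sup[symmetric]
  proof (rule nn_integral_monotone_convergence_SUP)
    show "incseq (\<lambda>k h. F k (x + h))" using inc by (auto simp: incseq_def le_fun_def)
  qed (rule shift_measurable[OF F])
  have "(\<integral>\<^sup>+x. f x \<partial>\<mu>G) = (\<integral>\<^sup>+x. (SUP k. F k x) \<partial>\<mu>G)" unfolding sup ..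
  also have "\<dots> = (SUP k. \<integral>\<^sup>+x. F k x \<partial>\<mu>G)"
    by (intro nn_integral_monotone_convergence_SUP inc) measurable
  also have "\<dots> = (SUP k. \<integral>\<^sup>+c. m k c \<partial>Q)" unfolding m(3) ..
  also have "\<dots> = (\<integral>\<^sup>+c. (SUP k. m k c) \<partial>Q)"
  proof (intro nn_integral_monotone_convergence_SUP_AE[symmetric] m(1))
    fix k
    show "AE c in Q. m k c \<le> m (Suc k) c"
      using ae
    proof eventually_elim
      case (elim c)
      have "periodize \<nu> (F k) (rep c) \<le> periodize \<nu> (F (Suc k)) (rep c)"
        using inc by (intro periodize_mono) (auto simp: incseq_Suc_iff le_fun_def)
      then show ?case using elim by simp
    qed
  qed
  also have "\<dots> = (\<integral>\<^sup>+c. periodize \<nu> f (rep c) \<partial>Q)"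
    unfolding per by (intro nn_integral_cong_AE) (use ae in eventually_elim, simp)
  finally show ?thesis .
qed

end

section \<open>Lower semicontinuous and periodic functions\<close>

text \<open>
  The periodization of a continuous function need not be continuous, or even finite, but it
  is lower semicontinuous. This is just enough: superlevel sets are open, so they are
  nonempty only if they have positive measure, and an upper bound that holds almost
  everywhere holds everywhere.
\<close>

definition lower_semicont :: "('a::topological_space \<Rightarrow> ennreal) \<Rightarrow> bool" where
  "lower_semicont f \<longleftrightarrow> (\<forall>a. open {x. a < f x})"

lemma lower_semicont_continuous:
  "continuous_on UNIV f \<Longrightarrow> lower_semicont f"
  unfolding lower_semicont_def by (auto intro!: open_Collect_less continuous_on_const)

lemma lower_semicont_measurable: "lower_semicont f \<Longrightarrow> f \<in> borel_measurable borel"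
  unfolding lower_semicont_def by (intro borel_measurableI_greater) auto

lemma lower_semicont_Liminf:
  assumes "lower_semicont f" "X \<longlonglongrightarrow> x"
  shows "f x \<le> liminf (\<lambda>k. f (X k))"
  unfolding le_Liminf_iff
proof (intro allI impI)
  fix y assume "y < f x"
  then have "open {x. y < f x}" "x \<in> {x. y < f x}"
    using assms(1) by (auto simp: lower_semicont_def)
  from topological_tendstoD[OF assms(2) this]
  show "\<forall>\<^sub>F k in sequentially. y < f (X k)" by simp
qed

context weil_subgroup
begin

definition H_periodic :: "('g \<Rightarrow> ennreal) \<Rightarrow> bool" where
  "H_periodic f \<longleftrightarrow> (\<forall>x. \<forall>h\<in>H. f (x + h) = f x)"

lemma H_periodic_periodize: "f \<in> borel_measurable borel \<Longrightarrow> H_periodic (periodize \<nu> f)"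
  unfolding H_periodic_def using periodize_add by blast

lemma H_periodic_rep: "H_periodic f \<Longrightarrow> f (rep ((+) x ` H)) = f x"
  using rep_coset[of x] unfolding H_periodic_def by auto

text \<open>
  Fatou's lemma along sequences, which suffice because \<open>G\<close> is first countable.
\<close>

lemma lower_semicont_periodize:
  assumes lsc: "lower_semicont f"
  shows "lower_semicont (periodize \<nu> f)"
  unfolding lower_semicont_def
proof
  fix a
  note f = lower_semicont_measurable[OF lsc]
  have "closed {x. periodize \<nu> f x \<le> a}"
    unfolding closed_sequential_limits
  proof (intro allI impI, elim conjE)
    fix X x assume X: "\<forall>k. X k \<in> {x. periodize \<nu> f x \<le> a}" "X \<longlonglongrightarrow> x"
    have "periodize \<nu> f x \<le> (\<integral>\<^sup>+h. liminf (\<lambda>k. f (X k + h)) \<partial>\<nu>)"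
      unfolding periodize_def
    proof (rule nn_integral_mono)
      fix h
      have "(\<lambda>k. X k + h) \<longlonglongrightarrow> x + h" using X(2) by (intro tendsto_intros)
      then show "f (x + h) \<le> liminf (\<lambda>k. f (X k + h))" by (rule lower_semicont_Liminf[OF lsc])
    qed
    also have "\<dots> \<le> liminf (\<lambda>k. periodize \<nu> f (X k))"
      unfolding periodize_def by (intro nn_integral_liminf shift_measurable f)
    also have "\<dots> \<le> limsup (\<lambda>k. periodize \<nu> f (X k))"
      by (rule Liminf_le_Limsup) simp
    also have "\<dots> \<le> a" using X(1) by (intro Limsup_bounded) auto
    finally show "x \<in> {x. periodize \<nu> f x \<le> a}" by simp
  qed
  then show "open {x. a < periodize \<nu> f x}"
    by (simp add: closed_def Collect_neg_eq[symmetric] not_le)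
qed

lemma openin_quotient_superlevel:
  assumes "lower_semicont f" "H_periodic f"
  shows "openin (quotient_topology H) {c \<in> cosets H. a < f (rep c)}"
  using assms H_periodic_rep[OF assms(2)]
  by (simp add: openin_quotient_topology lower_semicont_def cosets_def)

lemma lower_semicont_quotient_measurable:
  assumes "lower_semicont f" "H_periodic f"
  shows "(\<lambda>c. f (rep c)) \<in> borel_measurable Q"
  using openin_in_borel_of[OF openin_quotient_superlevel[OF assms]]
  by (intro borel_measurableI_greater) (simp add: sets_Q)

lemma AE_quotient_le_imp_le:
  assumes f: "lower_semicont f" "H_periodic f" and AE: "AE c in Q. f (rep c) \<le> a"
  shows "f x \<le> a"
proof (rule ccontr)
  assume "\<not> f x \<le> a"
  then have "(+) x ` H \<in> {c \<in> cosets H. a < f (rep c)}"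
    using H_periodic_rep[OF f(2)] by (auto simp: cosets_def)
  then have "emeasure Q {c \<in> cosets H. a < f (rep c)} > 0"
    using haar_Q openin_quotient_superlevel[OF f] unfolding haar_measure_def by blast
  moreover have "{c \<in> cosets H. a < f (rep c)} \<in> sets Q"
    using openin_in_borel_of[OF openin_quotient_superlevel[OF f]] by (simp add: sets_Q)
  ultimately show False
    using AE by (subst (asm) AE_iff_measurable[OF _ refl]) (auto simp: not_le)
qed

abbreviation covolume :: real where "covolume \<equiv> measure Q (cosets H)"

lemma compactin_cosets: "compactin (quotient_topology H) (cosets H)"
  using co_compact by (simp add: co_compact_def compact_space_def topspace_quotient_topology)

sublocale Q: finite_measure Q
proof
  show "emeasure Q (space Q) \<noteq> \<infinity>"
    using haar_Q compactin_cosets by (auto simp: haar_measure_def)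
qed

lemma covolume_pos: "covolume > 0"
proof -
  have "openin (quotient_topology H) (cosets H)"
    by (simp add: openin_quotient_topology cosets_def)
  then have "emeasure Q (cosets H) > 0"
    using haar_Q unfolding haar_measure_def cosets_def by blast
  then show ?thesis by (simp add: Q.emeasure_eq_measure)
qed

lemma emeasure_cosets: "emeasure Q (cosets H) = ennreal covolume"
  by (rule Q.emeasure_eq_measure)

text \<open>
  The images in \<open>G/H\<close> of countably many relatively compact open sets that cover \<open>G\<close> are open, so
  finitely many of them cover the compact quotient.
\<close>

lemma open_relatively_compact_transversal:
  obtains U K where "open U" "compact K" "U \<subseteq> K" "\<And>x. \<exists>h\<in>H. x + h \<in> U"
proof -
  obtain A K :: "nat \<Rightarrow> 'g set"
    where *: "\<And>i. open (A i)" "\<And>i. compact (K i)" "\<And>i. A i \<subseteq> K i" "(\<Union>i. A i) = UNIV"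
    using locally_compact_countable_cover[OF locally_compact] by blast
  define V where "V i = {c \<in> cosets H. c \<inter> A i \<noteq> {}}" for i
  have "openin (quotient_topology H) (V i)" for i
  proof -
    have "{x. (+) x ` H \<in> V i} = (\<Union>h\<in>H. {x. x + h \<in> A i})"
      by (auto simp: V_def cosets_def)
    moreover have "open {x. x + h \<in> A i}" for h
    proof -
      have "continuous_on UNIV (\<lambda>x::'g. x + h)" by (intro continuous_intros)
      from open_vimage[OF *(1) this] show ?thesis by (simp add: vimage_def)
    qed
    ultimately show ?thesis by (auto simp: openin_quotient_topology V_def)
  qed
  moreover have "cosets H \<subseteq> \<Union>(range V)"
  proof
    fix c assume c: "c \<in> cosets H"
    then obtain x where x: "x \<in> c" using subgroup by (auto simp: cosets_def closed_subgroup_def)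
    obtain i where "x \<in> A i" using *(4) by (metis UN_E UNIV_I)
    then show "c \<in> \<Union>(range V)" using c x by (auto simp: V_def)
  qed
  ultimately obtain \<F> where \<F>: "finite \<F>" "\<F> \<subseteq> range V" "cosets H \<subseteq> \<Union>\<F>"
    using compactin_cosets unfolding compactin_def by (metis (no_types, lifting) imageE)
  then obtain I where I: "finite I" "\<F> = V ` I" by (meson finite_subset_image)
  show thesis
  proof (rule that[of "\<Union>i\<in>I. A i" "\<Union>i\<in>I. K i"])
    show "(\<Union>i\<in>I. A i) \<subseteq> (\<Union>i\<in>I. K i)" using *(3) by (rule UN_mono[OF order_refl])
    fix x
    have "(+) x ` H \<in> \<Union>\<F>" using \<F>(3) by (auto simp: cosets_def)
    then show "\<exists>h\<in>H. x + h \<in> (\<Union>i\<in>I. A i)" unfolding I(2) V_def by auto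
  qed (use * I in \<open>auto intro!: compact_UN\<close>)
qed

lemma periodize_mult_periodic:
  assumes [measurable]: "\<phi> \<in> borel_measurable borel" and per: "H_periodic f"
  shows "periodize \<nu> (\<lambda>y. \<phi> y * f y) x = periodize \<nu> \<phi> x * f x"
proof -
  have "periodize \<nu> (\<lambda>y. \<phi> y * f y) x = (\<integral>\<^sup>+h. \<phi> (x + h) * f x \<partial>\<nu>)"
    unfolding periodize_def using per by (intro nn_integral_cong) (auto simp: H_periodic_def)
  also have "\<dots> = periodize \<nu> \<phi> x * f x"
    unfolding periodize_def by (intro nn_integral_multc shift_measurable assms)
  finally show ?thesis .
qed

text \<open>
  The indicator function of a relatively compact open set that meets every coset has a
  periodization \<open>w\<close> with values in \<open>(0,\<infinity>)\<close>. Since \<open>w\<close> is periodic, dividing by it before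
  periodizing is the same as dividing afterwards. The factor \<open>1 / covolume\<close> makes the integral
  over \<open>G\<close> equal to \<open>1\<close>.
\<close>

lemma bruhat_function:
  obtains \<phi> :: "'g \<Rightarrow> ennreal" where "\<phi> \<in> borel_measurable borel"
    "\<And>x. periodize \<nu> \<phi> x = ennreal (1 / covolume)"
proof -
  obtain U K where UK: "open U" "compact K" "U \<subseteq> K" "\<And>x. \<exists>h\<in>H. x + h \<in> U"
    using open_relatively_compact_transversal by blast
  have [measurable]: "U \<in> sets borel" "K \<in> sets borel" using UK by (auto intro: borel_compact)
  define w where "w = periodize \<nu> (indicator U)"
  have wU: "w x = emeasure \<nu> {h \<in> H. x + h \<in> U}" for x
  proof -
    have "w x = (\<integral>\<^sup>+h. indicator {h \<in> H. x + h \<in> U} h \<partial>\<nu>)"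
      unfolding w_def periodize_def by (intro nn_integral_cong) (auto split: split_indicator)
    also have "\<dots> = emeasure \<nu> {h \<in> H. x + h \<in> U}"
      using measurable_sets_Collect[OF inclusion_measurable, of "\<lambda>h. x + h \<in> U"] by simp
    finally show ?thesis .
  qed
  have w0: "w x > 0" for x
  proof -
    have "open ((+) x -` U)" by (intro open_vimage UK continuous_intros)
    then have "openin (top_of_set H) (H \<inter> (+) x -` U)" by (rule openin_open_Int)
    moreover have "H \<inter> (+) x -` U \<noteq> {}" using UK(4)[of x] by auto
    ultimately have "emeasure \<nu> (H \<inter> (+) x -` U) > 0"
      using haar_H by (auto simp: haar_measure_def)
    moreover have "H \<inter> (+) x -` U = {h \<in> H. x + h \<in> U}" by auto
    ultimately show ?thesis by (simp add: wU)
  qed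
  have wfin: "w x < \<infinity>" for x
  proof -
    have "compact ((+) (- x) ` K)" by (intro compact_continuous_image UK continuous_intros)
    then have "compactin (top_of_set H) (H \<inter> (+) (- x) ` K)"
      using subgroup by (auto simp: compactin_subtopology closed_subgroup_def intro: closed_Int_compact)
    then have "emeasure \<nu> (H \<inter> (+) (- x) ` K) < \<infinity>"
      using haar_H by (auto simp: haar_measure_def)
    moreover have "H \<inter> (+) (- x) ` K = {h \<in> H. x + h \<in> K}"
    proof (intro set_eqI iffI)
      fix h assume "h \<in> {h \<in> H. x + h \<in> K}"
      moreover have "h = - x + (x + h)" by simp
      ultimately show "h \<in> H \<inter> (+) (- x) ` K" by blast
    qed auto
    moreover have "w x \<le> emeasure \<nu> {h \<in> H. x + h \<in> K}"
      unfolding wU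
      using UK(3) measurable_sets_Collect[OF inclusion_measurable, of "\<lambda>h. x + h \<in> K"]
      by (intro emeasure_mono) auto
    ultimately show ?thesis by (metis le_less_trans)
  qed
  have wm [measurable]: "w \<in> borel_measurable borel" unfolding w_def by measurable
  define v where "v x = inverse (w x) * ennreal (1 / covolume)" for x
  have wper: "H_periodic w" unfolding w_def by (intro H_periodic_periodize) measurable
  then have vper: "H_periodic v" by (auto simp: H_periodic_def v_def)
  show thesis
  proof (rule that[of "\<lambda>x. indicator U x * v x"])
    show "(\<lambda>x. indicator U x * v x) \<in> borel_measurable borel" unfolding v_def by measurable
    fix x
    have "periodize \<nu> (\<lambda>x. indicator U x * v x) x = w x * v x"
      unfolding w_def by (intro periodize_mult_periodic vper) measurable
    also have "\<dots> = (w x * inverse (w x)) * ennreal (1 / covolume)"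
      unfolding v_def by (simp add: mult.assoc)
    also have "w x * inverse (w x) = 1"
    proof -
      have "w x / w x = 1" using w0[of x] wfin[of x] by (intro ennreal_divide_self) auto
      then show ?thesis by (simp add: divide_ennreal_def)
    qed
    finally show "periodize \<nu> (\<lambda>x. indicator U x * v x) x = ennreal (1 / covolume)" by simp
  qed
qed

end

section \<open>Means of periodic functions\<close>

text \<open>
  With \<open>\<integral> \<phi> = 1\<close> this is an average of translates of \<open>f\<close>.
\<close>

definition average :: "'g::ab_group_add measure \<Rightarrow> ('g \<Rightarrow> ennreal) \<Rightarrow> ('g \<Rightarrow> ennreal) \<Rightarrow> 'g \<Rightarrow> ennreal"
  where "average M \<phi> f x = (\<integral>\<^sup>+y. \<phi> y * f (x + y) \<partial>M)"

context haar_group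
begin

lemma average_measurable [measurable]:
  assumes [measurable]: "\<phi> \<in> borel_measurable borel" "f \<in> borel_measurable borel"
  shows "average \<mu>G \<phi> f \<in> borel_measurable borel"
  unfolding average_def by measurable

lemma average_const:
  assumes [measurable]: "\<phi> \<in> borel_measurable borel" and "(\<integral>\<^sup>+y. \<phi> y \<partial>\<mu>G) = 1"
  shows "average \<mu>G \<phi> (\<lambda>_. c) x = c"
  unfolding average_def using assms by (simp add: nn_integral_multc)

lemma average_commute:
  assumes [measurable]: "\<phi> \<in> borel_measurable borel" "\<psi> \<in> borel_measurable borel"
    "f \<in> borel_measurable borel"
  shows "average \<mu>G \<phi> (average \<mu>G \<psi> f) x = average \<mu>G \<psi> (average \<mu>G \<phi> f) x"
proof -
  interpret pair_sigma_finite \<mu>G \<mu>G ..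
  have "average \<mu>G \<phi> (average \<mu>G \<psi> f) x = (\<integral>\<^sup>+y. (\<integral>\<^sup>+z. \<phi> y * (\<psi> z * f (x + y + z)) \<partial>\<mu>G) \<partial>\<mu>G)"
    unfolding average_def by (intro nn_integral_cong nn_integral_cmult[symmetric]) measurable
  also have "\<dots> = (\<integral>\<^sup>+z. (\<integral>\<^sup>+y. \<phi> y * (\<psi> z * f (x + y + z)) \<partial>\<mu>G) \<partial>\<mu>G)"
    by (rule Fubini'[symmetric]) measurable
  also have "\<dots> = (\<integral>\<^sup>+z. (\<integral>\<^sup>+y. \<psi> z * (\<phi> y * f (x + z + y)) \<partial>\<mu>G) \<partial>\<mu>G)"
    by (simp add: ac_simps)
  also have "\<dots> = average \<mu>G \<psi> (average \<mu>G \<phi> f) x"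
    unfolding average_def by (intro nn_integral_cong nn_integral_cmult) measurable
  finally show ?thesis .
qed

text \<open>
  Averaging by \<open>\<phi> i\<close> turns \<open>f i\<close> into the constant \<open>m i\<close> and preserves the hypothesis on every
  other \<open>f j\<close>, because averages commute. Hence the summands can be replaced by constants one
  at a time; \<open>r\<close> collects the constants already produced.
\<close>

lemma constant_sum_eq_sum_of_means:
  assumes "finite J"
    and "\<And>j. j \<in> J \<Longrightarrow> \<phi> j \<in> borel_measurable borel"
    and "\<And>j. j \<in> J \<Longrightarrow> (\<integral>\<^sup>+y. \<phi> j y \<partial>\<mu>G) = 1"
    and "\<And>j. j \<in> J \<Longrightarrow> f j \<in> borel_measurable borel"
    and "\<And>j x. j \<in> J \<Longrightarrow> average \<mu>G (\<phi> j) (f j) x = m j"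
    and "\<And>x. (\<Sum>j\<in>J. f j x) + r = C"
  shows "(\<Sum>j\<in>J. m j) + r = C"
  using assms
proof (induction J arbitrary: f r rule: finite_induct)
  case empty
  then show ?case by simp
next
  case (insert i J)
  have [measurable]: "\<phi> i \<in> borel_measurable borel" "f i \<in> borel_measurable borel"
    using insert.prems(1,3) by auto
  have mJ [measurable]: "\<phi> j \<in> borel_measurable borel" "f j \<in> borel_measurable borel" if "j \<in> J" for j
    using insert.prems(1,3) that by auto
  have "(\<Sum>j\<in>J. m j) + (m i + r) = C"
  proof (rule insert.IH)
    fix j assume j: "j \<in> J"
    show "\<phi> j \<in> borel_measurable borel" "(\<integral>\<^sup>+y. \<phi> j y \<partial>\<mu>G) = 1"
      using insert.prems j by auto
    show "average \<mu>G (\<phi> i) (f j) \<in> borel_measurable borel"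
      using mJ(2)[OF j] by measurable
    fix x
    have "average \<mu>G (\<phi> j) (average \<mu>G (\<phi> i) (f j)) x = average \<mu>G (\<phi> i) (average \<mu>G (\<phi> j) (f j)) x"
      using mJ[OF j] by (intro average_commute) auto
    also have "average \<mu>G (\<phi> j) (f j) = (\<lambda>_. m j)" using insert.prems(4) j by auto
    also have "average \<mu>G (\<phi> i) (\<lambda>_. m j) x = m j"
      using insert.prems(1,2)[of i] by (intro average_const) auto
    finally show "average \<mu>G (\<phi> j) (average \<mu>G (\<phi> i) (f j)) x = m j" .
  next
    fix x
    have sm: "(\<lambda>y. (\<Sum>j\<in>J. f j (x + y))) \<in> borel_measurable \<mu>G"
      by (intro borel_measurable_sum) (use mJ(2) in measurable)
    have "C = average \<mu>G (\<phi> i) (\<lambda>_. C) x"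
      using insert.prems(1,2)[of i] by (intro average_const[symmetric]) auto
    also have "\<dots> = (\<integral>\<^sup>+y. \<phi> i y * (\<Sum>j\<in>J. f j (x + y)) + (\<phi> i y * f i (x + y) + \<phi> i y * r) \<partial>\<mu>G)"
      unfolding average_def
    proof (rule nn_integral_cong)
      fix y
      have "C = (\<Sum>j\<in>J. f j (x + y)) + (f i (x + y) + r)"
        using insert.prems(5)[of "x + y"] insert.hyps by (simp add: ac_simps)
      then show "\<phi> i y * C
          = \<phi> i y * (\<Sum>j\<in>J. f j (x + y)) + (\<phi> i y * f i (x + y) + \<phi> i y * r)"
        by (simp add: distrib_left)
    qed
    also have "\<dots> = (\<integral>\<^sup>+y. (\<Sum>j\<in>J. \<phi> i y * f j (x + y)) \<partial>\<mu>G)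
        + (average \<mu>G (\<phi> i) (f i) x + average \<mu>G (\<phi> i) (\<lambda>_. r) x)"
      unfolding average_def sum_distrib_left[symmetric]
      using sm by (simp add: nn_integral_add)
    also have "(\<integral>\<^sup>+y. (\<Sum>j\<in>J. \<phi> i y * f j (x + y)) \<partial>\<mu>G) = (\<Sum>j\<in>J. average \<mu>G (\<phi> i) (f j) x)"
      unfolding average_def by (intro nn_integral_sum) (use mJ(2) in measurable)
    also have "average \<mu>G (\<phi> i) (\<lambda>_. r) x = r"
      using insert.prems(1,2)[of i] by (intro average_const) auto
    also have "average \<mu>G (\<phi> i) (f i) x = m i" using insert.prems(4) by auto
    finally show "(\<Sum>j\<in>J. average \<mu>G (\<phi> i) (f j) x) + (m i + r) = C" by simp
  qed
  then show ?case using insert.hyps by (simp add: ac_simps)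
qed

end

context weil_subgroup
begin

text \<open>
  Averaging by a Bruhat function of \<open>H\<close> sends an \<open>H\<close>-periodic function to its mean over \<open>G/H\<close>, by
  Weil's formula.
\<close>

lemma mean_functional:
  obtains \<phi> where "\<phi> \<in> borel_measurable borel" "(\<integral>\<^sup>+y. \<phi> y \<partial>\<mu>G) = 1"
    "\<And>f x. f \<in> borel_measurable borel \<Longrightarrow>
       average \<mu>G \<phi> (periodize \<nu> f) x = (\<integral>\<^sup>+y. f y \<partial>\<mu>G) * ennreal (1 / covolume)"
proof -
  obtain \<phi> where \<phi> [measurable]: "\<phi> \<in> borel_measurable borel"
    and p\<phi>: "\<And>x. periodize \<nu> \<phi> x = ennreal (1 / covolume)"
    using bruhat_function by blast
  show thesis
  proof (rule that[OF \<phi>])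
    have "(\<integral>\<^sup>+y. \<phi> y \<partial>\<mu>G) = ennreal (1 / covolume) * ennreal covolume"
      using weil_nn_integral[OF \<phi>] by (simp add: p\<phi> emeasure_cosets)
    also have "\<dots> = 1" using covolume_pos by (simp flip: ennreal_mult)
    finally show "(\<integral>\<^sup>+y. \<phi> y \<partial>\<mu>G) = 1" .
    fix f :: "'g \<Rightarrow> ennreal" and x
    assume f [measurable]: "f \<in> borel_measurable borel"
    define P where "P y = periodize \<nu> f (x + y)" for y
    have Pm [measurable]: "P \<in> borel_measurable borel" unfolding P_def by measurable
    have P: "P = periodize \<nu> (\<lambda>y. f (x + y))"
      unfolding P_def periodize_def by (simp add: add.assoc)
    have Pper: "H_periodic P" unfolding P by (intro H_periodic_periodize) measurable
    have "average \<mu>G \<phi> (periodize \<nu> f) x = (\<integral>\<^sup>+c. periodize \<nu> (\<lambda>y. \<phi> y * P y) (rep c) \<partial>Q)"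
      unfolding average_def P_def[symmetric] by (intro weil_nn_integral) measurable
    also have "\<dots> = (\<integral>\<^sup>+c. ennreal (1 / covolume) * P (rep c) \<partial>Q)"
      by (simp add: periodize_mult_periodic[OF \<phi> Pper] p\<phi>)
    also have "\<dots> = (\<integral>\<^sup>+c. periodize \<nu> (\<lambda>y. ennreal (1 / covolume) * f (x + y)) (rep c) \<partial>Q)"
      unfolding P periodize_def
      by (intro nn_integral_cong nn_integral_cmult[symmetric] shift_measurable) measurable
    also have "\<dots> = (\<integral>\<^sup>+y. ennreal (1 / covolume) * f (x + y) \<partial>\<mu>G)"
      by (intro weil_nn_integral[symmetric]) measurable
    also have "\<dots> = ennreal (1 / covolume) * (\<integral>\<^sup>+y. f (x + y) \<partial>\<mu>G)"
      by (intro nn_integral_cmult) measurable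
    also have "(\<integral>\<^sup>+y. f (x + y) \<partial>\<mu>G) = (\<integral>\<^sup>+y. f y \<partial>\<mu>G)" by (rule nn_integral_translate[OF f])
    finally show "average \<mu>G \<phi> (periodize \<nu> f) x = (\<integral>\<^sup>+y. f y \<partial>\<mu>G) * ennreal (1 / covolume)"
      by (simp add: mult.commute)
  qed
qed

end

section \<open>Variance of periodizations\<close>

context weil_subgroup
begin

text \<open>
  In Weil's formula the periodic factor comes out of the inner integral, which leaves a
  second copy of the periodization.
\<close>

lemma integral_mult_periodize:
  assumes f [measurable]: "f \<in> borel_measurable borel"
  shows "(\<integral>\<^sup>+x. f x * periodize \<nu> f x \<partial>\<mu>G) = (\<integral>\<^sup>+c. (periodize \<nu> f (rep c))\<^sup>2 \<partial>Q)"
proof -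
  have "(\<integral>\<^sup>+x. f x * periodize \<nu> f x \<partial>\<mu>G)
      = (\<integral>\<^sup>+c. periodize \<nu> (\<lambda>x. f x * periodize \<nu> f x) (rep c) \<partial>Q)"
    by (intro weil_nn_integral) measurable
  then show ?thesis
    by (simp add: periodize_mult_periodic[OF f H_periodic_periodize[OF f]] power2_eq_square)
qed

text \<open>
  Since \<open>t\<close> has integral \<open>N\<close> over \<open>G/H\<close>, its mean is \<open>N / covolume\<close>. The last identity is the usual
  expression of the variance by the second moment.
\<close>

lemma variance_of_periodization:
  assumes lsc: "lower_semicont f" and N: "(\<integral>\<^sup>+x. f x \<partial>\<mu>G) = ennreal N" "0 \<le> N"
    and bd: "\<And>x. periodize \<nu> f x \<le> ennreal C"
  defines "t \<equiv> \<lambda>c. enn2real (periodize \<nu> f (rep c))"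
  shows "integrable Q t" "integrable Q (\<lambda>c. (t c)\<^sup>2)"
    "\<And>c. periodize \<nu> f (rep c) = ennreal (t c)"
    "(\<integral>\<^sup>+x. f x * periodize \<nu> f x \<partial>\<mu>G) = ennreal (\<integral>c. (t c)\<^sup>2 \<partial>Q)"
    "(\<integral>c. (t c - N / covolume)\<^sup>2 \<partial>Q) = (\<integral>c. (t c)\<^sup>2 \<partial>Q) - N\<^sup>2 / covolume"
proof -
  have f [measurable]: "f \<in> borel_measurable borel" by (rule lower_semicont_measurable[OF lsc])
  have per: "H_periodic (periodize \<nu> f)" by (rule H_periodic_periodize[OF f])
  have tm [measurable]: "t \<in> borel_measurable Q"
    using lower_semicont_quotient_measurable[OF lower_semicont_periodize[OF lsc] per]
    unfolding t_def by measurable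
  show pt: "periodize \<nu> f (rep c) = ennreal (t c)" for c
    unfolding t_def
    by (rule ennreal_enn2real[OF le_less_trans[OF bd ennreal_less_top], symmetric])
  have t0: "0 \<le> t c" for c by (simp add: t_def)
  have tC: "t c \<le> max C 0" for c
    using bd[of "rep c"] unfolding pt by (auto simp: ennreal_le_iff2 max_def split: if_splits)
  show i1: "integrable Q t"
    by (rule Q.integrable_const_bound[of _ "max C 0"]) (use t0 tC in auto)
  show i2: "integrable Q (\<lambda>c. (t c)\<^sup>2)"
    by (rule Q.integrable_const_bound[of _ "(max C 0)\<^sup>2"]) (use t0 tC in \<open>auto intro!: power_mono\<close>)
  show "(\<integral>\<^sup>+x. f x * periodize \<nu> f x \<partial>\<mu>G) = ennreal (\<integral>c. (t c)\<^sup>2 \<partial>Q)"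
    unfolding integral_mult_periodize[OF f] pt using i2 t0
    by (simp add: ennreal_power nn_integral_eq_integral)
  have "ennreal N = ennreal (\<integral>c. t c \<partial>Q)"
    using weil_nn_integral[OF f] i1 t0 N unfolding pt by (simp add: nn_integral_eq_integral)
  then have mean: "(\<integral>c. t c \<partial>Q) = N"
    using N(2) t0 by (simp add: Bochner_Integration.integral_nonneg)
  have "(\<integral>c. (t c - N / covolume)\<^sup>2 \<partial>Q)
      = (\<integral>c. (t c)\<^sup>2 - (2 * N / covolume) * t c + (N / covolume)\<^sup>2 \<partial>Q)"
    by (intro Bochner_Integration.integral_cong) (auto simp: power2_eq_square algebra_simps)
  also have "\<dots> = (\<integral>c. (t c)\<^sup>2 \<partial>Q) - (2 * N / covolume) * N + (N / covolume)\<^sup>2 * covolume"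
    using i1 i2 mean by simp
  also have "\<dots> = (\<integral>c. (t c)\<^sup>2 \<partial>Q) - N\<^sup>2 / covolume"
    using covolume_pos by (simp add: power2_eq_square field_simps)
  finally show "(\<integral>c. (t c - N / covolume)\<^sup>2 \<partial>Q) = (\<integral>c. (t c)\<^sup>2 \<partial>Q) - N\<^sup>2 / covolume" .
qed

end

text \<open>
  The means give \<open>C = \<Sum>\<^sub>j N/s\<^sub>j\<close>; then the integral of the constant against \<open>f\<close> shows that the
  variances of the periodizations have sum \<open>0\<close>.
\<close>

theorem constant_sum_imp_constant_periodizations:
  fixes \<mu>G :: "'g::{topological_ab_group_add, t2_space, second_countable_topology} measure"
  assumes J: "finite J"
    and W: "\<And>j. j \<in> J \<Longrightarrow> weil_subgroup \<mu>G (H j) (\<nu> j) (Q j)"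
    and lsc: "lower_semicont f" and N: "(\<integral>\<^sup>+x. f x \<partial>\<mu>G) = ennreal N" "0 \<le> N"
    and const: "\<And>x. (\<Sum>j\<in>J. periodize (\<nu> j) f x) = ennreal C"
    and j: "j \<in> J"
  shows "periodize (\<nu> j) f x = ennreal (N / measure (Q j) (cosets (H j)))"
proof -
  let ?s = "\<lambda>j. measure (Q j) (cosets (H j))"
  interpret Wj: weil_subgroup \<mu>G "H j" "\<nu> j" "Q j" by (rule W[OF j])
  have f [measurable]: "f \<in> borel_measurable borel" by (rule lower_semicont_measurable[OF lsc])
  have spos: "?s i > 0" if "i \<in> J" for i
    using weil_subgroup.covolume_pos[OF W[OF that]] .
  have "\<forall>i\<in>J. \<exists>\<phi>. \<phi> \<in> borel_measurable borel \<and> (\<integral>\<^sup>+y. \<phi> y \<partial>\<mu>G) = 1 \<and>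
      (\<forall>x. average \<mu>G \<phi> (periodize (\<nu> i) f) x = ennreal (N / ?s i))"
  proof
    fix i assume i: "i \<in> J"
    interpret Wi: weil_subgroup \<mu>G "H i" "\<nu> i" "Q i" by (rule W[OF i])
    obtain \<phi> where \<phi>: "\<phi> \<in> borel_measurable borel" "(\<integral>\<^sup>+y. \<phi> y \<partial>\<mu>G) = 1"
      "\<And>f x. f \<in> borel_measurable borel \<Longrightarrow>
        average \<mu>G \<phi> (periodize (\<nu> i) f) x = (\<integral>\<^sup>+y. f y \<partial>\<mu>G) * ennreal (1 / Wi.covolume)"
      using Wi.mean_functional by blast
    have "average \<mu>G \<phi> (periodize (\<nu> i) f) x = ennreal (N / ?s i)" for x
      unfolding \<phi>(3)[OF f] N(1) using N(2) by (simp flip: ennreal_mult)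
    then show "\<exists>\<phi>. \<phi> \<in> borel_measurable borel \<and> (\<integral>\<^sup>+y. \<phi> y \<partial>\<mu>G) = 1 \<and>
      (\<forall>x. average \<mu>G \<phi> (periodize (\<nu> i) f) x = ennreal (N / ?s i))"
      using \<phi>(1,2) by blast
  qed
  from bchoice[OF this] obtain \<phi> where \<phi>: "\<And>i. i \<in> J \<Longrightarrow> \<phi> i \<in> borel_measurable borel"
    "\<And>i. i \<in> J \<Longrightarrow> (\<integral>\<^sup>+y. \<phi> i y \<partial>\<mu>G) = 1"
    "\<And>i x. i \<in> J \<Longrightarrow> average \<mu>G (\<phi> i) (periodize (\<nu> i) f) x = ennreal (N / ?s i)"
    by blast
  have "(\<Sum>i\<in>J. ennreal (N / ?s i)) + 0 = ennreal C"
  proof (rule Wj.constant_sum_eq_sum_of_means[OF J, of \<phi> "\<lambda>i. periodize (\<nu> i) f"])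
    show "periodize (\<nu> i) f \<in> borel_measurable borel" if "i \<in> J" for i
      using weil_subgroup.periodize_measurable[OF W[OF that] f] .
  qed (use \<phi> const in auto)
  then have C: "ennreal C = ennreal (\<Sum>i\<in>J. N / ?s i)"
    using spos N(2) by (simp add: sum_ennreal less_imp_le)
  have C': "(\<Sum>i\<in>J. periodize (\<nu> i) f x) = ennreal (\<Sum>i\<in>J. N / ?s i)" for x
    using const C by simp
  have bd: "periodize (\<nu> i) f x \<le> ennreal C" if "i \<in> J" for i x
    unfolding const[of x, symmetric] using J that by (intro member_le_sum) auto
  define t where "t i c = enn2real (periodize (\<nu> i) f (SOME x. x \<in> c))" for i c
  note var = weil_subgroup.variance_of_periodization[OF W lsc N bd, folded t_def]
  define V where "V i = (\<integral>c. (t i c - N / ?s i)\<^sup>2 \<partial>Q i)" for i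
  have V0: "0 \<le> V i" for i unfolding V_def by (intro Bochner_Integration.integral_nonneg) auto
  have V: "V i = (\<integral>c. (t i c)\<^sup>2 \<partial>Q i) - N\<^sup>2 / ?s i" if "i \<in> J" for i
    using var(5)[OF that that] unfolding V_def .
  \<comment> \<open>The sum of the second moments is the integral of \<open>f\<close> times the constant, that is \<open>N C\<close>.\<close>
  have "ennreal (\<Sum>i\<in>J. \<integral>c. (t i c)\<^sup>2 \<partial>Q i) = (\<Sum>i\<in>J. \<integral>\<^sup>+x. f x * periodize (\<nu> i) f x \<partial>\<mu>G)"
    using var(4) by (simp add: sum_ennreal Bochner_Integration.integral_nonneg)
  also have "\<dots> = (\<integral>\<^sup>+x. f x * (\<Sum>i\<in>J. periodize (\<nu> i) f x) \<partial>\<mu>G)"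
    unfolding sum_distrib_left
    by (intro nn_integral_sum[symmetric])
      (use weil_subgroup.periodize_measurable[OF W f] in measurable)
  also have "\<dots> = ennreal N * ennreal (\<Sum>i\<in>J. N / ?s i)"
    unfolding C' by (simp add: nn_integral_multc N)
  also have "\<dots> = ennreal (\<Sum>i\<in>J. N\<^sup>2 / ?s i)"
    using N(2) by (simp add: sum_distrib_left power2_eq_square flip: ennreal_mult')
  finally have "(\<Sum>i\<in>J. \<integral>c. (t i c)\<^sup>2 \<partial>Q i) = (\<Sum>i\<in>J. N\<^sup>2 / ?s i)"
    using spos by (subst (asm) ennreal_inj)
      (auto intro!: sum_nonneg Bochner_Integration.integral_nonneg simp: less_imp_le)
  then have "(\<Sum>i\<in>J. V i) = 0" using V by (simp add: sum_subtractf)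
  then have Vi: "V i = 0" if "i \<in> J" for i
    using that J V0 by (simp add: sum_nonneg_eq_0_iff)
  \<comment> \<open>Vanishing variance gives equality almost everywhere; semicontinuity keeps one inequality everywhere.\<close>
  have le: "periodize (\<nu> i) f x \<le> ennreal (N / ?s i)" if i: "i \<in> J" for i x
  proof -
    interpret Wi: weil_subgroup \<mu>G "H i" "\<nu> i" "Q i" by (rule W[OF i])
    have "integrable (Q i) (\<lambda>c. (t i c - N / ?s i)\<^sup>2)"
      using var(1,2)[OF i i] by (auto simp: power2_diff)
    then have "AE c in Q i. (t i c - N / ?s i)\<^sup>2 = 0"
      using Vi[OF i] unfolding V_def by (subst (asm) integral_nonneg_eq_0_iff_AE) auto
    then have "AE c in Q i. periodize (\<nu> i) f (SOME x. x \<in> c) \<le> ennreal (N / ?s i)"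
      by eventually_elim (simp add: var(3)[OF i i])
    then show ?thesis
      by (rule Wi.AE_quotient_le_imp_le[OF Wi.lower_semicont_periodize[OF lsc] Wi.H_periodic_periodize[OF f]])
  qed
  have eq: "periodize (\<nu> i) f x = ennreal (enn2real (periodize (\<nu> i) f x))" if "i \<in> J" for i
    by (rule ennreal_enn2real[OF le_less_trans[OF bd[OF that] ennreal_less_top], symmetric])
  have "ennreal (\<Sum>i\<in>J. enn2real (periodize (\<nu> i) f x)) = ennreal (\<Sum>i\<in>J. N / ?s i)"
  proof -
    have "(\<Sum>i\<in>J. periodize (\<nu> i) f x) = (\<Sum>i\<in>J. ennreal (enn2real (periodize (\<nu> i) f x)))"
      by (intro sum.cong refl eq)
    then show ?thesis unfolding C'[of x] by (simp add: sum_ennreal)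
  qed
  then have "(\<Sum>i\<in>J. enn2real (periodize (\<nu> i) f x)) = (\<Sum>i\<in>J. N / ?s i)"
    using spos N(2) by (subst (asm) ennreal_inj) (auto intro!: sum_nonneg simp: less_imp_le)
  then have "(\<Sum>i\<in>J. N / ?s i - enn2real (periodize (\<nu> i) f x)) = 0"
    by (simp add: sum_subtractf)
  moreover have "0 \<le> N / ?s i - enn2real (periodize (\<nu> i) f x)" if "i \<in> J" for i
    using le[OF that, of x] spos[OF that] N(2) eq[OF that]
    by (metis diff_ge_0_iff_ge divide_nonneg_pos enn2real_leI)
  ultimately have "N / ?s j - enn2real (periodize (\<nu> j) f x) = 0"
    using j J by (simp add: sum_nonneg_eq_0_iff)
  then show ?thesis using eq[OF j] by simp
qed

section \<open>Square integrable functions\<close>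

lemma cmod_add_sq_le: "(cmod (a + b))\<^sup>2 \<le> 2 * (cmod a)\<^sup>2 + 2 * (cmod b)\<^sup>2"
proof -
  have "(cmod (a + b))\<^sup>2 \<le> (cmod a + cmod b)\<^sup>2"
    by (intro power_mono norm_triangle_ineq) auto
  also have "\<dots> \<le> 2 * (cmod a)\<^sup>2 + 2 * (cmod b)\<^sup>2"
    using sum_squares_bound[of "cmod a" "cmod b"] by (simp add: power2_sum)
  finally show ?thesis .
qed

lemma cmod_mult_le: "cmod (a * cnj b) \<le> ((cmod a)\<^sup>2 + (cmod b)\<^sup>2) / 2"
  using sum_squares_bound[of "cmod a" "cmod b"] by (simp add: norm_mult)

lemma L2_measurable [measurable_dest]: "f \<in> L2 M \<Longrightarrow> f \<in> borel_measurable M"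
  by (simp add: L2_def)

lemma L2_integrable: "f \<in> L2 M \<Longrightarrow> integrable M (\<lambda>x. (cmod (f x))\<^sup>2)"
  by (simp add: L2_def)

lemma L2_norm_sq_nonneg: "0 \<le> L2_norm_sq M f"
  unfolding L2_norm_sq_def by (intro Bochner_Integration.integral_nonneg) auto

lemma L2_bound:
  assumes [measurable]: "f \<in> borel_measurable M"
    and "integrable M g" "\<And>x. x \<in> space M \<Longrightarrow> (cmod (f x))\<^sup>2 \<le> g x"
  shows "f \<in> L2 M" "L2_norm_sq M f \<le> (\<integral>x. g x \<partial>M)"
proof -
  have i: "integrable M (\<lambda>x. (cmod (f x))\<^sup>2)"
    by (rule Bochner_Integration.integrable_bound[OF assms(2)])
      (auto intro!: AE_I2 order_trans[OF assms(3) abs_ge_self])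
  then show "f \<in> L2 M" by (simp add: L2_def)
  show "L2_norm_sq M f \<le> (\<integral>x. g x \<partial>M)"
    unfolding L2_norm_sq_def by (intro integral_mono i assms)
qed

lemma
  assumes f: "f \<in> L2 M" and g: "g \<in> L2 M"
  shows L2_add: "(\<lambda>x. f x + g x) \<in> L2 M"
    and L2_norm_sq_add_le: "L2_norm_sq M (\<lambda>x. f x + g x) \<le> 2 * L2_norm_sq M f + 2 * L2_norm_sq M g"
proof -
  note [measurable] = L2_measurable[OF f] L2_measurable[OF g]
  have i: "integrable M (\<lambda>x. 2 * (cmod (f x))\<^sup>2 + 2 * (cmod (g x))\<^sup>2)"
    using L2_integrable[OF f] L2_integrable[OF g] by simp
  show "(\<lambda>x. f x + g x) \<in> L2 M"
    by (rule L2_bound[OF _ i]) (auto intro: cmod_add_sq_le)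
  have "L2_norm_sq M (\<lambda>x. f x + g x) \<le> (\<integral>x. 2 * (cmod (f x))\<^sup>2 + 2 * (cmod (g x))\<^sup>2 \<partial>M)"
    by (rule L2_bound[OF _ i]) (auto intro: cmod_add_sq_le)
  then show "L2_norm_sq M (\<lambda>x. f x + g x) \<le> 2 * L2_norm_sq M f + 2 * L2_norm_sq M g"
    using L2_integrable[OF f] L2_integrable[OF g] by (simp add: L2_norm_sq_def)
qed

lemma
  assumes f: "f \<in> L2 M" and [measurable]: "h \<in> borel_measurable M"
    and B: "\<And>x. x \<in> space M \<Longrightarrow> cmod (h x) \<le> B"
  shows L2_mult_bounded: "(\<lambda>x. f x * h x) \<in> L2 M"
    and L2_norm_sq_mult_bounded: "L2_norm_sq M (\<lambda>x. f x * h x) \<le> B\<^sup>2 * L2_norm_sq M f"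
proof -
  note [measurable] = L2_measurable[OF f]
  have i: "integrable M (\<lambda>x. B\<^sup>2 * (cmod (f x))\<^sup>2)" using L2_integrable[OF f] by simp
  have b: "(cmod (f x * h x))\<^sup>2 \<le> B\<^sup>2 * (cmod (f x))\<^sup>2" if "x \<in> space M" for x
  proof -
    have "(cmod (h x))\<^sup>2 \<le> B\<^sup>2" using B[OF that] by (intro power_mono) auto
    then have "(cmod (f x))\<^sup>2 * (cmod (h x))\<^sup>2 \<le> (cmod (f x))\<^sup>2 * B\<^sup>2"
      by (intro mult_left_mono) auto
    then show ?thesis by (simp add: norm_mult power_mult_distrib mult.commute)
  qed
  show "(\<lambda>x. f x * h x) \<in> L2 M" by (rule L2_bound[OF _ i b]) auto
  have "L2_norm_sq M (\<lambda>x. f x * h x) \<le> (\<integral>x. B\<^sup>2 * (cmod (f x))\<^sup>2 \<partial>M)"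
    by (rule L2_bound[OF _ i b]) auto
  then show "L2_norm_sq M (\<lambda>x. f x * h x) \<le> B\<^sup>2 * L2_norm_sq M f" by (simp add: L2_norm_sq_def)
qed

lemma L2_uminus: "f \<in> L2 M \<Longrightarrow> (\<lambda>x. - f x) \<in> L2 M"
  by (simp add: L2_def)

lemma L2_diff: "f \<in> L2 M \<Longrightarrow> g \<in> L2 M \<Longrightarrow> (\<lambda>x. f x - g x) \<in> L2 M"
  using L2_add[OF _ L2_uminus, of f M g] by simp

lemma L2_norm_sq_diff_commute: "L2_norm_sq M (\<lambda>x. f x - g x) = L2_norm_sq M (\<lambda>x. g x - f x)"
  by (simp add: L2_norm_sq_def norm_minus_commute)

lemma L2_norm_sq_triangle:
  assumes "f \<in> L2 M" "g \<in> L2 M" "h \<in> L2 M"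
  shows "L2_norm_sq M (\<lambda>x. f x - h x)
    \<le> 2 * L2_norm_sq M (\<lambda>x. f x - g x) + 2 * L2_norm_sq M (\<lambda>x. g x - h x)"
  using L2_norm_sq_add_le[OF L2_diff[OF assms(1,2)] L2_diff[OF assms(2,3)]] by simp

lemma borel_measurable_cnj [measurable (raw)]:
  "f \<in> borel_measurable M \<Longrightarrow> (\<lambda>x. cnj (f x)) \<in> borel_measurable M"
  by (rule measurable_compose[OF _ borel_measurable_continuous_onI]) (auto intro: continuous_intros)

lemma L2_inner_integrable:
  assumes f: "f \<in> L2 M" and g: "g \<in> L2 M"
  shows "integrable M (\<lambda>x. f x * cnj (g x))"
proof (rule Bochner_Integration.integrable_bound)
  show "integrable M (\<lambda>x. ((cmod (f x))\<^sup>2 + (cmod (g x))\<^sup>2) / 2)"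
    using L2_integrable[OF f] L2_integrable[OF g] by simp
  show "AE x in M. norm (f x * cnj (g x)) \<le> norm (((cmod (f x))\<^sup>2 + (cmod (g x))\<^sup>2) / 2)"
    using cmod_mult_le by (intro AE_I2) (auto intro: order_trans[OF _ abs_ge_self])
qed (use f g in measurable)

text \<open>
  Where the Cauchy-Schwarz inequality would be expected, the arithmetic-geometric mean is
  enough: if the squared norm of \<open>g\<close> equals its pairing with \<open>f\<close>, it is at most the squared norm
  of \<open>f\<close>.
\<close>

lemma L2_inner_le:
  assumes f: "f \<in> L2 M" and g: "g \<in> L2 M"
  shows "cmod (\<integral>x. f x * cnj (g x) \<partial>M) \<le> (L2_norm_sq M f + L2_norm_sq M g) / 2"
proof -
  have "cmod (\<integral>x. f x * cnj (g x) \<partial>M) \<le> (\<integral>x. cmod (f x * cnj (g x)) \<partial>M)"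
    by (rule integral_norm_bound)
  also have "\<dots> \<le> (\<integral>x. ((cmod (f x))\<^sup>2 + (cmod (g x))\<^sup>2) / 2 \<partial>M)"
    using L2_inner_integrable[OF f g] L2_integrable[OF f] L2_integrable[OF g]
    by (intro integral_mono cmod_mult_le) auto
  also have "\<dots> = (L2_norm_sq M f + L2_norm_sq M g) / 2"
    using L2_integrable[OF f] L2_integrable[OF g] by (simp add: L2_norm_sq_def)
  finally show ?thesis .
qed

lemma L2_norm_sq_add:
  assumes f: "f \<in> L2 M" and g: "g \<in> L2 M"
  shows "L2_norm_sq M (\<lambda>x. f x + g x)
    = L2_norm_sq M f + L2_norm_sq M g + 2 * Re (\<integral>x. f x * cnj (g x) \<partial>M)"
proof -
  have "(cmod (f x + g x))\<^sup>2 = (cmod (f x))\<^sup>2 + (cmod (g x))\<^sup>2 + 2 * Re (f x * cnj (g x))" for x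
    unfolding cmod_power2 by (simp add: power2_eq_square algebra_simps)
  then have "L2_norm_sq M (\<lambda>x. f x + g x)
      = (\<integral>x. (cmod (f x))\<^sup>2 + (cmod (g x))\<^sup>2 + 2 * Re (f x * cnj (g x)) \<partial>M)"
    unfolding L2_norm_sq_def by presburger
  also have "\<dots> = L2_norm_sq M f + L2_norm_sq M g + 2 * (\<integral>x. Re (f x * cnj (g x)) \<partial>M)"
    using L2_integrable[OF f] L2_integrable[OF g] integrable_Re[OF L2_inner_integrable[OF f g]]
    unfolding L2_norm_sq_def by (simp del: times_complex.sel)
  also have "(\<integral>x. Re (f x * cnj (g x)) \<partial>M) = Re (\<integral>x. f x * cnj (g x) \<partial>M)"
    by (rule integral_Re[OF L2_inner_integrable[OF f g]])
  finally show ?thesis .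
qed

lemma L2_norm_sq_zero_iff:
  assumes "f \<in> L2 M"
  shows "L2_norm_sq M f = 0 \<longleftrightarrow> (AE x in M. f x = 0)"
  unfolding L2_norm_sq_def using integral_nonneg_eq_0_iff_AE[OF L2_integrable[OF assms]] by simp

lemma L2_norm_sq_cong: "(\<And>x. x \<in> space M \<Longrightarrow> f x = g x) \<Longrightarrow> L2_norm_sq M f = L2_norm_sq M g"
  unfolding L2_norm_sq_def by (intro Bochner_Integration.integral_cong) auto

lemma L2_cong: "(\<And>x. x \<in> space M \<Longrightarrow> f x = g x) \<Longrightarrow> f \<in> L2 M \<longleftrightarrow> g \<in> L2 M"
proof -
  assume "\<And>x. x \<in> space M \<Longrightarrow> f x = g x"
  then have "f \<in> borel_measurable M \<longleftrightarrow> g \<in> borel_measurable M"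
    "integrable M (\<lambda>x. (cmod (f x))\<^sup>2) \<longleftrightarrow> integrable M (\<lambda>x. (cmod (g x))\<^sup>2)"
    by (auto intro!: measurable_cong Bochner_Integration.integrable_cong)
  then show ?thesis by (simp add: L2_def)
qed

lemma L2_norm_sq_cong_AE:
  "f \<in> borel_measurable M \<Longrightarrow> g \<in> borel_measurable M \<Longrightarrow> (AE x in M. f x = g x) \<Longrightarrow>
    L2_norm_sq M f = L2_norm_sq M g"
  unfolding L2_norm_sq_def by (intro integral_cong_AE) auto

lemma L2_mult_dominated:
  assumes F: "F \<in> L2 M" and [measurable]: "\<And>k. h k \<in> borel_measurable M" "h' \<in> borel_measurable M"
    and lim: "\<And>x. x \<in> space M \<Longrightarrow> (\<lambda>k. h k x) \<longlonglongrightarrow> h' x"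
    and bd: "\<And>k x. x \<in> space M \<Longrightarrow> cmod (h k x - h' x) \<le> B"
  shows "(\<lambda>k. L2_norm_sq M (\<lambda>x. F x * h k x - F x * h' x)) \<longlonglongrightarrow> 0"
proof -
  note [measurable] = L2_measurable[OF F]
  have "(\<lambda>k. \<integral>x. (cmod (F x * h k x - F x * h' x))\<^sup>2 \<partial>M) \<longlonglongrightarrow> (\<integral>x. 0 \<partial>M)"
  proof (rule integral_dominated_convergence)
    show "integrable M (\<lambda>x. B\<^sup>2 * (cmod (F x))\<^sup>2)" using L2_integrable[OF F] by simp
    show "AE x in M. (\<lambda>k. (cmod (F x * h k x - F x * h' x))\<^sup>2) \<longlonglongrightarrow> 0"
    proof (rule AE_I2)
      fix x assume "x \<in> space M"
      then have "(\<lambda>k. (cmod (F x * h k x - F x * h' x))\<^sup>2) \<longlonglongrightarrow> (cmod (F x * h' x - F x * h' x))\<^sup>2"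
        by (intro tendsto_intros lim)
      then show "(\<lambda>k. (cmod (F x * h k x - F x * h' x))\<^sup>2) \<longlonglongrightarrow> 0" by simp
    qed
    show "AE x in M. norm ((cmod (F x * h k x - F x * h' x))\<^sup>2) \<le> B\<^sup>2 * (cmod (F x))\<^sup>2" for k
    proof (rule AE_I2)
      fix x assume "x \<in> space M"
      from bd[OF this, of k] have "(cmod (h k x - h' x))\<^sup>2 \<le> B\<^sup>2" by (intro power_mono) auto
      then show "norm ((cmod (F x * h k x - F x * h' x))\<^sup>2) \<le> B\<^sup>2 * (cmod (F x))\<^sup>2"
        by (simp flip: right_diff_distrib add: norm_mult power_mult_distrib mult_left_mono mult.commute[of "B\<^sup>2"])
    qed
  qed measurable
  then show ?thesis by (simp add: L2_norm_sq_def)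
qed

section \<open>Borel sets of the dual group\<close>

definition evaluation_sets :: "('g::topological_ab_group_add \<Rightarrow> complex) set set" where
  "evaluation_sets = {{\<gamma> \<in> characters. \<gamma> x \<in> K} |x K. closed K}"

lemma topspace_dual_topology [simp]: "topspace dual_topology = characters"
proof -
  have "UNIV \<in> {{\<gamma>. \<gamma> ` C \<subseteq> U} |C U. compact C \<and> open U}"
    by (intro CollectI exI[of _ "{}"] exI[of _ UNIV]) auto
  then have "(\<Union>{{\<gamma>. \<gamma> ` C \<subseteq> U} |C U. compact C \<and> open U}) = UNIV" by blast
  then show ?thesis
    unfolding dual_topology_def topspace_subtopology topology_generated_by_topspace by blast
qed

text \<open>
  The compact-open topology has an uncountable subbase \<open>{\<gamma>. \<gamma> ` K \<subseteq> U}\<close>. As \<open>G\<close> is second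
  countable, the sets \<open>{\<gamma>. \<gamma> ` b \<subseteq> closure v}\<close> with \<open>b\<close> and \<open>v\<close> from countable bases can be used
  instead: finitely many of them separate a given \<open>\<gamma>\<close> from the complement of a subbasic set.
  They need not be open, but by continuity each is a countable intersection of evaluation
  sets at points of a countable dense subset of \<open>G\<close>.
\<close>

lemma open_dual_in_sigma_evaluation_sets:
  fixes W :: "('g::{topological_ab_group_add, t2_space, second_countable_topology} \<Rightarrow> complex) set"
  assumes "openin dual_topology W"
  shows "W \<in> sigma_sets characters evaluation_sets"
proof -
  let ?S = "sigma (characters :: ('g \<Rightarrow> complex) set) evaluation_sets"
  have pow: "evaluation_sets \<subseteq> Pow (characters :: ('g \<Rightarrow> complex) set)"
    by (auto simp: evaluation_sets_def)
  have sp: "space ?S = characters" and st: "sets ?S = sigma_sets characters evaluation_sets"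
    using pow by (auto simp: space_measure_of sets_measure_of)
  obtain B :: "'g set set" where B: "countable B" "topological_basis B"
    using ex_countable_basis by blast
  obtain C :: "complex set set" where C: "countable C" "topological_basis C"
    using ex_countable_basis by blast
  obtain D :: "'g set" where D: "countable D" "\<And>X. open X \<Longrightarrow> X \<noteq> {} \<Longrightarrow> \<exists>d\<in>D. d \<in> X"
    using countable_dense_setE by blast
  define cell where "cell b v = {\<gamma> \<in> characters. \<gamma> ` b \<subseteq> closure v}" for b :: "'g set" and v :: "complex set"
  have cell: "cell b v \<in> sets ?S" if b: "open b" for b v
  proof -
    have "cell b v = (\<Inter>d\<in>b \<inter> D. {\<gamma> \<in> characters. \<gamma> d \<in> closure v}) \<inter> characters"
    proof (intro equalityI subsetI)
      fix \<gamma> assume *: "\<gamma> \<in> (\<Inter>d\<in>b \<inter> D. {\<gamma> \<in> characters. \<gamma> d \<in> closure v}) \<inter> characters"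
      then have c: "continuous_on UNIV \<gamma>" by (auto simp: characters_def)
      have "open (b \<inter> \<gamma> -` (- closure v))"
        using b by (intro open_Int open_vimage[OF _ c]) auto
      then have "b \<inter> \<gamma> -` (- closure v) = {}" using D(2) * by fastforce
      then show "\<gamma> \<in> cell b v" using * by (auto simp: cell_def)
    qed (auto simp: cell_def)
    moreover have "{\<gamma> \<in> characters. \<gamma> d \<in> closure v} \<in> sets ?S" for d :: 'g
      unfolding st by (intro sigma_sets.Basic) (auto simp: evaluation_sets_def)
    moreover have "characters \<in> sets ?S" using sets.top[of ?S] sp by simp
    ultimately show ?thesis
      using D(1) by (cases "b \<inter> D = {}") (auto intro!: sets.countable_INT')
  qed
  define \<S> where "\<S> = (\<lambda>(b, v). cell b v) ` (B \<times> C)"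
  define \<B> where "\<B> = (\<lambda>T. characters \<inter> \<Inter>T) ` {T. finite T \<and> T \<subseteq> \<S>}"
  have "countable \<S>" unfolding \<S>_def using B C by auto
  then have cB: "countable \<B>" unfolding \<B>_def
    by (intro countable_image countable_Collect_finite_subset)
  have \<S>: "T \<in> sets ?S" if "T \<in> \<S>" for T
  proof -
    obtain b v where "b \<in> B" "T = cell b v" using \<open>T \<in> \<S>\<close> by (auto simp: \<S>_def)
    then show ?thesis using cell[of b v] topological_basis_open[OF B(2)] by simp
  qed
  have \<B>: "T \<in> sets ?S" if "T \<in> \<B>" for T
  proof -
    obtain F where F: "finite F" "F \<subseteq> \<S>" "T = characters \<inter> \<Inter>F" using \<open>T \<in> \<B>\<close> unfolding \<B>_def by blast
    have "characters \<inter> \<Inter>F \<in> sets ?S"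
      using F(1,2)
    proof (induction F rule: finite_induct)
      case empty
      then show ?case using sets.top[of ?S] sp by simp
    next
      case (insert x F)
      have "characters \<inter> \<Inter>(insert x F) = x \<inter> (characters \<inter> \<Inter>F)" by auto
      then show ?case using insert \<S> by auto
    qed
    then show ?thesis using F(3) by simp
  qed
  have Int: "S \<inter> T \<in> \<B>" if ST: "S \<in> \<B>" "T \<in> \<B>" for S T
  proof -
    obtain F where F: "finite F" "F \<subseteq> \<S>" "S = characters \<inter> \<Inter>F" using ST(1) unfolding \<B>_def by blast
    obtain G where G: "finite G" "G \<subseteq> \<S>" "T = characters \<inter> \<Inter>G" using ST(2) unfolding \<B>_def by blast
    have "S \<inter> T = characters \<inter> \<Inter>(F \<union> G)" using F(3) G(3) by auto
    then show ?thesis unfolding \<B>_def using F G by (intro image_eqI[of _ _ "F \<union> G"]) auto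
  qed
  obtain T where T: "openin (topology_generated_by {{\<gamma>. \<gamma> ` K \<subseteq> U} |K U. compact K \<and> open U}) T"
      "W = T \<inter> characters"
    using assms by (auto simp: dual_topology_def openin_subtopology)
  have gen: "\<exists>S\<in>\<B>. \<gamma> \<in> S \<and> S \<subseteq> T" if "\<gamma> \<in> T" "\<gamma> \<in> characters" for \<gamma>
    using T(1)[unfolded openin_topology_generated_by_iff] that
  proof (induction T arbitrary: \<gamma> rule: generate_topology_on.induct)
    case Empty
    then show ?case by simp
  next
    case (Int a b)
    obtain S where "S \<in> \<B>" "\<gamma> \<in> S" "S \<subseteq> a" using Int.IH(1)[of \<gamma>] Int.prems by auto
    moreover obtain T where "T \<in> \<B>" "\<gamma> \<in> T" "T \<subseteq> b" using Int.IH(2)[of \<gamma>] Int.prems by auto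
    ultimately show ?case using \<open>\<And>S T. S \<in> \<B> \<Longrightarrow> T \<in> \<B> \<Longrightarrow> S \<inter> T \<in> \<B>\<close>
      by (intro bexI[of _ "S \<inter> T"]) auto
  next
    case (UN K)
    then obtain k where "k \<in> K" "\<gamma> \<in> k" by auto
    then show ?case using UN.IH[of k \<gamma>] UN.prems by (meson Union_upper order_trans)
  next
    case (Basis s)
    then obtain K U where KU: "s = {\<gamma>. \<gamma> ` K \<subseteq> U}" "compact K" "open U" by auto
    have c: "continuous_on UNIV \<gamma>" using Basis.prems by (auto simp: characters_def)
    have "\<forall>x\<in>K. \<exists>p. p \<in> B \<times> C \<and> x \<in> fst p \<and> \<gamma> ` fst p \<subseteq> closure (snd p) \<and> closure (snd p) \<subseteq> U"
    proof
      fix x assume "x \<in> K"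
      then have "\<gamma> x \<in> U" using Basis.prems KU by auto
      then obtain e where e: "e > 0" "cball (\<gamma> x) e \<subseteq> U"
        using KU(3) open_contains_cball by blast
      obtain v where v: "v \<in> C" "\<gamma> x \<in> v" "v \<subseteq> ball (\<gamma> x) e"
        by (rule topological_basisE[OF C(2), of "ball (\<gamma> x) e" "\<gamma> x"]) (use e(1) in auto)
      have "open v" using v(1) C(2) topological_basis_open by blast
      then have "open (\<gamma> -` v)" by (rule open_vimage[OF _ c])
      moreover have "x \<in> \<gamma> -` v" using v(2) by simp
      ultimately obtain b where b: "b \<in> B" "x \<in> b" "b \<subseteq> \<gamma> -` v"
        by (rule topological_basisE[OF B(2)])
      have "closure v \<subseteq> cball (\<gamma> x) e"
        using v(3) ball_subset_cball closed_cball by (meson closure_minimal order_trans)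
      then show "\<exists>p. p \<in> B \<times> C \<and> x \<in> fst p \<and> \<gamma> ` fst p \<subseteq> closure (snd p) \<and> closure (snd p) \<subseteq> U"
        using v b e(2) closure_subset[of v] by (intro exI[of _ "(b, v)"]) auto
    qed
    from bchoice[OF this] obtain p where p: "\<And>x. x \<in> K \<Longrightarrow> p x \<in> B \<times> C"
      "\<And>x. x \<in> K \<Longrightarrow> x \<in> fst (p x)" "\<And>x. x \<in> K \<Longrightarrow> \<gamma> ` fst (p x) \<subseteq> closure (snd (p x))"
      "\<And>x. x \<in> K \<Longrightarrow> closure (snd (p x)) \<subseteq> U" by blast
    have "open (fst (p x))" if "x \<in> K" for x
      using p(1)[OF that] B(2) topological_basis_open by (auto simp: mem_Times_iff)
    moreover have "K \<subseteq> (\<Union>x\<in>K. fst (p x))" using p(2) by auto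
    ultimately obtain K' where K': "K' \<subseteq> K" "finite K'" "K \<subseteq> (\<Union>x\<in>K'. fst (p x))"
      by (rule compactE_image[OF KU(2), of K "\<lambda>x. fst (p x)"])
    let ?T = "characters \<inter> \<Inter>((\<lambda>x. cell (fst (p x)) (snd (p x))) ` K')"
    have "?T \<in> \<B>" unfolding \<B>_def
    proof (intro imageI CollectI conjI)
      show "(\<lambda>x. cell (fst (p x)) (snd (p x))) ` K' \<subseteq> \<S>"
        using p(1) K'(1) unfolding \<S>_def by (force simp: case_prod_beta)
    qed (use K' in auto)
    moreover have "\<gamma> \<in> ?T" using Basis.prems(2) p(3) K'(1) by (auto simp: cell_def)
    moreover have "?T \<subseteq> s"
    proof
      fix \<delta> assume \<delta>: "\<delta> \<in> ?T"
      have "\<delta> y \<in> U" if y: "y \<in> K" for y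
      proof -
        obtain x where x: "x \<in> K'" "y \<in> fst (p x)" using K'(3) y by auto
        then have "\<delta> ` fst (p x) \<subseteq> closure (snd (p x))" using \<delta> by (auto simp: cell_def)
        then show ?thesis using x p(4) K'(1) by blast
      qed
      then show "\<delta> \<in> s" using KU(1) by auto
    qed
    ultimately show ?case by (intro bexI[of _ ?T] conjI)
  qed
  have "S \<subseteq> characters" if "S \<in> \<B>" for S using that by (auto simp: \<B>_def)
  then have "W = \<Union>{S \<in> \<B>. S \<subseteq> T}"
    unfolding T(2) using gen by (intro equalityI subsetI) (blast, auto)
  also have "\<dots> \<in> sets ?S" using cB \<B> by (intro sets.countable_Union) auto
  finally show ?thesis unfolding st .
qed

lemma evaluation_measurable:
  assumes "sets M = sets (borel_of dual_topology)"
  shows "(\<lambda>\<gamma>. \<gamma> x) \<in> borel_measurable M"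
proof (rule continuous_map_measurable[OF assms])
  show "continuous_map dual_topology euclidean (\<lambda>\<gamma>. \<gamma> x)"
    unfolding continuous_map_def
  proof (intro conjI allI impI)
    fix U :: "complex set" assume "openin euclidean U"
    then have "{\<gamma>. \<gamma> ` {x} \<subseteq> U} \<in> {{\<gamma>. \<gamma> ` C \<subseteq> U} |C U. compact C \<and> open U}"
      by (auto intro!: exI[of _ "{x}"] exI[of _ U])
    then have "openin dual_topology ({\<gamma>. \<gamma> ` {x} \<subseteq> U} \<inter> characters)"
      unfolding dual_topology_def openin_subtopology
      by (intro exI[of _ "{\<gamma>. \<gamma> ` {x} \<subseteq> U}"] conjI refl topology_generated_by_Basis)
    moreover have "{\<gamma>. \<gamma> ` {x} \<subseteq> U} \<inter> characters = {\<gamma> \<in> topspace dual_topology. \<gamma> x \<in> U}" by auto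
    ultimately show "openin dual_topology {\<gamma> \<in> topspace dual_topology. \<gamma> x \<in> U}" by simp
  qed simp
qed

section \<open>The closure of the set of Fourier transforms\<close>

lemma character_norm: "\<gamma> \<in> characters \<Longrightarrow> cmod (\<gamma> x) = 1"
  and character_add: "\<gamma> \<in> characters \<Longrightarrow> \<gamma> (x + y) = \<gamma> x * \<gamma> y"
  and character_continuous: "\<gamma> \<in> characters \<Longrightarrow> continuous_on UNIV \<gamma>"
  by (auto simp: characters_def)

lemma character_measurable: "\<gamma> \<in> characters \<Longrightarrow> \<gamma> \<in> borel_measurable borel"
  using character_continuous by (rule borel_measurable_continuous_onI)

lemma character_zero: "\<gamma> \<in> characters \<Longrightarrow> \<gamma> 0 = 1"
  using character_add[of \<gamma> 0 0] character_norm[of \<gamma> 0] by auto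

lemma character_uminus:
  assumes "\<gamma> \<in> characters" shows "\<gamma> (- x) = cnj (\<gamma> x)"
proof -
  have "\<gamma> x * \<gamma> (- x) = 1"
    using character_add[OF assms, of x "- x"] character_zero[OF assms] by simp
  moreover have "\<gamma> x * cnj (\<gamma> x) = 1"
    using character_norm[OF assms, of x] by (simp add: complex_norm_square[symmetric])
  ultimately show ?thesis by (metis mult_cancel_left mult_zero_left zero_neq_one)
qed

locale plancherel_group = haar_group \<mu>G
  for \<mu>G :: "'g::{topological_ab_group_add, t2_space, second_countable_topology} measure" +
  fixes \<mu>D :: "('g \<Rightarrow> complex) measure"
  assumes dual_haar: "dual_haar_measure \<mu>D"
    and plancherel: "plancherel_normalized \<mu>G \<mu>D"
begin

lemma sets_D: "sets \<mu>D = sets (borel_of dual_topology)"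
  using dual_haar by (simp add: dual_haar_measure_def haar_measure_def)

lemma space_D [simp]: "space \<mu>D = characters"
  using sets_eq_imp_space_eq[OF sets_D] by simp

lemma evaluation_measurable_D [measurable]: "(\<lambda>\<gamma>. \<gamma> x) \<in> borel_measurable \<mu>D"
  by (rule evaluation_measurable[OF sets_D])

lemma distr_translate: "distr \<mu>G \<mu>G ((+) a) = \<mu>G"
proof (rule measure_eqI)
  fix A assume "A \<in> sets (distr \<mu>G \<mu>G ((+) a))"
  then have [measurable]: "A \<in> sets borel" by simp
  have "emeasure (distr \<mu>G \<mu>G ((+) a)) A = (\<integral>\<^sup>+x. indicator A x \<partial>distr \<mu>G \<mu>G ((+) a))"
    by simp
  also have "\<dots> = (\<integral>\<^sup>+x. indicator A (a + x) \<partial>\<mu>G)"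
    by (intro nn_integral_distr) measurable
  also have "\<dots> = emeasure \<mu>G A" by (subst nn_integral_translate) auto
  finally show "emeasure (distr \<mu>G \<mu>G ((+) a)) A = emeasure \<mu>G A" .
qed simp

lemma
  fixes f :: "'g \<Rightarrow> 'b::{banach, second_countable_topology}"
  assumes [measurable]: "f \<in> borel_measurable borel"
  shows integral_translate: "(\<integral>x. f (a + x) \<partial>\<mu>G) = (\<integral>x. f x \<partial>\<mu>G)"
    and integrable_translate_iff: "integrable \<mu>G (\<lambda>x. f (a + x)) \<longleftrightarrow> integrable \<mu>G f"
proof -
  have t: "(+) a \<in> measurable \<mu>G \<mu>G" and f: "f \<in> borel_measurable \<mu>G" by measurable
  show "(\<integral>x. f (a + x) \<partial>\<mu>G) = (\<integral>x. f x \<partial>\<mu>G)"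
    using integral_distr[OF t f] unfolding distr_translate by (rule sym)
  show "integrable \<mu>G (\<lambda>x. f (a + x)) \<longleftrightarrow> integrable \<mu>G f"
    using integrable_distr_eq[OF t f] unfolding distr_translate by (rule sym)
qed

lemma AE_translate:
  assumes [measurable]: "Measurable.pred borel P" and "AE x in \<mu>G. P x"
  shows "AE x in \<mu>G. P (a + x)"
proof -
  have "(+) a \<in> measurable \<mu>G \<mu>G" by measurable
  moreover have "{x \<in> space \<mu>G. P x} \<in> sets \<mu>G" by measurable
  ultimately have "(AE x in \<mu>G. P x) \<longleftrightarrow> (AE x in \<mu>G. P (a + x))"
    using AE_distr_iff[of "(+) a" \<mu>G \<mu>G P] unfolding distr_translate by blast
  then show ?thesis using assms(2) by simp
qed

lemma measurable_G_iff: "f \<in> borel_measurable \<mu>G \<longleftrightarrow> f \<in> borel_measurable borel"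
  by (simp cong: measurable_cong_sets)

lemma L2_G_measurable: "f \<in> L2 \<mu>G \<Longrightarrow> f \<in> borel_measurable borel"
  by (drule L2_measurable) (simp only: measurable_G_iff)

lemma integrable_G_measurable: "integrable \<mu>G (f :: 'g \<Rightarrow> complex) \<Longrightarrow> f \<in> borel_measurable borel"
  by (drule borel_measurable_integrable) (simp only: measurable_G_iff)

lemma L2_translate:
  assumes f: "f \<in> L2 \<mu>G" shows "(\<lambda>x. f (a + x)) \<in> L2 \<mu>G"
proof -
  note [measurable] = L2_G_measurable[OF f]
  have "integrable \<mu>G (\<lambda>x. (cmod (f (a + x)))\<^sup>2)"
    using L2_integrable[OF f] by (subst integrable_translate_iff[of "\<lambda>x. (cmod (f x))\<^sup>2" a]) auto
  moreover have "(\<lambda>x. f (a + x)) \<in> borel_measurable \<mu>G" by measurable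
  ultimately show ?thesis by (simp add: L2_def)
qed

lemma L2_norm_sq_translate:
  assumes [measurable]: "f \<in> borel_measurable borel"
  shows "L2_norm_sq \<mu>G (\<lambda>x. f (a + x)) = L2_norm_sq \<mu>G f"
  unfolding L2_norm_sq_def by (rule integral_translate) measurable

definition L1_L2 :: "('g \<Rightarrow> complex) \<Rightarrow> bool" where
  "L1_L2 u \<longleftrightarrow> integrable \<mu>G u \<and> u \<in> L2 \<mu>G"

lemma fourier_L2: "L1_L2 u \<Longrightarrow> fourier \<mu>G u \<in> L2 \<mu>D"
  and fourier_norm: "L1_L2 u \<Longrightarrow> L2_norm_sq \<mu>D (fourier \<mu>G u) = L2_norm_sq \<mu>G u"
  using plancherel by (auto simp: plancherel_normalized_def L1_L2_def)

lemma L1_L2_add: "L1_L2 u \<Longrightarrow> L1_L2 v \<Longrightarrow> L1_L2 (\<lambda>x. u x + v x)"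
  by (auto simp: L1_L2_def intro: L2_add)

lemma L1_L2_cmult: "L1_L2 u \<Longrightarrow> L1_L2 (\<lambda>x. c * u x)"
  using L2_mult_bounded[of u \<mu>G "\<lambda>_. c" "cmod c"] by (auto simp: L1_L2_def mult.commute)

lemma L1_L2_translate: "L1_L2 u \<Longrightarrow> L1_L2 (\<lambda>x. u (a + x))"
  using L2_translate[of u a] integrable_translate_iff[of u a] integrable_G_measurable[of u]
  by (auto simp: L1_L2_def)

lemma fourier_integrable:
  assumes "integrable \<mu>G u" "\<gamma> \<in> characters"
  shows "integrable \<mu>G (\<lambda>x. u x * cnj (\<gamma> x))"
proof (rule Bochner_Integration.integrable_bound[OF assms(1)])
  note [measurable] = character_measurable[OF assms(2)] integrable_G_measurable[OF assms(1)]
  show "(\<lambda>x. u x * cnj (\<gamma> x)) \<in> borel_measurable \<mu>G" by measurable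
qed (simp add: norm_mult character_norm[OF assms(2)])

lemma fourier_add:
  "integrable \<mu>G u \<Longrightarrow> integrable \<mu>G v \<Longrightarrow> \<gamma> \<in> characters \<Longrightarrow>
    fourier \<mu>G (\<lambda>x. u x + v x) \<gamma> = fourier \<mu>G u \<gamma> + fourier \<mu>G v \<gamma>"
  using fourier_integrable[of u \<gamma>] fourier_integrable[of v \<gamma>]
  by (simp add: fourier_def distrib_right)

lemma fourier_cmult: "fourier \<mu>G (\<lambda>x. c * u x) \<gamma> = c * fourier \<mu>G u \<gamma>"
  by (simp add: fourier_def mult.assoc)

lemma fourier_translate:
  assumes u: "integrable \<mu>G u" and \<gamma>: "\<gamma> \<in> characters"
  shows "fourier \<mu>G (\<lambda>x. u (a + x)) \<gamma> = \<gamma> a * fourier \<mu>G u \<gamma>"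
proof -
  note [measurable] = character_measurable[OF \<gamma>] integrable_G_measurable[OF u]
  have "fourier \<mu>G (\<lambda>x. u (a + x)) \<gamma> = (\<integral>x. \<gamma> a * (u (a + x) * cnj (\<gamma> (a + x))) \<partial>\<mu>G)"
    unfolding fourier_def
  proof (intro Bochner_Integration.integral_cong refl)
    fix x
    have "\<gamma> a * cnj (\<gamma> a) = 1"
      using character_norm[OF \<gamma>, of a] by (simp add: complex_norm_square[symmetric])
    then show "u (a + x) * cnj (\<gamma> x) = \<gamma> a * (u (a + x) * cnj (\<gamma> (a + x)))"
      by (simp add: character_add[OF \<gamma>] algebra_simps)
  qed
  also have "\<dots> = \<gamma> a * (\<integral>x. u (a + x) * cnj (\<gamma> (a + x)) \<partial>\<mu>G)" by simp
  also have "(\<integral>x. u (a + x) * cnj (\<gamma> (a + x)) \<partial>\<mu>G) = fourier \<mu>G u \<gamma>"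
    unfolding fourier_def by (rule integral_translate[of "\<lambda>x. u x * cnj (\<gamma> x)"]) measurable
  finally show ?thesis .
qed

text \<open>
  Polarization: the norm of \<open>u + v\<close> gives the real part, that of \<open>u + \<i> v\<close> the imaginary part.
\<close>

lemma plancherel_inner:
  assumes u: "L1_L2 u" and v: "L1_L2 v"
  shows "(\<integral>\<gamma>. fourier \<mu>G u \<gamma> * cnj (fourier \<mu>G v \<gamma>) \<partial>\<mu>D) = (\<integral>x. u x * cnj (v x) \<partial>\<mu>G)"
proof -
  have Re: "Re (\<integral>\<gamma>. fourier \<mu>G u \<gamma> * cnj (fourier \<mu>G w \<gamma>) \<partial>\<mu>D) = Re (\<integral>x. u x * cnj (w x) \<partial>\<mu>G)"
    if w: "L1_L2 w" for w
  proof -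
    have "L2_norm_sq \<mu>D (\<lambda>\<gamma>. fourier \<mu>G u \<gamma> + fourier \<mu>G w \<gamma>)
        = L2_norm_sq \<mu>D (fourier \<mu>G (\<lambda>x. u x + w x))"
      using u w fourier_add by (intro L2_norm_sq_cong) (auto simp: L1_L2_def)
    also have "\<dots> = L2_norm_sq \<mu>G (\<lambda>x. u x + w x)" by (rule fourier_norm[OF L1_L2_add[OF u w]])
    finally show ?thesis
      using u w L2_norm_sq_add[OF fourier_L2[OF u] fourier_L2[OF w]] fourier_norm[OF u] fourier_norm[OF w]
        L2_norm_sq_add[of u \<mu>G w] by (simp add: L1_L2_def)
  qed
  have "(\<integral>\<gamma>. fourier \<mu>G u \<gamma> * cnj (fourier \<mu>G (\<lambda>x. \<i> * v x) \<gamma>) \<partial>\<mu>D)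
      = - \<i> * (\<integral>\<gamma>. fourier \<mu>G u \<gamma> * cnj (fourier \<mu>G v \<gamma>) \<partial>\<mu>D)"
    unfolding fourier_cmult integral_mult_right_zero[symmetric]
    by (intro Bochner_Integration.integral_cong) auto
  moreover have "(\<integral>x. u x * cnj (\<i> * v x) \<partial>\<mu>G) = - \<i> * (\<integral>x. u x * cnj (v x) \<partial>\<mu>G)"
    unfolding integral_mult_right_zero[symmetric] by (intro Bochner_Integration.integral_cong) auto
  ultimately have "Im (\<integral>\<gamma>. fourier \<mu>G u \<gamma> * cnj (fourier \<mu>G v \<gamma>) \<partial>\<mu>D) = Im (\<integral>x. u x * cnj (v x) \<partial>\<mu>G)"
    using Re[OF L1_L2_cmult[OF v, of \<i>]] by simp
  then show ?thesis using Re[OF v] by (simp add: complex_eq_iff)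
qed

text \<open>
  The closure in \<open>L\<^sup>2\<close> of the dual group of the transforms of \<open>L\<^sup>1 \<inter> L\<^sup>2\<close>. It is in fact the whole
  space, but for the existence of band-limited functions it is enough to know that it admits
  restriction to Borel sets.
\<close>

definition fourier_closure :: "(('g \<Rightarrow> complex) \<Rightarrow> complex) set" where
  "fourier_closure = {F \<in> L2 \<mu>D. \<forall>e>0. \<exists>u. L1_L2 u \<and> L2_norm_sq \<mu>D (\<lambda>\<gamma>. fourier \<mu>G u \<gamma> - F \<gamma>) < e}"

lemma fourier_closure_L2: "F \<in> fourier_closure \<Longrightarrow> F \<in> L2 \<mu>D"
  by (simp add: fourier_closure_def)

lemma fourier_closure_cong:
  assumes "F \<in> fourier_closure" and eq: "\<And>\<gamma>. \<gamma> \<in> characters \<Longrightarrow> F \<gamma> = F' \<gamma>"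
  shows "F' \<in> fourier_closure"
proof -
  have "L2_norm_sq \<mu>D (\<lambda>\<gamma>. u \<gamma> - F \<gamma>) = L2_norm_sq \<mu>D (\<lambda>\<gamma>. u \<gamma> - F' \<gamma>)" for u
    using eq by (intro L2_norm_sq_cong) auto
  moreover have "F' \<in> L2 \<mu>D" using assms L2_cong[of \<mu>D F F'] by (auto simp: fourier_closure_def)
  ultimately show ?thesis using assms(1) by (simp add: fourier_closure_def)
qed

lemma fourier_in_fourier_closure: "L1_L2 u \<Longrightarrow> fourier \<mu>G u \<in> fourier_closure"
  using fourier_L2[of u] unfolding fourier_closure_def by (auto intro!: exI[of _ u] simp: L2_norm_sq_def)

lemma fourier_closure_closed:
  assumes F: "F \<in> L2 \<mu>D"
    and approx: "\<And>e. 0 < e \<Longrightarrow> \<exists>F'\<in>fourier_closure. L2_norm_sq \<mu>D (\<lambda>\<gamma>. F' \<gamma> - F \<gamma>) < e"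
  shows "F \<in> fourier_closure"
  unfolding fourier_closure_def
proof (intro CollectI conjI F allI impI)
  fix e :: real assume e: "0 < e"
  obtain F' where F': "F' \<in> fourier_closure" "L2_norm_sq \<mu>D (\<lambda>\<gamma>. F' \<gamma> - F \<gamma>) < e / 4"
    using approx[of "e / 4"] e by auto
  obtain u where u: "L1_L2 u" "L2_norm_sq \<mu>D (\<lambda>\<gamma>. fourier \<mu>G u \<gamma> - F' \<gamma>) < e / 4"
    using F'(1) e unfolding fourier_closure_def by (auto dest!: spec[of _ "e / 4"])
  have "L2_norm_sq \<mu>D (\<lambda>\<gamma>. fourier \<mu>G u \<gamma> - F \<gamma>) < e"
    using L2_norm_sq_triangle[OF fourier_L2[OF u(1)] fourier_closure_L2[OF F'(1)] F] u(2) F'(2) by simp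
  then show "\<exists>u. L1_L2 u \<and> L2_norm_sq \<mu>D (\<lambda>\<gamma>. fourier \<mu>G u \<gamma> - F \<gamma>) < e" using u(1) by blast
qed

lemma fourier_closure_limit:
  assumes F: "F \<in> L2 \<mu>D" and "\<And>k. F' k \<in> fourier_closure"
    and lim: "(\<lambda>k. L2_norm_sq \<mu>D (\<lambda>\<gamma>. F' k \<gamma> - F \<gamma>)) \<longlonglongrightarrow> 0"
  shows "F \<in> fourier_closure"
proof (rule fourier_closure_closed[OF F])
  fix e :: real assume "0 < e"
  then have "\<forall>\<^sub>F k in sequentially. L2_norm_sq \<mu>D (\<lambda>\<gamma>. F' k \<gamma> - F \<gamma>) < e"
    using lim by (rule order_tendstoD(2)[rotated])
  then obtain k where "L2_norm_sq \<mu>D (\<lambda>\<gamma>. F' k \<gamma> - F \<gamma>) < e"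
    by (auto dest: eventually_happens)
  then show "\<exists>F'\<in>fourier_closure. L2_norm_sq \<mu>D (\<lambda>\<gamma>. F' \<gamma> - F \<gamma>) < e" using assms(2) by blast
qed

lemma fourier_closure_add:
  assumes F: "F \<in> fourier_closure" and G: "G \<in> fourier_closure"
  shows "(\<lambda>\<gamma>. F \<gamma> + G \<gamma>) \<in> fourier_closure"
  unfolding fourier_closure_def
proof (intro CollectI conjI allI impI)
  show "(\<lambda>\<gamma>. F \<gamma> + G \<gamma>) \<in> L2 \<mu>D" using F G by (intro L2_add fourier_closure_L2)
  fix e :: real assume e: "0 < e"
  obtain u where u: "L1_L2 u" "L2_norm_sq \<mu>D (\<lambda>\<gamma>. fourier \<mu>G u \<gamma> - F \<gamma>) < e / 4"
    using F e unfolding fourier_closure_def by (auto dest!: spec[of _ "e / 4"])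
  obtain v where v: "L1_L2 v" "L2_norm_sq \<mu>D (\<lambda>\<gamma>. fourier \<mu>G v \<gamma> - G \<gamma>) < e / 4"
    using G e unfolding fourier_closure_def by (auto dest!: spec[of _ "e / 4"])
  have "L2_norm_sq \<mu>D (\<lambda>\<gamma>. fourier \<mu>G (\<lambda>x. u x + v x) \<gamma> - (F \<gamma> + G \<gamma>))
      = L2_norm_sq \<mu>D (\<lambda>\<gamma>. (fourier \<mu>G u \<gamma> - F \<gamma>) + (fourier \<mu>G v \<gamma> - G \<gamma>))"
    using u v by (intro L2_norm_sq_cong) (auto simp: fourier_add L1_L2_def)
  also have "\<dots> < e"
    using L2_norm_sq_add_le[OF L2_diff[OF fourier_L2[OF u(1)] fourier_closure_L2[OF F]]
        L2_diff[OF fourier_L2[OF v(1)] fourier_closure_L2[OF G]]] u(2) v(2) by simp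
  finally show "\<exists>u. L1_L2 u \<and> L2_norm_sq \<mu>D (\<lambda>\<gamma>. fourier \<mu>G u \<gamma> - (F \<gamma> + G \<gamma>)) < e"
    using L1_L2_add[OF u(1) v(1)] by blast
qed

text \<open>
  If multiplication by a bounded \<open>m\<close> corresponds to an operator \<open>L\<close> on functions on \<open>G\<close>, it is
  continuous in \<open>L\<^sup>2\<close> and so preserves the closure.
\<close>

lemma fourier_closure_bounded_multiplier:
  assumes F: "F \<in> fourier_closure" and m [measurable]: "m \<in> borel_measurable \<mu>D"
    and bd: "\<And>\<gamma>. \<gamma> \<in> characters \<Longrightarrow> cmod (m \<gamma>) \<le> B"
    and op: "\<And>u. L1_L2 u \<Longrightarrow> L1_L2 (L u)"
      "\<And>u \<gamma>. L1_L2 u \<Longrightarrow> \<gamma> \<in> characters \<Longrightarrow> fourier \<mu>G (L u) \<gamma> = fourier \<mu>G u \<gamma> * m \<gamma>"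
  shows "(\<lambda>\<gamma>. F \<gamma> * m \<gamma>) \<in> fourier_closure"
  unfolding fourier_closure_def
proof (intro CollectI conjI allI impI)
  show "(\<lambda>\<gamma>. F \<gamma> * m \<gamma>) \<in> L2 \<mu>D"
    using bd by (intro L2_mult_bounded[OF fourier_closure_L2[OF F] m, of B]) simp
  fix e :: real assume e: "0 < e"
  have "0 < e / (B\<^sup>2 + 1)" using e by (simp add: add_nonneg_pos)
  then obtain u where u: "L1_L2 u" "L2_norm_sq \<mu>D (\<lambda>\<gamma>. fourier \<mu>G u \<gamma> - F \<gamma>) < e / (B\<^sup>2 + 1)"
    using F unfolding fourier_closure_def by blast
  let ?d = "L2_norm_sq \<mu>D (\<lambda>\<gamma>. fourier \<mu>G u \<gamma> - F \<gamma>)"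
  have "L2_norm_sq \<mu>D (\<lambda>\<gamma>. fourier \<mu>G (L u) \<gamma> - F \<gamma> * m \<gamma>)
      = L2_norm_sq \<mu>D (\<lambda>\<gamma>. (fourier \<mu>G u \<gamma> - F \<gamma>) * m \<gamma>)"
    using op(2)[OF u(1)] by (intro L2_norm_sq_cong) (auto simp: algebra_simps)
  also have "\<dots> \<le> B\<^sup>2 * ?d"
    by (rule L2_norm_sq_mult_bounded[OF L2_diff[OF fourier_L2[OF u(1)] fourier_closure_L2[OF F]] m])
      (simp add: bd)
  also have "\<dots> \<le> (B\<^sup>2 + 1) * ?d" using L2_norm_sq_nonneg[of \<mu>D] by (intro mult_right_mono) auto
  also have "\<dots> < e"
    using u(2) by (simp add: pos_less_divide_eq add_nonneg_pos mult.commute)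
  finally show "\<exists>u. L1_L2 u \<and> L2_norm_sq \<mu>D (\<lambda>\<gamma>. fourier \<mu>G u \<gamma> - F \<gamma> * m \<gamma>) < e"
    using op(1)[OF u(1)] by blast
qed

lemma fourier_closure_cmult: "F \<in> fourier_closure \<Longrightarrow> (\<lambda>\<gamma>. F \<gamma> * c) \<in> fourier_closure"
  by (rule fourier_closure_bounded_multiplier[where L = "\<lambda>u x. c * u x" and B = "cmod c"])
    (auto simp: L1_L2_cmult fourier_cmult)

lemma fourier_closure_evaluation: "F \<in> fourier_closure \<Longrightarrow> (\<lambda>\<gamma>. F \<gamma> * \<gamma> a) \<in> fourier_closure"
  by (rule fourier_closure_bounded_multiplier[where L = "\<lambda>u x. u (a + x)" and B = 1])
    (simp_all add: L1_L2_translate fourier_translate L1_L2_def[THEN iffD1] character_norm)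

lemma fourier_closure_Re_Im:
  assumes F: "F \<in> fourier_closure"
  shows "(\<lambda>\<gamma>. F \<gamma> * complex_of_real (Re (\<gamma> a))) \<in> fourier_closure"
    "(\<lambda>\<gamma>. F \<gamma> * complex_of_real (Im (\<gamma> a))) \<in> fourier_closure"
proof -
  note p = fourier_closure_evaluation[OF F, of a] and m = fourier_closure_evaluation[OF F, of "- a"]
  show "(\<lambda>\<gamma>. F \<gamma> * complex_of_real (Re (\<gamma> a))) \<in> fourier_closure"
  proof (rule fourier_closure_cong[OF fourier_closure_add[OF fourier_closure_cmult[OF p, of "1/2"] fourier_closure_cmult[OF m, of "1/2"]]])
    fix \<gamma> :: "'g \<Rightarrow> complex" assume "\<gamma> \<in> characters"
    then show "F \<gamma> * \<gamma> a * (1 / 2) + F \<gamma> * \<gamma> (- a) * (1 / 2) = F \<gamma> * complex_of_real (Re (\<gamma> a))"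
      by (simp add: character_uminus complex_eq_iff field_simps)
  qed
  show "(\<lambda>\<gamma>. F \<gamma> * complex_of_real (Im (\<gamma> a))) \<in> fourier_closure"
  proof (rule fourier_closure_cong[OF fourier_closure_add[OF fourier_closure_cmult[OF p, of "- \<i>/2"] fourier_closure_cmult[OF m, of "\<i>/2"]]])
    fix \<gamma> :: "'g \<Rightarrow> complex" assume "\<gamma> \<in> characters"
    then show "F \<gamma> * \<gamma> a * (- \<i> / 2) + F \<gamma> * \<gamma> (- a) * (\<i> / 2) = F \<gamma> * complex_of_real (Im (\<gamma> a))"
      by (simp add: character_uminus complex_eq_iff field_simps)
  qed
qed

text \<open>
  Real polynomial functions of \<open>\<gamma> a\<close> are generated by its real and imaginary parts, which are
  combinations of \<open>\<gamma> a\<close> and \<open>\<gamma> (-a)\<close>.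
\<close>

lemma fourier_closure_polynomial:
  assumes "real_polynomial_function p" "F \<in> fourier_closure"
  shows "(\<lambda>\<gamma>. F \<gamma> * complex_of_real (p (\<gamma> a))) \<in> fourier_closure"
  using assms
proof (induction p arbitrary: F rule: real_polynomial_function.induct)
  case (linear f)
  have f: "f z = Re z * f 1 + Im z * f \<i>" for z
  proof -
    have "f z = f (Re z *\<^sub>R 1 + Im z *\<^sub>R \<i>)" by (rule arg_cong[of _ _ f]) (simp add: complex_eq_iff)
    then show ?thesis
      using linear(1) by (simp add: linear_add linear_scale bounded_linear.linear)
  qed
  show ?case
    by (rule fourier_closure_cong[OF fourier_closure_add[OF
          fourier_closure_cmult[OF fourier_closure_Re_Im(1)[OF linear(2), of a], of "of_real (f 1)"]
          fourier_closure_cmult[OF fourier_closure_Re_Im(2)[OF linear(2), of a], of "of_real (f \<i>)"]]])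
      (subst f, simp add: algebra_simps)
next
  case (const c)
  then show ?case by (rule fourier_closure_cmult)
next
  case (add f g)
  show ?case
    by (rule fourier_closure_cong[OF fourier_closure_add[OF add.IH(1)[OF add.prems] add.IH(2)[OF add.prems]]])
      (simp add: algebra_simps)
next
  case (mult f g)
  show ?case
    by (rule fourier_closure_cong[OF mult.IH(2)[OF mult.IH(1)[OF mult.prems]]]) (simp add: algebra_simps)
qed

text \<open>
  Values of characters lie on the unit circle, where continuous functions are uniform limits
  of polynomial functions.
\<close>

lemma fourier_closure_continuous:
  assumes q: "continuous_on UNIV q" and F: "F \<in> fourier_closure"
  shows "(\<lambda>\<gamma>. F \<gamma> * complex_of_real (q (\<gamma> a))) \<in> fourier_closure"
proof (rule fourier_closure_closed)
  have qs: "continuous_on (sphere 0 1) q" using q by (rule continuous_on_subset) auto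
  have [measurable]: "q \<in> borel_measurable borel" using q by (rule borel_measurable_continuous_onI)
  have "bounded (q ` sphere 0 1)"
    by (intro compact_imp_bounded compact_continuous_image qs compact_sphere)
  then obtain B where "\<And>z. z \<in> sphere 0 1 \<Longrightarrow> \<bar>q z\<bar> \<le> B"
    unfolding bounded_iff by force
  then show "(\<lambda>\<gamma>. F \<gamma> * complex_of_real (q (\<gamma> a))) \<in> L2 \<mu>D"
    by (intro L2_mult_bounded[where B = B] fourier_closure_L2[OF F]) (auto simp: character_norm)
  fix e :: real assume e: "0 < e"
  let ?N = "L2_norm_sq \<mu>D F"
  \<comment> \<open>An approximation within \<open>d\<close> gives a squared error of at most \<open>d\<^sup>2 ?N < e\<close>, also when \<open>?N = 0\<close>.\<close>
  define d where "d = sqrt (e / (?N + 1))"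
  have N: "0 \<le> ?N" by (rule L2_norm_sq_nonneg)
  have d: "0 < d" using e N by (simp add: d_def)
  obtain p where p: "real_polynomial_function p" "\<And>z. z \<in> sphere 0 1 \<Longrightarrow> \<bar>q z - p z\<bar> < d"
    using Stone_Weierstrass_real_polynomial_function[OF compact_sphere qs d] by blast
  have [measurable]: "p \<in> borel_measurable borel"
    using p(1) by (intro borel_measurable_continuous_onI)
      (simp add: continuous_on_polymonial_function real_polynomial_function_eq)
  have "L2_norm_sq \<mu>D (\<lambda>\<gamma>. F \<gamma> * complex_of_real (p (\<gamma> a)) - F \<gamma> * complex_of_real (q (\<gamma> a)))
      = L2_norm_sq \<mu>D (\<lambda>\<gamma>. F \<gamma> * complex_of_real (p (\<gamma> a) - q (\<gamma> a)))"
    by (simp add: algebra_simps)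
  also have "\<dots> \<le> d\<^sup>2 * ?N"
  proof (rule L2_norm_sq_mult_bounded[OF fourier_closure_L2[OF F]])
    fix \<gamma> assume "\<gamma> \<in> space \<mu>D"
    then have "\<gamma> a \<in> sphere 0 1" by (simp add: character_norm)
    from p(2)[OF this] have "\<bar>p (\<gamma> a) - q (\<gamma> a)\<bar> \<le> d" by linarith
    then show "cmod (complex_of_real (p (\<gamma> a) - q (\<gamma> a))) \<le> d"
      unfolding norm_of_real .
  qed measurable
  also have "\<dots> = e * (?N / (?N + 1))" using e N by (simp add: d_def)
  also have "\<dots> < e * 1" using e N by (intro mult_strict_left_mono) auto
  finally show "\<exists>F'\<in>fourier_closure. L2_norm_sq \<mu>D (\<lambda>\<gamma>. F' \<gamma> - F \<gamma> * complex_of_real (q (\<gamma> a))) < e"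
    using fourier_closure_polynomial[OF p(1) F, of a] by auto
qed

text \<open>
  The indicator function of a nonempty closed set is the decreasing limit of the continuous
  functions \<open>max 0 (1 - k dist(z, K))\<close>.
\<close>

lemma fourier_closure_indicator_closed:
  assumes K: "closed K" and F: "F \<in> fourier_closure"
  shows "(\<lambda>\<gamma>. F \<gamma> * indicator {\<gamma> \<in> characters. \<gamma> a \<in> K} \<gamma>) \<in> fourier_closure"
proof (cases "K = {}")
  case True
  then show ?thesis using fourier_closure_cmult[OF F, of 0] by simp
next
  case False
  define q where "q k z = max 0 (1 - real k * infdist z K)" for k z
  have qc: "continuous_on UNIV (q k)" for k
    unfolding q_def by (intro continuous_intros)
  have [measurable]: "q k \<in> borel_measurable borel" for k
    using qc by (rule borel_measurable_continuous_onI)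
  have [measurable]: "K \<in> sets borel" using K by simp
  have [measurable]: "characters \<in> sets \<mu>D" using sets.top[of \<mu>D] by simp
  have [measurable]: "{\<gamma> \<in> characters. \<gamma> a \<in> K} \<in> sets \<mu>D"
    using measurable_sets_Collect[OF evaluation_measurable_D, of "\<lambda>z. z \<in> K" a] by simp
  let ?i = "indicator {\<gamma> \<in> characters. \<gamma> a \<in> K} :: _ \<Rightarrow> complex"
  have q01: "0 \<le> q k z" "q k z \<le> 1" for k z using infdist_nonneg[of z K] by (auto simp: q_def)
  show ?thesis
  proof (rule fourier_closure_limit)
    show "(\<lambda>\<gamma>. F \<gamma> * ?i \<gamma>) \<in> L2 \<mu>D"
      by (rule L2_mult_bounded[OF fourier_closure_L2[OF F], where B = 1]) (auto split: split_indicator)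
    show "(\<lambda>\<gamma>. F \<gamma> * complex_of_real (q k (\<gamma> a))) \<in> fourier_closure" for k
      by (rule fourier_closure_continuous[OF qc F])
    show "(\<lambda>k. L2_norm_sq \<mu>D (\<lambda>\<gamma>. F \<gamma> * complex_of_real (q k (\<gamma> a)) - F \<gamma> * ?i \<gamma>)) \<longlonglongrightarrow> 0"
    proof (rule L2_mult_dominated[OF fourier_closure_L2[OF F], where B = 1])
      fix \<gamma> assume \<gamma>: "\<gamma> \<in> space \<mu>D"
      show "(\<lambda>k. complex_of_real (q k (\<gamma> a))) \<longlonglongrightarrow> ?i \<gamma>"
      proof (cases "\<gamma> a \<in> K")
        case True
        then show ?thesis using \<gamma> by (simp add: q_def)
      next
        case False
        then have pos: "0 < infdist (\<gamma> a) K"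
          using K \<open>K \<noteq> {}\<close> in_closed_iff_infdist_zero[of K "\<gamma> a"] infdist_nonneg[of "\<gamma> a" K] by auto
        obtain k0 where k0: "1 / infdist (\<gamma> a) K < real k0" using reals_Archimedean2 by blast
        have "q k (\<gamma> a) = 0" if "k0 \<le> k" for k
        proof -
          have "1 / infdist (\<gamma> a) K < real k" using k0 that by linarith
          then have "1 < real k * infdist (\<gamma> a) K" using pos by (simp add: pos_divide_less_eq)
          then show ?thesis by (simp add: q_def)
        qed
        then have "\<forall>\<^sub>F k in sequentially. complex_of_real (q k (\<gamma> a)) = ?i \<gamma>"
          using False by (intro eventually_sequentiallyI[of k0]) simp
        then show ?thesis by (rule tendsto_eventually)
      qed
      show "cmod (complex_of_real (q k (\<gamma> a)) - ?i \<gamma>) \<le> 1" for k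
      proof -
        have "complex_of_real (q k (\<gamma> a)) - ?i \<gamma> = of_real (q k (\<gamma> a) - indicator {\<gamma> \<in> characters. \<gamma> a \<in> K} \<gamma>)"
          by (simp split: split_indicator)
        then have "cmod (complex_of_real (q k (\<gamma> a)) - ?i \<gamma>) = \<bar>q k (\<gamma> a) - indicator {\<gamma> \<in> characters. \<gamma> a \<in> K} \<gamma>\<bar>"
          by (simp only: norm_of_real)
        then show ?thesis using q01[of k "\<gamma> a"] by (auto split: split_indicator)
      qed
    qed measurable
  qed
qed

text \<open>
  The sets \<open>A\<close> with this property for all \<open>F\<close> form a \<sigma>-algebra. It contains the evaluation sets,
  hence all Borel sets.
\<close>

lemma fourier_closure_indicator:
  assumes A: "A \<in> sets \<mu>D" and F: "F \<in> fourier_closure"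
  shows "(\<lambda>\<gamma>. F \<gamma> * indicator A \<gamma>) \<in> fourier_closure"
proof -
  have ev: "evaluation_sets \<subseteq> Pow (characters :: ('g \<Rightarrow> complex) set)"
    by (auto simp: evaluation_sets_def)
  have "sigma_sets characters {U. openin dual_topology U} \<subseteq> sigma_sets (characters :: ('g \<Rightarrow> complex) set) evaluation_sets"
    by (intro sigma_sets_mono subsetI) (simp add: open_dual_in_sigma_evaluation_sets)
  then have "A \<in> sigma_sets characters evaluation_sets"
    using A by (auto simp: sets_D sets_borel_of)
  moreover have "evaluation_sets \<subseteq> sets \<mu>D"
  proof
    fix S :: "('g \<Rightarrow> complex) set" assume "S \<in> evaluation_sets"
    then obtain x K where "closed K" "S = {\<gamma> \<in> characters. \<gamma> x \<in> K}" by (auto simp: evaluation_sets_def)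
    then show "S \<in> sets \<mu>D"
      using measurable_sets_Collect[OF evaluation_measurable_D, of "\<lambda>z. z \<in> K" x] by simp
  qed
  ultimately show ?thesis using F
  proof (induction A arbitrary: F rule: sigma_sets.induct)
    case (Basic A)
    then show ?case by (auto simp: evaluation_sets_def intro: fourier_closure_indicator_closed)
  next
    case Empty
    then show ?case using fourier_closure_cmult[of F 0] by simp
  next
    case (Compl A)
    show ?case
    proof (rule fourier_closure_cong[OF fourier_closure_add[OF Compl.prems(2) fourier_closure_cmult[OF Compl.IH[OF Compl.prems], of "-1"]]])
      fix \<gamma> :: "'g \<Rightarrow> complex" assume "\<gamma> \<in> characters"
      then show "F \<gamma> + F \<gamma> * indicator A \<gamma> * - 1 = F \<gamma> * indicator (characters - A) \<gamma>"
        by (simp split: split_indicator)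
    qed
  next
    case (Union A)
    have Am [measurable]: "A i \<in> sets \<mu>D" for i
      using Union.hyps[of i] sets.sigma_sets_subset[OF Union.prems(1)] space_D by auto
    have fin: "(\<lambda>\<gamma>. F \<gamma> * indicator (\<Union>i<k. A i) \<gamma>) \<in> fourier_closure" for k
    proof (induction k)
      case 0
      then show ?case using fourier_closure_cmult[OF Union.prems(2), of 0] by simp
    next
      case (Suc k)
      let ?G = "\<lambda>\<gamma>. F \<gamma> * indicator (\<Union>i<k. A i) \<gamma>"
      have "(\<lambda>\<gamma>. (F \<gamma> + ?G \<gamma> * (-1)) * indicator (A k) \<gamma>) \<in> fourier_closure"
        by (rule Union.IH[OF Union.prems(1) fourier_closure_add[OF Union.prems(2) fourier_closure_cmult[OF Suc]]])
      then show ?case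
        by (rule fourier_closure_cong[OF fourier_closure_add[OF Suc]])
          (auto simp: lessThan_Suc split: split_indicator)
    qed
    let ?i = "\<lambda>k. indicator (\<Union>i<k. A i) :: _ \<Rightarrow> complex"
    show ?case
    proof (rule fourier_closure_limit[OF _ fin])
      show "(\<lambda>\<gamma>. F \<gamma> * indicator (\<Union>i. A i) \<gamma>) \<in> L2 \<mu>D"
        by (rule L2_mult_bounded[OF fourier_closure_L2[OF Union.prems(2)], where B = 1]) (auto split: split_indicator)
      show "(\<lambda>k. L2_norm_sq \<mu>D (\<lambda>\<gamma>. F \<gamma> * ?i k \<gamma> - F \<gamma> * indicator (\<Union>i. A i) \<gamma>)) \<longlonglongrightarrow> 0"
      proof (rule L2_mult_dominated[OF fourier_closure_L2[OF Union.prems(2)], where B = 1])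
        show "(\<lambda>k. ?i k \<gamma>) \<longlonglongrightarrow> indicator (\<Union>i. A i) \<gamma>" for \<gamma>
          by (rule LIMSEQ_indicator_UN)
      qed (auto split: split_indicator)
    qed
  qed
qed

end

section \<open>Inversion for band-limited functions\<close>

context plancherel_group
begin

text \<open>
  A function that is measurable in \<open>\<gamma>\<close> and continuous in \<open>x\<close> is jointly measurable: it is the
  limit of \<open>\<gamma> (d (m k x))\<close>, where \<open>d (m k x)\<close> is a point of a countable dense set that
  approximates \<open>x\<close> up to the \<open>k\<close>-th neighbourhood of \<open>0\<close> and depends measurably on \<open>x\<close>.
\<close>

lemma evaluation_jointly_measurable:
  "(\<lambda>p. fst p (snd p)) \<in> borel_measurable (\<mu>D \<Otimes>\<^sub>M borel)"
proof -
  obtain A :: "nat \<Rightarrow> 'g set" where A: "\<And>i. open (A i)" "\<And>i. 0 \<in> A i"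
    "\<And>S. open S \<Longrightarrow> 0 \<in> S \<Longrightarrow> eventually (\<lambda>i. A i \<subseteq> S) sequentially"
    by (rule countable_basis_at_decseq[of "0 :: 'g"]) auto
  obtain D :: "'g set" where D: "countable D" "\<And>X. open X \<Longrightarrow> X \<noteq> {} \<Longrightarrow> \<exists>d\<in>D. d \<in> X"
    using countable_dense_setE by blast
  have Dne: "D \<noteq> {}" using D(2)[of UNIV] by auto
  define d where "d = from_nat_into D"
  have near: "\<exists>m. x - d m \<in> A k" for x k
  proof -
    have "continuous_on UNIV (\<lambda>y. x - y)" by (intro continuous_intros)
    then have "open ((\<lambda>y. x - y) -` A k)" by (rule open_vimage[OF A(1)])
    moreover have "x \<in> (\<lambda>y. x - y) -` A k" using A(2) by simp
    ultimately obtain y where "y \<in> D" "x - y \<in> A k" using D(2) by (metis empty_iff vimageE)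
    then show ?thesis unfolding d_def using from_nat_into_surj[OF D(1)] by metis
  qed
  define m where "m k x = (LEAST i. x - d i \<in> A k)" for k x
  have m: "x - d (m k x) \<in> A k" for k x unfolding m_def by (rule LeastI_ex[OF near])
  have [measurable]: "A k \<in> sets borel" for k using A(1) by simp
  have [measurable]: "(\<lambda>x. x - d i) \<in> borel_measurable borel" for i
    by (intro borel_measurable_continuous_onI continuous_intros)
  have mm [measurable]: "m k \<in> measurable borel (count_space UNIV)" for k
    unfolding m_def by measurable
  show ?thesis
  proof (rule borel_measurable_LIMSEQ_metric)
    show "(\<lambda>p. fst p (d (m k (snd p)))) \<in> borel_measurable (\<mu>D \<Otimes>\<^sub>M borel)" for k
    proof (rule measurable_compose_countable[where f = "\<lambda>i p. fst p (d i)"])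
      show "(\<lambda>p. fst p (d i)) \<in> borel_measurable (\<mu>D \<Otimes>\<^sub>M borel)" for i
        by (rule measurable_compose[OF measurable_fst evaluation_measurable_D])
    qed measurable
    fix p assume "p \<in> space (\<mu>D \<Otimes>\<^sub>M (borel :: 'g measure))"
    then have \<gamma>: "fst p \<in> characters" by (auto simp: space_pair_measure)
    let ?x = "snd p"
    have "(\<lambda>k. ?x - d (m k ?x)) \<longlonglongrightarrow> 0"
    proof (rule topological_tendstoI)
      fix S :: "'g set" assume "open S" "0 \<in> S"
      from A(3)[OF this] show "\<forall>\<^sub>F k in sequentially. ?x - d (m k ?x) \<in> S"
        by eventually_elim (use m in blast)
    qed
    then have "(\<lambda>k. ?x - (?x - d (m k ?x))) \<longlonglongrightarrow> ?x - 0" by (intro tendsto_intros)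
    then have "(\<lambda>k. d (m k ?x)) \<longlonglongrightarrow> ?x" by simp
    then show "(\<lambda>k. fst p (d (m k ?x))) \<longlonglongrightarrow> fst p ?x"
      using character_continuous[OF \<gamma>]
      by (auto simp: continuous_on_sequentially comp_def)
  qed
qed

definition inverse_fourier :: "(('g \<Rightarrow> complex) \<Rightarrow> complex) \<Rightarrow> 'g \<Rightarrow> complex" where
  "inverse_fourier F x = (\<integral>\<gamma>. F \<gamma> * \<gamma> x \<partial>\<mu>D)"

text \<open>
  On a set of finite measure square integrability implies integrability, by \<open>t \<le> 1 + t\<^sup>2\<close>.
\<close>

lemma band_supported_integrable:
  assumes E: "band \<mu>D E" and F: "F \<in> L2 \<mu>D" and supp: "\<And>\<gamma>. \<gamma> \<notin> E \<Longrightarrow> F \<gamma> = 0"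
  shows "integrable \<mu>D F"
proof (rule Bochner_Integration.integrable_bound)
  have "integrable \<mu>D (\<lambda>\<gamma>. indicator E \<gamma> :: real)"
    using E by (simp add: band_def)
  then show "integrable \<mu>D (\<lambda>\<gamma>. indicator E \<gamma> + (cmod (F \<gamma>))\<^sup>2)"
    using L2_integrable[OF F] by simp
  show "F \<in> borel_measurable \<mu>D" using F by (rule L2_measurable)
  show "AE \<gamma> in \<mu>D. norm (F \<gamma>) \<le> norm (indicator E \<gamma> + (cmod (F \<gamma>))\<^sup>2 :: real)"
  proof (rule AE_I2)
    fix \<gamma>
    have "cmod (F \<gamma>) \<le> 1 + (cmod (F \<gamma>))\<^sup>2"
    proof -
      have "2 * cmod (F \<gamma>) \<le> 1 + (cmod (F \<gamma>))\<^sup>2"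
        using sum_squares_bound[of "cmod (F \<gamma>)" 1] by simp
      moreover have "0 \<le> cmod (F \<gamma>)" by simp
      ultimately show ?thesis by linarith
    qed
    then show "norm (F \<gamma>) \<le> norm (indicator E \<gamma> + (cmod (F \<gamma>))\<^sup>2 :: real)"
      using supp[of \<gamma>] by (auto split: split_indicator)
  qed
qed

lemma inverse_fourier_continuous:
  assumes F: "integrable \<mu>D F"
  shows "continuous_on UNIV (inverse_fourier F)"
proof (rule continuous_on_sequentiallyI)
  fix u :: "nat \<Rightarrow> 'g" and a assume u: "u \<longlonglongrightarrow> a"
  have [measurable]: "F \<in> borel_measurable \<mu>D" using F by simp
  show "(\<lambda>k. inverse_fourier F (u k)) \<longlonglongrightarrow> inverse_fourier F a"
    unfolding inverse_fourier_def
  proof (rule integral_dominated_convergence[where w = "\<lambda>\<gamma>. cmod (F \<gamma>)"])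
    show "AE \<gamma> in \<mu>D. (\<lambda>k. F \<gamma> * \<gamma> (u k)) \<longlonglongrightarrow> F \<gamma> * \<gamma> a"
    proof (rule AE_I2)
      fix \<gamma> assume "\<gamma> \<in> space \<mu>D"
      then have "(\<lambda>k. \<gamma> (u k)) \<longlonglongrightarrow> \<gamma> a"
        using character_continuous[of \<gamma>] u by (auto simp: continuous_on_sequentially comp_def)
      then show "(\<lambda>k. F \<gamma> * \<gamma> (u k)) \<longlonglongrightarrow> F \<gamma> * \<gamma> a" by (intro tendsto_intros)
    qed
    show "AE \<gamma> in \<mu>D. norm (F \<gamma> * \<gamma> (u k)) \<le> cmod (F \<gamma>)" for k
      by (rule AE_I2) (simp add: norm_mult character_norm)
    show "integrable \<mu>D (\<lambda>\<gamma>. cmod (F \<gamma>))" using F by (rule integrable_norm)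
  qed measurable
qed

text \<open>
  Fubini's theorem. Restricting the dual Haar measure to \<open>E\<close> gives a finite measure, to which
  the theorem applies.
\<close>

lemma inverse_fourier_pairing:
  assumes E: "band \<mu>D E" and F: "integrable \<mu>D F" and supp: "\<And>\<gamma>. \<gamma> \<notin> E \<Longrightarrow> F \<gamma> = 0"
    and v: "integrable \<mu>G v"
  shows "(\<integral>x. inverse_fourier F x * cnj (v x) \<partial>\<mu>G) = (\<integral>\<gamma>. F \<gamma> * cnj (fourier \<mu>G v \<gamma>) \<partial>\<mu>D)"
proof -
  define N where "N = density \<mu>D (\<lambda>\<gamma>. ennreal (indicator E \<gamma>))"
  have Em [measurable]: "E \<in> sets \<mu>D" using E by (simp add: band_def)
  have Fm [measurable]: "F \<in> borel_measurable \<mu>D" using F by simp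
  have vm [measurable]: "v \<in> borel_measurable borel" by (rule integrable_G_measurable[OF v])
  have sN [measurable_cong]: "sets N = sets \<mu>D" by (simp add: N_def)
  have spN: "space N = characters" by (simp add: N_def)
  have "emeasure N (space N) = (\<integral>\<^sup>+\<gamma>. ennreal (indicator E \<gamma>) * indicator (space \<mu>D) \<gamma> \<partial>\<mu>D)"
    unfolding N_def space_density by (rule emeasure_density[OF _ sets.top]) measurable
  also have "\<dots> = (\<integral>\<^sup>+\<gamma>. indicator E \<gamma> \<partial>\<mu>D)"
    by (intro nn_integral_cong) (simp add: ennreal_indicator)
  also have "\<dots> = emeasure \<mu>D E" by simp
  finally interpret N: finite_measure N
    using E by (intro finite_measureI) (auto simp: band_def)
  interpret P: pair_sigma_finite N \<mu>G ..
  have toN: "(\<integral>\<gamma>. F \<gamma> * h \<gamma> \<partial>N) = (\<integral>\<gamma>. F \<gamma> * h \<gamma> \<partial>\<mu>D)" if [measurable]: "h \<in> borel_measurable \<mu>D" for h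
  proof -
    have "(\<integral>\<gamma>. F \<gamma> * h \<gamma> \<partial>N) = (\<integral>\<gamma>. indicator E \<gamma> *\<^sub>R (F \<gamma> * h \<gamma>) \<partial>\<mu>D)"
      unfolding N_def by (rule integral_density) auto
    also have "\<dots> = (\<integral>\<gamma>. F \<gamma> * h \<gamma> \<partial>\<mu>D)"
      using supp by (intro Bochner_Integration.integral_cong) (auto split: split_indicator)
    finally show ?thesis .
  qed
  have "integrable \<mu>D (\<lambda>\<gamma>. indicator E \<gamma> *\<^sub>R F \<gamma>)"
    using F by (rule Bochner_Integration.integrable_bound) (auto split: split_indicator)
  then have FN: "integrable N F"
    unfolding N_def by (subst integrable_density) auto
  let ?f = "\<lambda>p. F (fst p) * (fst p (snd p) * cnj (v (snd p)))"
  have ev: "(\<lambda>p. fst p (snd p)) \<in> borel_measurable (N \<Otimes>\<^sub>M \<mu>G)"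
    using evaluation_jointly_measurable
    by (subst measurable_cong_sets[OF sets_pair_measure_cong[OF sN sets_G] refl])
  have fm [measurable]: "?f \<in> borel_measurable (N \<Otimes>\<^sub>M \<mu>G)"
    using ev by measurable
  have nrm: "norm (?f (\<gamma>, x)) = cmod (F \<gamma>) * cmod (v x)" if "\<gamma> \<in> characters" for \<gamma> x
    using character_norm[OF that] by (simp add: norm_mult)
  have int: "integrable (N \<Otimes>\<^sub>M \<mu>G) ?f"
  proof (rule P.Fubini_integrable[OF fm])
    have "integrable N (\<lambda>\<gamma>. cmod (F \<gamma>) * (\<integral>x. cmod (v x) \<partial>\<mu>G))" using FN by simp
    moreover have "(\<integral>x. norm (?f (\<gamma>, x)) \<partial>\<mu>G) = cmod (F \<gamma>) * (\<integral>x. cmod (v x) \<partial>\<mu>G)"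
      if "\<gamma> \<in> space N" for \<gamma>
      using that nrm[of \<gamma>] unfolding spN by (simp only: integral_mult_right_zero)
    ultimately show "integrable N (\<lambda>\<gamma>. \<integral>x. norm (?f (\<gamma>, x)) \<partial>\<mu>G)"
      by (subst Bochner_Integration.integrable_cong[OF refl]) auto
    show "AE \<gamma> in N. integrable \<mu>G (\<lambda>x. ?f (\<gamma>, x))"
    proof (rule AE_I2)
      fix \<gamma> assume "\<gamma> \<in> space N"
      then have \<gamma>: "\<gamma> \<in> characters" by (simp add: spN)
      note [measurable] = character_measurable[OF \<gamma>]
      show "integrable \<mu>G (\<lambda>x. ?f (\<gamma>, x))"
      proof (rule Bochner_Integration.integrable_bound)
        show "integrable \<mu>G (\<lambda>x. cmod (F \<gamma>) * cmod (v x))" using v by simp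
        show "(\<lambda>x. ?f (\<gamma>, x)) \<in> borel_measurable \<mu>G" by simp
      qed (use nrm[OF \<gamma>] in simp)
    qed
  qed
  have "(\<integral>x. inverse_fourier F x * cnj (v x) \<partial>\<mu>G) = (\<integral>x. (\<integral>\<gamma>. ?f (\<gamma>, x) \<partial>N) \<partial>\<mu>G)"
  proof (intro Bochner_Integration.integral_cong refl)
    fix x
    have "inverse_fourier F x * cnj (v x) = (\<integral>\<gamma>. F \<gamma> * \<gamma> x * cnj (v x) \<partial>\<mu>D)"
      unfolding inverse_fourier_def by simp
    also have "\<dots> = (\<integral>\<gamma>. F \<gamma> * (\<gamma> x * cnj (v x)) \<partial>N)"
      by (subst toN) (auto simp: mult.assoc)
    finally show "inverse_fourier F x * cnj (v x) = (\<integral>\<gamma>. ?f (\<gamma>, x) \<partial>N)" by simp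
  qed
  also have "\<dots> = (\<integral>\<gamma>. (\<integral>x. ?f (\<gamma>, x) \<partial>\<mu>G) \<partial>N)"
    by (rule P.Fubini_integral) (use int in \<open>simp add: case_prod_beta'\<close>)
  also have "\<dots> = (\<integral>\<gamma>. F \<gamma> * cnj (fourier \<mu>G v \<gamma>) \<partial>N)"
  proof (intro Bochner_Integration.integral_cong refl)
    fix \<gamma>
    have "cnj (fourier \<mu>G v \<gamma>) = (\<integral>x. \<gamma> x * cnj (v x) \<partial>\<mu>G)"
      unfolding fourier_def by (subst Bochner_Integration.integral_cnj[symmetric]) (simp add: mult.commute)
    then show "(\<integral>x. ?f (\<gamma>, x) \<partial>\<mu>G) = F \<gamma> * cnj (fourier \<mu>G v \<gamma>)" by simp
  qed
  also have "\<dots> = (\<integral>\<gamma>. F \<gamma> * cnj (fourier \<mu>G v \<gamma>) \<partial>\<mu>D)"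
  proof (rule toN)
    have "(\<lambda>\<gamma>. \<integral>x. \<gamma> x * cnj (v x) \<partial>\<mu>G) \<in> borel_measurable \<mu>D"
    proof (rule borel_measurable_lebesgue_integral)
      have ev': "(\<lambda>p. fst p (snd p)) \<in> borel_measurable (\<mu>D \<Otimes>\<^sub>M \<mu>G)"
        using evaluation_jointly_measurable
        by (subst measurable_cong_sets[OF sets_pair_measure_cong[OF refl sets_G] refl])
      show "(\<lambda>(\<gamma>, x). \<gamma> x * cnj (v x)) \<in> borel_measurable (\<mu>D \<Otimes>\<^sub>M \<mu>G)"
        unfolding case_prod_beta using ev' by measurable
    qed
    moreover have "cnj (fourier \<mu>G v \<gamma>) = (\<integral>x. \<gamma> x * cnj (v x) \<partial>\<mu>G)" for \<gamma>
      unfolding fourier_def by (subst Bochner_Integration.integral_cnj[symmetric]) (simp add: mult.commute)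
    ultimately show "(\<lambda>\<gamma>. cnj (fourier \<mu>G v \<gamma>)) \<in> borel_measurable \<mu>D" by simp
  qed
  finally show ?thesis .
qed

text \<open>
  Nothing is known beforehand about the integrability of \<open>w = u - inverse_fourier F\<close>, so \<open>w\<close> is
  paired with its own truncations \<open>v\<close>. The pairing is the squared norm of \<open>v\<close>, and by Plancherel
  and the previous lemma it equals the pairing of \<open>fourier u - F\<close> with the transform of \<open>v\<close>.
  This bounds the norm of \<open>v\<close> uniformly, and the truncations increase to \<open>w\<close>.
\<close>

lemma
  assumes E: "band \<mu>D E" and F: "F \<in> L2 \<mu>D" and supp: "\<And>\<gamma>. \<gamma> \<notin> E \<Longrightarrow> F \<gamma> = 0"
    and u: "L1_L2 u"
  shows inverse_fourier_L2: "inverse_fourier F \<in> L2 \<mu>G"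
    and inverse_fourier_error:
      "L2_norm_sq \<mu>G (\<lambda>x. u x - inverse_fourier F x) \<le> L2_norm_sq \<mu>D (\<lambda>\<gamma>. fourier \<mu>G u \<gamma> - F \<gamma>)"
proof -
  let ?D = "L2_norm_sq \<mu>D (\<lambda>\<gamma>. fourier \<mu>G u \<gamma> - F \<gamma>)"
  have FI: "integrable \<mu>D F" by (rule band_supported_integrable[OF E F supp])
  have gm [measurable]: "inverse_fourier F \<in> borel_measurable borel"
    by (intro borel_measurable_continuous_onI inverse_fourier_continuous FI)
  have um [measurable]: "u \<in> borel_measurable borel"
    using u by (auto simp: L1_L2_def intro: L2_G_measurable)
  define w where "w x = u x - inverse_fourier F x" for x
  have wm [measurable]: "w \<in> borel_measurable borel" unfolding w_def by measurable
  obtain A :: "nat \<Rightarrow> 'g set" where A: "range A \<subseteq> sets \<mu>G" "(\<Union>i. A i) = space \<mu>G"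
      "\<And>i. emeasure \<mu>G (A i) \<noteq> \<infinity>" "incseq A"
    using sigma_finite_incseq by blast
  have Am [measurable]: "A i \<in> sets borel" for i using A(1) by auto
  define B where "B k = {x \<in> A k. cmod (w x) \<le> real k}" for k
  have Bm [measurable]: "B k \<in> sets borel" for k
  proof -
    have "B k = A k \<inter> {x \<in> space borel. cmod (w x) \<le> real k}" by (auto simp: B_def)
    also have "\<dots> \<in> sets borel" by measurable
    finally show ?thesis .
  qed
  have Binc: "incseq B"
    using A(4) unfolding B_def incseq_def by (fastforce intro: order_trans)
  have bound: "(\<integral>\<^sup>+x. ennreal ((cmod (w x))\<^sup>2) * indicator (B k) x \<partial>\<mu>G) \<le> ennreal ?D" for k
  proof -
    define v where "v x = w x * indicator (B k) x" for x
    have vm [measurable]: "v \<in> borel_measurable borel" unfolding v_def by measurable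
    have vk: "cmod (v x) \<le> real k * indicator (A k) x" for x
      unfolding v_def B_def by (auto split: split_indicator)
    have IA: "integrable \<mu>G (\<lambda>x. indicator (A k) x :: real)" using A(3) by (simp add: less_top)
    have v: "L1_L2 v" unfolding L1_L2_def
    proof
      show "integrable \<mu>G v"
      proof (rule Bochner_Integration.integrable_bound)
        show "integrable \<mu>G (\<lambda>x. real k * indicator (A k) x)" using IA by simp
        show "v \<in> borel_measurable \<mu>G" by measurable
      qed (use vk in \<open>auto intro!: AE_I2\<close>)
      show "v \<in> L2 \<mu>G"
      proof (rule L2_bound(1))
        show "integrable \<mu>G (\<lambda>x. (real k)\<^sup>2 * indicator (A k) x)" using IA by simp
        show "v \<in> borel_measurable \<mu>G" by measurable
        fix x
        have "(cmod (v x))\<^sup>2 \<le> (real k * indicator (A k) x)\<^sup>2" by (intro power_mono vk) auto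
        then show "(cmod (v x))\<^sup>2 \<le> (real k)\<^sup>2 * indicator (A k) x"
          by (simp add: power_mult_distrib power2_eq_square split: split_indicator_asm split_indicator)
      qed
    qed
    have v': "integrable \<mu>G v" "v \<in> L2 \<mu>G" using v by (auto simp: L1_L2_def)
    have dL: "(\<lambda>\<gamma>. fourier \<mu>G u \<gamma> - F \<gamma>) \<in> L2 \<mu>D" by (rule L2_diff[OF fourier_L2[OF u] F])
    have Iu: "integrable \<mu>G (\<lambda>x. u x * cnj (v x))"
      using u v by (intro L2_inner_integrable) (auto simp: L1_L2_def)
    have Iv: "integrable \<mu>G (\<lambda>x. v x * cnj (v x))" by (rule L2_inner_integrable[OF v'(2) v'(2)])
    have vw: "v x * cnj (v x) = w x * cnj (v x)" for x by (simp add: v_def split: split_indicator)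
    have Ig: "integrable \<mu>G (\<lambda>x. inverse_fourier F x * cnj (v x))"
    proof -
      have "integrable \<mu>G (\<lambda>x. u x * cnj (v x) - v x * cnj (v x))" using Iu Iv by simp
      then show ?thesis unfolding vw w_def by (simp add: algebra_simps)
    qed
    have "complex_of_real (L2_norm_sq \<mu>G v) = (\<integral>x. v x * cnj (v x) \<partial>\<mu>G)"
      unfolding L2_norm_sq_def integral_complex_of_real[symmetric] by (simp add: complex_norm_square del: of_real_power integral_complex_of_real)
    also have "\<dots> = (\<integral>x. u x * cnj (v x) \<partial>\<mu>G) - (\<integral>x. inverse_fourier F x * cnj (v x) \<partial>\<mu>G)"
      using Iu Ig unfolding vw by (simp add: w_def left_diff_distrib)
    also have "\<dots> = (\<integral>\<gamma>. fourier \<mu>G u \<gamma> * cnj (fourier \<mu>G v \<gamma>) \<partial>\<mu>D) - (\<integral>\<gamma>. F \<gamma> * cnj (fourier \<mu>G v \<gamma>) \<partial>\<mu>D)"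
    proof -
      have "(\<integral>x. inverse_fourier F x * cnj (v x) \<partial>\<mu>G) = (\<integral>\<gamma>. F \<gamma> * cnj (fourier \<mu>G v \<gamma>) \<partial>\<mu>D)"
        by (rule inverse_fourier_pairing[OF E FI supp v'(1)])
      then show ?thesis by (simp only: plancherel_inner[OF u v])
    qed
    also have "\<dots> = (\<integral>\<gamma>. (fourier \<mu>G u \<gamma> - F \<gamma>) * cnj (fourier \<mu>G v \<gamma>) \<partial>\<mu>D)"
      using L2_inner_integrable[OF fourier_L2[OF u] fourier_L2[OF v]] L2_inner_integrable[OF F fourier_L2[OF v]]
      by (simp add: left_diff_distrib)
    finally have "L2_norm_sq \<mu>G v \<le> cmod (\<integral>\<gamma>. (fourier \<mu>G u \<gamma> - F \<gamma>) * cnj (fourier \<mu>G v \<gamma>) \<partial>\<mu>D)"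
      by (metis abs_ge_self norm_of_real)
    also have "\<dots> \<le> (?D + L2_norm_sq \<mu>D (fourier \<mu>G v)) / 2"
      by (rule L2_inner_le[OF dL fourier_L2[OF v]])
    finally have "L2_norm_sq \<mu>G v \<le> ?D" unfolding fourier_norm[OF v] by simp
    moreover have "(\<integral>\<^sup>+x. ennreal ((cmod (w x))\<^sup>2) * indicator (B k) x \<partial>\<mu>G) = ennreal (L2_norm_sq \<mu>G v)"
    proof -
      have "(\<integral>\<^sup>+x. ennreal ((cmod (w x))\<^sup>2) * indicator (B k) x \<partial>\<mu>G) = (\<integral>\<^sup>+x. ennreal ((cmod (v x))\<^sup>2) \<partial>\<mu>G)"
        unfolding v_def by (intro nn_integral_cong) (auto split: split_indicator)
      also have "\<dots> = ennreal (L2_norm_sq \<mu>G v)"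
        unfolding L2_norm_sq_def by (intro nn_integral_eq_integral L2_integrable v') auto
      finally show ?thesis .
    qed
    ultimately show ?thesis by (simp add: ennreal_leI)
  qed
  have sup: "ennreal ((cmod (w x))\<^sup>2) = (SUP k. ennreal ((cmod (w x))\<^sup>2) * indicator (B k) x)" for x
  proof -
    have "(\<Union>k. B k) = UNIV"
    proof (intro equalityI subsetI UNIV_I)
      fix x
      obtain i where i: "x \<in> A i" using A(2) by auto
      obtain l where l: "cmod (w x) \<le> real l" using real_arch_simple[of "cmod (w x)"] by blast
      have "A i \<subseteq> A (max i l)" by (rule incseqD[OF A(4)]) simp
      then have "x \<in> A (max i l)" using i by blast
      moreover have "cmod (w x) \<le> real (max i l)" using l by linarith
      ultimately have "x \<in> B (max i l)" by (simp add: B_def)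
      then show "x \<in> (\<Union>k. B k)" by (rule UN_I[OF UNIV_I])
    qed
    then have "x \<in> (\<Union>k. B k)" by simp
    then obtain k where k: "x \<in> B k" by (elim UN_E)
    show ?thesis
    proof (rule antisym)
      show "ennreal ((cmod (w x))\<^sup>2) \<le> (SUP k. ennreal ((cmod (w x))\<^sup>2) * indicator (B k) x)"
        using k by (intro SUP_upper2[of k]) auto
    qed (auto intro!: SUP_least split: split_indicator)
  qed
  have "(\<integral>\<^sup>+x. ennreal ((cmod (w x))\<^sup>2) \<partial>\<mu>G)
      = (\<integral>\<^sup>+x. (SUP k. ennreal ((cmod (w x))\<^sup>2) * indicator (B k) x) \<partial>\<mu>G)"
    by (rule nn_integral_cong) (rule sup)
  also have "\<dots> = (SUP k. \<integral>\<^sup>+x. ennreal ((cmod (w x))\<^sup>2) * indicator (B k) x \<partial>\<mu>G)"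
  proof (rule nn_integral_monotone_convergence_SUP)
    show "incseq (\<lambda>k x. ennreal ((cmod (w x))\<^sup>2) * indicator (B k) x)"
      using Binc by (auto simp: incseq_def le_fun_def split: split_indicator)
  qed measurable
  also have "\<dots> \<le> ennreal ?D" using bound by (intro SUP_least)
  finally have le: "(\<integral>\<^sup>+x. ennreal ((cmod (w x))\<^sup>2) \<partial>\<mu>G) \<le> ennreal ?D" .
  have wG: "w \<in> borel_measurable \<mu>G" by measurable
  have wL: "w \<in> L2 \<mu>G"
    unfolding L2_def
  proof (intro CollectI conjI wG integrableI_nonneg)
    show "(\<lambda>x. (cmod (w x))\<^sup>2) \<in> borel_measurable \<mu>G" by measurable
    show "(\<integral>\<^sup>+x. ennreal ((cmod (w x))\<^sup>2) \<partial>\<mu>G) < \<infinity>" using le by (simp add: le_less_trans)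
  qed auto
  have "(\<lambda>x. u x - w x) \<in> L2 \<mu>G" using u wL by (intro L2_diff) (auto simp: L1_L2_def)
  then show "inverse_fourier F \<in> L2 \<mu>G" by (simp add: w_def)
  have "(\<integral>\<^sup>+x. ennreal ((cmod (w x))\<^sup>2) \<partial>\<mu>G) = ennreal (L2_norm_sq \<mu>G w)"
    unfolding L2_norm_sq_def by (intro nn_integral_eq_integral L2_integrable wL) auto
  then show "L2_norm_sq \<mu>G (\<lambda>x. u x - inverse_fourier F x) \<le> ?D"
    using le L2_norm_sq_nonneg[of \<mu>D] by (simp add: w_def[abs_def])
qed

text \<open>
  A sequence in \<open>L\<^sup>1 \<inter> L\<^sup>2\<close> that converges to \<open>f\<close> and whose transforms converge to \<open>F\<close> also
  converges to \<open>inverse_fourier F\<close>.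
\<close>

lemma band_limited_continuous_representative:
  assumes E: "band \<mu>D E" and f: "f \<in> band_limited \<mu>G \<mu>D E"
  shows "\<exists>g. continuous_on UNIV g \<and> (AE x in \<mu>G. g x = f x)"
proof -
  obtain F u where fL: "f \<in> L2 \<mu>G" and FL: "F \<in> L2 \<mu>D" and u: "\<And>k. L1_L2 (u k)"
    and uf: "(\<lambda>k. L2_norm_sq \<mu>G (\<lambda>x. u k x - f x)) \<longlonglongrightarrow> 0"
    and uF: "(\<lambda>k. L2_norm_sq \<mu>D (\<lambda>\<gamma>. fourier \<mu>G (u k) \<gamma> - F \<gamma>)) \<longlonglongrightarrow> 0"
    and supp: "AE \<gamma> in \<mu>D. \<gamma> \<notin> E \<longrightarrow> F \<gamma> = 0"
    using f unfolding band_limited_def has_fourier_L2_def L1_L2_def by blast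
  have [measurable]: "E \<in> sets \<mu>D" using E by (simp add: band_def)
  note [measurable] = L2_measurable[OF FL]
  define F0 where "F0 \<gamma> = F \<gamma> * indicator E \<gamma>" for \<gamma>
  have F0L: "F0 \<in> L2 \<mu>D"
    unfolding F0_def by (rule L2_mult_bounded[OF FL, where B = 1]) (auto split: split_indicator)
  have F0: "F0 \<gamma> = 0" if "\<gamma> \<notin> E" for \<gamma> using that by (simp add: F0_def)
  have eq: "L2_norm_sq \<mu>D (\<lambda>\<gamma>. fourier \<mu>G (u k) \<gamma> - F0 \<gamma>) = L2_norm_sq \<mu>D (\<lambda>\<gamma>. fourier \<mu>G (u k) \<gamma> - F \<gamma>)" for k
  proof (rule L2_norm_sq_cong_AE)
    note [measurable] = L2_measurable[OF fourier_L2[OF u[of k]]] L2_measurable[OF F0L]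
    show "(\<lambda>\<gamma>. fourier \<mu>G (u k) \<gamma> - F0 \<gamma>) \<in> borel_measurable \<mu>D"
      "(\<lambda>\<gamma>. fourier \<mu>G (u k) \<gamma> - F \<gamma>) \<in> borel_measurable \<mu>D" by measurable
    show "AE \<gamma> in \<mu>D. fourier \<mu>G (u k) \<gamma> - F0 \<gamma> = fourier \<mu>G (u k) \<gamma> - F \<gamma>"
      using supp by eventually_elim (auto simp: F0_def split: split_indicator)
  qed
  let ?g = "inverse_fourier F0"
  have gL: "?g \<in> L2 \<mu>G" by (rule inverse_fourier_L2[OF E F0L F0 u])
  have "(\<lambda>k. 2 * L2_norm_sq \<mu>G (\<lambda>x. u k x - f x) + 2 * L2_norm_sq \<mu>D (\<lambda>\<gamma>. fourier \<mu>G (u k) \<gamma> - F \<gamma>)) \<longlonglongrightarrow> 2 * 0 + 2 * 0"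
    by (intro tendsto_intros uf uF)
  moreover have "L2_norm_sq \<mu>G (\<lambda>x. f x - ?g x) \<le> 2 * L2_norm_sq \<mu>G (\<lambda>x. u k x - f x) + 2 * L2_norm_sq \<mu>D (\<lambda>\<gamma>. fourier \<mu>G (u k) \<gamma> - F \<gamma>)" for k
  proof -
    have "L2_norm_sq \<mu>G (\<lambda>x. f x - ?g x) \<le> 2 * L2_norm_sq \<mu>G (\<lambda>x. f x - u k x) + 2 * L2_norm_sq \<mu>G (\<lambda>x. u k x - ?g x)"
      using u[of k] by (intro L2_norm_sq_triangle fL gL) (simp add: L1_L2_def)
    moreover have "L2_norm_sq \<mu>G (\<lambda>x. u k x - ?g x) \<le> L2_norm_sq \<mu>D (\<lambda>\<gamma>. fourier \<mu>G (u k) \<gamma> - F0 \<gamma>)"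
      by (rule inverse_fourier_error[OF E F0L F0 u])
    ultimately show ?thesis unfolding eq L2_norm_sq_diff_commute[of \<mu>G f] by linarith
  qed
  ultimately have "L2_norm_sq \<mu>G (\<lambda>x. f x - ?g x) \<le> 2 * 0 + 2 * 0"
    by (intro LIMSEQ_le_const) auto
  then have "L2_norm_sq \<mu>G (\<lambda>x. f x - ?g x) = 0" using L2_norm_sq_nonneg[of \<mu>G] by (simp add: antisym)
  then have "AE x in \<mu>G. f x - ?g x = 0" using L2_norm_sq_zero_iff[OF L2_diff[OF fL gL]] by simp
  then have "AE x in \<mu>G. ?g x = f x" by eventually_elim simp
  then show ?thesis
    using inverse_fourier_continuous[OF band_supported_integrable, OF E F0L F0] by blast
qed

text \<open>
  The approximating sequence for \<open>F\<close> converges in \<open>L\<^sup>2(G)\<close> as well, so \<open>F\<close> is the transform of its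
  inverse transform; if that is zero, the approximating transforms tend to zero in norm.
\<close>

lemma fourier_closure_band_limited:
  assumes E: "band \<mu>D E" and F: "F \<in> fourier_closure" and supp: "\<And>\<gamma>. \<gamma> \<notin> E \<Longrightarrow> F \<gamma> = 0"
  shows "inverse_fourier F \<in> band_limited \<mu>G \<mu>D E"
    and "L2_norm_sq \<mu>G (inverse_fourier F) = 0 \<Longrightarrow> L2_norm_sq \<mu>D F = 0"
proof -
  note FL = fourier_closure_L2[OF F]
  have "\<exists>u. L1_L2 u \<and> L2_norm_sq \<mu>D (\<lambda>\<gamma>. fourier \<mu>G u \<gamma> - F \<gamma>) < inverse (real (Suc k))" for k
    using F by (simp add: fourier_closure_def)
  then have "\<forall>k. \<exists>u. L1_L2 u \<and> L2_norm_sq \<mu>D (\<lambda>\<gamma>. fourier \<mu>G u \<gamma> - F \<gamma>) < inverse (real (Suc k))" by blast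
  from choice[OF this] obtain u where u: "\<And>k. L1_L2 (u k)"
    "\<And>k. L2_norm_sq \<mu>D (\<lambda>\<gamma>. fourier \<mu>G (u k) \<gamma> - F \<gamma>) < inverse (real (Suc k))" by blast
  have gL: "inverse_fourier F \<in> L2 \<mu>G" by (rule inverse_fourier_L2[OF E FL supp u(1)])
  have uF: "(\<lambda>k. L2_norm_sq \<mu>D (\<lambda>\<gamma>. fourier \<mu>G (u k) \<gamma> - F \<gamma>)) \<longlonglongrightarrow> 0"
    by (rule tendsto_sandwich[OF _ _ tendsto_const LIMSEQ_inverse_real_of_nat])
      (auto intro!: always_eventually L2_norm_sq_nonneg less_imp_le u(2) simp del: of_nat_Suc)
  have ug: "(\<lambda>k. L2_norm_sq \<mu>G (\<lambda>x. u k x - inverse_fourier F x)) \<longlonglongrightarrow> 0"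
    by (rule tendsto_sandwich[OF _ _ tendsto_const uF])
      (auto intro!: always_eventually L2_norm_sq_nonneg inverse_fourier_error[OF E FL supp u(1)])
  have "has_fourier_L2 \<mu>G \<mu>D (inverse_fourier F) F"
    unfolding has_fourier_L2_def using gL FL ug uF u(1)
    by (intro conjI exI[of _ u]) (auto simp: L1_L2_def)
  then show "inverse_fourier F \<in> band_limited \<mu>G \<mu>D E"
    unfolding band_limited_def using supp by blast
  assume z: "L2_norm_sq \<mu>G (inverse_fourier F) = 0"
  have "L2_norm_sq \<mu>D F \<le> 6 * L2_norm_sq \<mu>D (\<lambda>\<gamma>. fourier \<mu>G (u k) \<gamma> - F \<gamma>)" for k
  proof -
    have "L2_norm_sq \<mu>D F \<le> 2 * L2_norm_sq \<mu>D (\<lambda>\<gamma>. F \<gamma> - fourier \<mu>G (u k) \<gamma>) + 2 * L2_norm_sq \<mu>D (fourier \<mu>G (u k))"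
      using L2_norm_sq_add_le[OF L2_diff[OF FL fourier_L2[OF u(1)[of k]]] fourier_L2[OF u(1)[of k]]] by simp
    moreover have "L2_norm_sq \<mu>D (fourier \<mu>G (u k)) \<le> 2 * L2_norm_sq \<mu>G (\<lambda>x. u k x - inverse_fourier F x)"
      using L2_norm_sq_add_le[OF L2_diff[OF _ gL] gL, of "u k"] u(1)[of k] z
      by (simp add: fourier_norm L1_L2_def)
    moreover have "L2_norm_sq \<mu>G (\<lambda>x. u k x - inverse_fourier F x) \<le> L2_norm_sq \<mu>D (\<lambda>\<gamma>. fourier \<mu>G (u k) \<gamma> - F \<gamma>)"
      by (rule inverse_fourier_error[OF E FL supp u(1)])
    ultimately show ?thesis unfolding L2_norm_sq_diff_commute[of \<mu>D F] by linarith
  qed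
  then have "L2_norm_sq \<mu>D F \<le> 6 * 0"
    by (intro LIMSEQ_le_const[OF tendsto_mult[OF tendsto_const uF]]) auto
  then show "L2_norm_sq \<mu>D F = 0" using L2_norm_sq_nonneg[of \<mu>D F] by simp
qed

text \<open>
  Near \<open>0\<close> a character is close to \<open>1\<close>, so the integral of its conjugate over a small
  neighbourhood of \<open>0\<close> is nonzero. Countably many neighbourhoods serve all characters.
\<close>

lemma fourier_of_small_neighbourhoods:
  obtains u :: "nat \<Rightarrow> 'g \<Rightarrow> complex" where "\<And>k. L1_L2 (u k)"
    "\<And>\<gamma>. \<gamma> \<in> characters \<Longrightarrow> \<exists>k. fourier \<mu>G (u k) \<gamma> \<noteq> 0"
proof -
  obtain U0 K0 :: "'g set" where U0: "open U0" "compact K0" "0 \<in> U0" "U0 \<subseteq> K0"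
  proof -
    have "\<exists>U K. open U \<and> compact K \<and> (0::'g) \<in> U \<and> U \<subseteq> K"
      using locally_compact unfolding locally_compact_space_def by simp
    then show ?thesis using that by blast
  qed
  obtain A :: "nat \<Rightarrow> 'g set" where A: "\<And>i. open (A i)" "\<And>i. 0 \<in> A i"
    "\<And>S. open S \<Longrightarrow> 0 \<in> S \<Longrightarrow> eventually (\<lambda>i. A i \<subseteq> S) sequentially"
    by (rule countable_basis_at_decseq[of "0 :: 'g"]) auto
  define B where "B k = A k \<inter> U0" for k
  have Bo: "open (B k)" "0 \<in> B k" for k using A U0 by (auto simp: B_def)
  have [measurable]: "B k \<in> sets borel" for k using Bo by simp
  have Bfin: "emeasure \<mu>G (B k) < \<infinity>" for k
  proof -
    have "emeasure \<mu>G (B k) \<le> emeasure \<mu>G K0"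
      using U0 by (intro emeasure_mono) (auto simp: B_def borel_compact)
    also have "\<dots> < \<infinity>" using haar U0(2) by (simp add: haar_measure_def)
    finally show ?thesis .
  qed
  have Bpos: "measure \<mu>G (B k) > 0" for k
  proof -
    have "emeasure \<mu>G (B k) > 0" using haar Bo[of k] by (auto simp: haar_measure_def)
    then show ?thesis using Bfin[of k] by (simp add: measure_def enn2real_positive_iff)
  qed
  define u where "u k x = complex_of_real (indicator (B k) x)" for k x
  have Ir: "integrable \<mu>G (\<lambda>x. indicator (B k) x :: real)" for k using Bfin by simp
  show thesis
  proof (rule that[of u])
    fix k
    have "integrable \<mu>G (u k)" unfolding u_def using Ir by (intro integrable_of_real)
    moreover have "(cmod (u k x))\<^sup>2 = indicator (B k) x" for x
      by (simp add: u_def power2_eq_square split: split_indicator)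
    ultimately show "L1_L2 (u k)" using Ir by (auto simp: L1_L2_def L2_def)
  next
    fix \<gamma> :: "'g \<Rightarrow> complex" assume \<gamma>: "\<gamma> \<in> characters"
    have "open (\<gamma> -` ball 1 (1/2))" by (intro open_vimage character_continuous[OF \<gamma>]) auto
    moreover have "0 \<in> \<gamma> -` ball 1 (1/2)" using character_zero[OF \<gamma>] by simp
    ultimately have "eventually (\<lambda>i. A i \<subseteq> \<gamma> -` ball 1 (1/2)) sequentially" by (rule A(3))
    then obtain k where k: "A k \<subseteq> \<gamma> -` ball 1 (1/2)" by (auto dest: eventually_happens)
    have Iu: "integrable \<mu>G (\<lambda>x. u k x * cnj (\<gamma> x))"
      using Ir by (intro fourier_integrable \<gamma>) (simp add: u_def)
    have "measure \<mu>G (B k) / 2 = (\<integral>x. indicator (B k) x / 2 \<partial>\<mu>G)" by simp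
    also have "\<dots> \<le> (\<integral>x. Re (u k x * cnj (\<gamma> x)) \<partial>\<mu>G)"
    proof (rule integral_mono)
      show "integrable \<mu>G (\<lambda>x. indicator (B k) x / 2 :: real)" using Ir by simp
      show "integrable \<mu>G (\<lambda>x. Re (u k x * cnj (\<gamma> x)))" using Iu by (rule integrable_Re)
      fix x
      show "indicator (B k) x / 2 \<le> Re (u k x * cnj (\<gamma> x))"
      proof (cases "x \<in> B k")
        case True
        then have "cmod (1 - \<gamma> x) < 1/2" using k by (auto simp: B_def dist_norm)
        then have "Re (1 - \<gamma> x) < 1/2" using complex_Re_le_cmod[of "1 - \<gamma> x"] by linarith
        then show ?thesis using True by (simp add: u_def)
      qed (simp add: u_def)
    qed
    also have "\<dots> = Re (fourier \<mu>G (u k) \<gamma>)" unfolding fourier_def by (rule integral_Re[OF Iu])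
    finally have "fourier \<mu>G (u k) \<gamma> \<noteq> 0" using Bpos[of k] by auto
    then show "\<exists>k. fourier \<mu>G (u k) \<gamma> \<noteq> 0" by blast
  qed
qed

text \<open>
  Otherwise the restrictions to \<open>E\<close> of the transforms of the previous lemma vanish almost
  everywhere, but at each character one of these countably many transforms is nonzero.
\<close>

lemma band_limited_nonzero:
  assumes E: "band \<mu>D E" and pos: "emeasure \<mu>D E \<noteq> 0"
  shows "\<exists>f\<in>band_limited \<mu>G \<mu>D E. L2_norm_sq \<mu>G f \<noteq> 0"
proof (rule ccontr)
  assume contra: "\<not> ?thesis"
  obtain u :: "nat \<Rightarrow> 'g \<Rightarrow> complex" where u: "\<And>k. L1_L2 (u k)"
    "\<And>\<gamma>. \<gamma> \<in> characters \<Longrightarrow> \<exists>k. fourier \<mu>G (u k) \<gamma> \<noteq> 0"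
    using fourier_of_small_neighbourhoods by blast
  have Em: "E \<in> sets \<mu>D" using E by (simp add: band_def)
  have "AE \<gamma> in \<mu>D. fourier \<mu>G (u k) \<gamma> * indicator E \<gamma> = 0" for k
  proof -
    have F: "(\<lambda>\<gamma>. fourier \<mu>G (u k) \<gamma> * indicator E \<gamma>) \<in> fourier_closure"
      by (intro fourier_closure_indicator Em fourier_in_fourier_closure u)
    have "L2_norm_sq \<mu>D (\<lambda>\<gamma>. fourier \<mu>G (u k) \<gamma> * indicator E \<gamma>) = 0"
      using fourier_closure_band_limited[OF E F] contra by auto
    then show ?thesis using L2_norm_sq_zero_iff[OF fourier_closure_L2[OF F]] by simp
  qed
  then have "AE \<gamma> in \<mu>D. \<forall>k. fourier \<mu>G (u k) \<gamma> * indicator E \<gamma> = 0"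
    unfolding AE_all_countable ..
  then have "AE \<gamma> in \<mu>D. \<gamma> \<notin> E"
    using AE_space by eventually_elim (use u(2) in \<open>force split: split_indicator_asm\<close>)
  then have "emeasure \<mu>D E = 0"
    using Em sets.sets_into_space[OF Em]
    by (subst (asm) AE_iff_measurable[of E]) auto
  then show False using pos by simp
qed

lemma band_limited_L2: "f \<in> band_limited \<mu>G \<mu>D E \<Longrightarrow> f \<in> L2 \<mu>G"
  by (auto simp: band_limited_def has_fourier_L2_def)

lemma band_limited_translate:
  assumes f: "f \<in> band_limited \<mu>G \<mu>D E"
  shows "(\<lambda>x. f (a + x)) \<in> band_limited \<mu>G \<mu>D E"
proof -
  obtain F u where fL: "f \<in> L2 \<mu>G" and FL: "F \<in> L2 \<mu>D" and u: "\<And>k. L1_L2 (u k)"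
    and uf: "(\<lambda>k. L2_norm_sq \<mu>G (\<lambda>x. u k x - f x)) \<longlonglongrightarrow> 0"
    and uF: "(\<lambda>k. L2_norm_sq \<mu>D (\<lambda>\<gamma>. fourier \<mu>G (u k) \<gamma> - F \<gamma>)) \<longlonglongrightarrow> 0"
    and supp: "AE \<gamma> in \<mu>D. \<gamma> \<notin> E \<longrightarrow> F \<gamma> = 0"
    using f unfolding band_limited_def has_fourier_L2_def L1_L2_def by blast
  have "L2_norm_sq \<mu>G (\<lambda>x. u k (a + x) - f (a + x)) = L2_norm_sq \<mu>G (\<lambda>x. u k x - f x)" for k
    using u[of k] fL by (intro L2_norm_sq_translate[of "\<lambda>x. u k x - f x"] borel_measurable_diff L2_G_measurable)
      (auto simp: L1_L2_def)
  moreover have "L2_norm_sq \<mu>D (\<lambda>\<gamma>. fourier \<mu>G (\<lambda>x. u k (a + x)) \<gamma> - F \<gamma> * \<gamma> a)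
      = L2_norm_sq \<mu>D (\<lambda>\<gamma>. fourier \<mu>G (u k) \<gamma> - F \<gamma>)" for k
    unfolding L2_norm_sq_def
  proof (intro Bochner_Integration.integral_cong refl)
    fix \<gamma> assume "\<gamma> \<in> space \<mu>D"
    then have \<gamma>: "\<gamma> \<in> characters" by simp
    have "fourier \<mu>G (\<lambda>x. u k (a + x)) \<gamma> - F \<gamma> * \<gamma> a = \<gamma> a * (fourier \<mu>G (u k) \<gamma> - F \<gamma>)"
      using u[of k] by (simp add: fourier_translate[OF _ \<gamma>] L1_L2_def right_diff_distrib mult.commute)
    then show "(cmod (fourier \<mu>G (\<lambda>x. u k (a + x)) \<gamma> - F \<gamma> * \<gamma> a))\<^sup>2 = (cmod (fourier \<mu>G (u k) \<gamma> - F \<gamma>))\<^sup>2"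
      by (simp add: norm_mult character_norm[OF \<gamma>])
  qed
  moreover have "(\<lambda>\<gamma>. F \<gamma> * \<gamma> a) \<in> L2 \<mu>D"
    by (rule L2_mult_bounded[OF FL, where B = 1]) (auto simp: character_norm)
  ultimately have "has_fourier_L2 \<mu>G \<mu>D (\<lambda>x. f (a + x)) (\<lambda>\<gamma>. F \<gamma> * \<gamma> a)"
    unfolding has_fourier_L2_def using L2_translate[OF fL] uf uF L1_L2_translate[OF u]
    by (intro conjI exI[of _ "\<lambda>k x. u k (a + x)"]) (auto simp: L1_L2_def)
  moreover have "AE \<gamma> in \<mu>D. \<gamma> \<notin> E \<longrightarrow> F \<gamma> * \<gamma> a = 0" using supp by eventually_elim auto
  ultimately show ?thesis unfolding band_limited_def by blast
qed

lemma continuous_AE_eq_imp_eq: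
  fixes g h :: "'g \<Rightarrow> complex"
  assumes g: "continuous_on UNIV g" and h: "continuous_on UNIV h" and AE: "AE x in \<mu>G. g x = h x"
  shows "g = h"
proof (rule ccontr)
  assume "g \<noteq> h"
  then have ne: "{x. g x \<noteq> h x} \<noteq> {}" by auto
  have o: "open {x. g x \<noteq> h x}" by (intro open_Collect_neq g h)
  then have "emeasure \<mu>G {x. g x \<noteq> h x} > 0"
    using haar ne by (auto simp: haar_measure_def)
  moreover have "emeasure \<mu>G {x. g x \<noteq> h x} = 0"
    using AE o by (subst (asm) AE_iff_measurable[OF _ refl]) auto
  ultimately show False by simp
qed

lemma continuous_rep_eqI:
  assumes "continuous_on UNIV g" "AE x in \<mu>G. g x = f x"
  shows "continuous_rep \<mu>G f = g"
  unfolding continuous_rep_def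
proof (rule the_equality)
  fix h assume h: "continuous_on UNIV h \<and> (AE x in \<mu>G. h x = f x)"
  have "AE x in \<mu>G. h x = g x" using conjunct2[OF h] assms(2) by eventually_elim simp
  then show "h = g" using h assms(1) by (intro continuous_AE_eq_imp_eq) auto
qed (use assms in blast)

lemma
  assumes E: "band \<mu>D E" and f: "f \<in> band_limited \<mu>G \<mu>D E"
  shows continuous_rep_continuous: "continuous_on UNIV (continuous_rep \<mu>G f)"
    and continuous_rep_AE: "AE x in \<mu>G. continuous_rep \<mu>G f x = f x"
    and continuous_rep_translate:
      "continuous_rep \<mu>G (\<lambda>x. f (a + x)) = (\<lambda>x. continuous_rep \<mu>G f (a + x))"
proof -
  obtain g where g: "continuous_on UNIV g" "AE x in \<mu>G. g x = f x"
    using band_limited_continuous_representative[OF E f] by blast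
  have eq: "continuous_rep \<mu>G f = g" by (rule continuous_rep_eqI[OF g])
  show "continuous_on UNIV (continuous_rep \<mu>G f)" "AE x in \<mu>G. continuous_rep \<mu>G f x = f x"
    unfolding eq using g by auto
  note [measurable] = borel_measurable_continuous_onI[OF g(1)] L2_G_measurable[OF band_limited_L2[OF f]]
  show "continuous_rep \<mu>G (\<lambda>x. f (a + x)) = (\<lambda>x. continuous_rep \<mu>G f (a + x))"
    unfolding eq
  proof (rule continuous_rep_eqI)
    show "continuous_on UNIV (\<lambda>x. g (a + x))"
      by (rule continuous_on_compose2[OF g(1)]) (auto intro!: continuous_intros)
    show "AE x in \<mu>G. g (a + x) = f (a + x)" by (rule AE_translate[OF _ g(2)]) measurable
  qed
qed

end

section \<open>Images of a subgroup under an automorphism\<close>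

lemma
  assumes "topological_aut \<eta>"
  shows topological_aut_add: "\<eta> (x + y) = \<eta> x + \<eta> y"
    and topological_aut_inj: "inj \<eta>"
    and topological_aut_inv: "inv \<eta> (\<eta> x) = x" "\<eta> (inv \<eta> y) = y"
    and topological_aut_continuous: "continuous_on UNIV \<eta>" "continuous_on UNIV (inv \<eta>)"
  using assms by (auto simp: topological_aut_def bij_is_inj bij_is_surj surj_f_inv_f)

lemma
  assumes aut: "topological_aut \<eta>"
  shows topological_aut_zero: "\<eta> 0 = 0"
    and topological_aut_uminus: "\<eta> (- x) = - \<eta> x"
    and topological_aut_inv_add: "inv \<eta> (x + y) = inv \<eta> x + inv \<eta> y"
proof -
  have "\<eta> 0 + \<eta> 0 = \<eta> 0 + 0" using topological_aut_add[OF aut, of 0 0] by simp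
  then show z: "\<eta> 0 = 0" by (simp only: add_left_cancel)
  have "\<eta> (- x) + \<eta> x = 0" using topological_aut_add[OF aut, of "- x" x] z by simp
  then show "\<eta> (- x) = - \<eta> x" by (simp add: eq_neg_iff_add_eq_0)
  have "\<eta> (inv \<eta> x + inv \<eta> y) = x + y"
    by (simp add: topological_aut_add[OF aut] topological_aut_inv(2)[OF aut])
  then show "inv \<eta> (x + y) = inv \<eta> x + inv \<eta> y" using topological_aut_inv(1)[OF aut] by metis
qed

lemma topological_aut_image_eq_vimage:
  "topological_aut \<eta> \<Longrightarrow> \<eta> ` A = inv \<eta> -` A"
  by (rule bij_image_Collect_eq[of \<eta> "\<lambda>x. x \<in> A", simplified, folded vimage_def])
    (simp add: topological_aut_def)

lemma closed_subgroup_image: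
  assumes aut: "topological_aut \<eta>" and sub: "closed_subgroup \<Gamma>"
  shows "closed_subgroup (\<eta> ` \<Gamma>)"
proof -
  have "closed (inv \<eta> -` \<Gamma>)"
    using sub topological_aut_continuous(2)[OF aut] by (intro closed_vimage) (auto simp: closed_subgroup_def)
  moreover have "0 \<in> \<eta> ` \<Gamma>"
    using sub topological_aut_zero[OF aut] by (auto simp: closed_subgroup_def image_iff intro!: bexI[of _ 0])
  moreover have "x + y \<in> \<eta> ` \<Gamma>" if "x \<in> \<eta> ` \<Gamma>" "y \<in> \<eta> ` \<Gamma>" for x y
  proof -
    obtain a b where "a \<in> \<Gamma>" "x = \<eta> a" "b \<in> \<Gamma>" "y = \<eta> b" using \<open>x \<in> \<eta> ` \<Gamma>\<close> \<open>y \<in> \<eta> ` \<Gamma>\<close> by blast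
    then show ?thesis
      using sub topological_aut_add[OF aut, of a b] by (auto simp: closed_subgroup_def intro!: image_eqI[of _ _ "a + b"])
  qed
  moreover have "- x \<in> \<eta> ` \<Gamma>" if "x \<in> \<eta> ` \<Gamma>" for x
  proof -
    obtain a where "a \<in> \<Gamma>" "x = \<eta> a" using \<open>x \<in> \<eta> ` \<Gamma>\<close> by blast
    then show ?thesis
      using sub topological_aut_uminus[OF aut, of a] by (auto simp: closed_subgroup_def intro!: image_eqI[of _ _ "- a"])
  qed
  ultimately show ?thesis
    unfolding closed_subgroup_def by (simp add: topological_aut_image_eq_vimage[OF aut])
qed

lemma coset_image:
  assumes aut: "topological_aut \<eta>"
  shows "\<eta> ` ((+) x ` \<Gamma>) = (+) (\<eta> x) ` (\<eta> ` \<Gamma>)"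
  by (simp add: image_image topological_aut_add[OF aut])

lemma co_compact_image:
  assumes aut: "topological_aut \<eta>" and co: "co_compact \<Gamma>"
  shows "co_compact (\<eta> ` \<Gamma>)"
proof -
  have im: "(`) \<eta> ` cosets \<Gamma> = cosets (\<eta> ` \<Gamma>)"
  proof -
    have "(`) \<eta> ` cosets \<Gamma> = range (\<lambda>x. (+) (\<eta> x) ` (\<eta> ` \<Gamma>))"
      unfolding cosets_def image_image[of _ _ UNIV] coset_image[OF aut] ..
    also have "\<dots> = (\<lambda>y. (+) y ` (\<eta> ` \<Gamma>)) ` range \<eta>" unfolding image_image[of _ \<eta> UNIV] ..
    also have "range \<eta> = UNIV" using aut by (simp add: topological_aut_def bij_is_surj)
    finally show ?thesis by (simp add: cosets_def)
  qed
  have "continuous_map (quotient_topology \<Gamma>) (quotient_topology (\<eta> ` \<Gamma>)) ((`) \<eta>)"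
    unfolding continuous_map_def topspace_quotient_topology
  proof (intro conjI allI impI)
    show "(`) \<eta> \<in> cosets \<Gamma> \<rightarrow> cosets (\<eta> ` \<Gamma>)" using im by blast
    fix U assume "openin (quotient_topology (\<eta> ` \<Gamma>)) U"
    then have "open {y. (+) y ` (\<eta> ` \<Gamma>) \<in> U}" by (simp add: openin_quotient_topology)
    then have "open (\<eta> -` {y. (+) y ` (\<eta> ` \<Gamma>) \<in> U})"
      by (rule open_vimage[OF _ topological_aut_continuous(1)[OF aut]])
    moreover have "\<eta> -` {y. (+) y ` (\<eta> ` \<Gamma>) \<in> U} = {x. (+) x ` \<Gamma> \<in> {c \<in> cosets \<Gamma>. \<eta> ` c \<in> U}}"
      by (auto simp: cosets_def coset_image[OF aut])
    ultimately show "openin (quotient_topology \<Gamma>) {c \<in> cosets \<Gamma>. \<eta> ` c \<in> U}"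
      by (simp add: openin_quotient_topology)
  qed
  then have "compactin (quotient_topology (\<eta> ` \<Gamma>)) ((`) \<eta> ` cosets \<Gamma>)"
    using co by (intro image_compactin) (auto simp: co_compact_def compact_space_def topspace_quotient_topology)
  then show ?thesis by (simp add: im co_compact_def compact_space_def topspace_quotient_topology)
qed

lemma topological_aut_measurable:
  assumes aut: "topological_aut \<eta>" and sets: "sets \<mu>\<Gamma> = sets (borel_of (top_of_set \<Gamma>))"
  shows "\<eta> \<in> measurable \<mu>\<Gamma> (borel_of (top_of_set (\<eta> ` \<Gamma>)))"
proof (rule measurable_sigma_sets)
  have sp: "space \<mu>\<Gamma> = \<Gamma>" using sets_eq_imp_space_eq[OF sets] by simp
  show "sets (borel_of (top_of_set (\<eta> ` \<Gamma>))) = sigma_sets (\<eta> ` \<Gamma>) {U. openin (top_of_set (\<eta> ` \<Gamma>)) U}"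
    by (simp add: sets_borel_of)
  show "{U. openin (top_of_set (\<eta> ` \<Gamma>)) U} \<subseteq> Pow (\<eta> ` \<Gamma>)" by (auto dest: openin_imp_subset)
  show "\<eta> \<in> space \<mu>\<Gamma> \<rightarrow> \<eta> ` \<Gamma>" using sp by auto
  fix U assume "U \<in> {U. openin (top_of_set (\<eta> ` \<Gamma>)) U}"
  then obtain V where V: "open V" "U = \<eta> ` \<Gamma> \<inter> V" by (auto simp: openin_open)
  have "open (\<eta> -` V)" by (rule open_vimage[OF V(1) topological_aut_continuous(1)[OF aut]])
  moreover have "\<eta> -` U \<inter> space \<mu>\<Gamma> = \<Gamma> \<inter> \<eta> -` V" using V sp by auto
  ultimately show "\<eta> -` U \<inter> space \<mu>\<Gamma> \<in> sets \<mu>\<Gamma>"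
    unfolding sets using openin_open_Int openin_in_borel_of by metis
qed

text \<open>
  Together with \<open>closed_subgroup_image\<close> and \<open>co_compact_image\<close> this makes all results on
  periodizations over a closed co-compact subgroup apply to each \<open>\<eta>\<^sub>j\<Gamma>\<close> with the image measure.
\<close>

lemma haar_measure_image:
  fixes \<Gamma> :: "'g::{topological_ab_group_add, t2_space, second_countable_topology} set"
  assumes sub: "closed_subgroup \<Gamma>" and aut: "topological_aut \<eta>" and haar: "haar_measure (top_of_set \<Gamma>) (+) \<mu>\<Gamma>"
  shows "haar_measure (top_of_set (\<eta> ` \<Gamma>)) (+) (image_measure \<eta> \<Gamma> \<mu>\<Gamma>)"
proof -
  let ?\<nu> = "image_measure \<eta> \<Gamma> \<mu>\<Gamma>"
  have sets: "sets \<mu>\<Gamma> = sets (borel_of (top_of_set \<Gamma>))" and sp: "space \<mu>\<Gamma> = \<Gamma>"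
    using haar haar_measure_space[OF haar] by (auto simp: haar_measure_def)
  note m = topological_aut_measurable[OF aut sets]
  note inj = topological_aut_inj[OF aut]
  have em: "emeasure ?\<nu> A = emeasure \<mu>\<Gamma> (\<eta> -` A)"
    if "A \<in> sets (borel_of (top_of_set (\<eta> ` \<Gamma>)))" for A
  proof -
    have "A \<subseteq> \<eta> ` \<Gamma>" using sets.sets_into_space[OF that] by simp
    then have "\<eta> -` A \<inter> space \<mu>\<Gamma> = \<eta> -` A" using sp inj by (auto dest: injD)
    then show ?thesis using emeasure_distr[OF m that] by (simp add: image_measure_def)
  qed
  show ?thesis
    unfolding haar_measure_def topspace_euclidean_subtopology
  proof (intro conjI ballI allI impI)
    show s\<nu>: "sets ?\<nu> = sets (borel_of (top_of_set (\<eta> ` \<Gamma>)))" by (simp add: image_measure_def)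
    fix a A assume a: "a \<in> \<eta> ` \<Gamma>" and A: "A \<in> sets ?\<nu>"
    then obtain b where b: "b \<in> \<Gamma>" "a = \<eta> b" by auto
    have A': "A \<in> sets (borel_of (top_of_set (\<eta> ` \<Gamma>)))" using A s\<nu> by simp
    have "A \<subseteq> \<eta> ` \<Gamma>" using sets.sets_into_space[OF A'] by simp
    then have "\<eta> -` A \<inter> space \<mu>\<Gamma> = \<eta> -` A" using sp inj by (auto dest: injD)
    then have "\<eta> -` A \<in> sets \<mu>\<Gamma>" using measurable_sets[OF m A'] by simp
    then have inv: "emeasure \<mu>\<Gamma> ((+) b ` (\<eta> -` A)) = emeasure \<mu>\<Gamma> (\<eta> -` A)"
      using haar b(1) by (simp add: haar_measure_def)
    have vim: "\<eta> -` ((+) a ` A) = (+) b ` (\<eta> -` A)"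
    proof (intro set_eqI iffI)
      fix x assume "x \<in> \<eta> -` ((+) a ` A)"
      then obtain y where y: "y \<in> A" "\<eta> x = \<eta> b + y" using b(2) by auto
      have "x = b + inv \<eta> y"
        using arg_cong[OF y(2), of "inv \<eta>"]
        by (simp add: topological_aut_inv_add[OF aut] topological_aut_inv(1)[OF aut])
      moreover have "inv \<eta> y \<in> \<eta> -` A" using y(1) topological_aut_inv(2)[OF aut] by simp
      ultimately show "x \<in> (+) b ` (\<eta> -` A)" by blast
    qed (use b(2) topological_aut_add[OF aut] in auto)
    have "(+) a ` A \<in> sets ?\<nu>"
      by (rule subgroup_translate_image[OF closed_subgroup_image[OF aut sub] s\<nu> a A])
    then show "emeasure ?\<nu> ((+) a ` A) = emeasure ?\<nu> A"
      using em[of "(+) a ` A"] em[OF A'] inv vim s\<nu> by simp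
  next
    fix C assume C: "compactin (top_of_set (\<eta> ` \<Gamma>)) C"
    then have C': "compact C" "C \<subseteq> \<eta> ` \<Gamma>" by (auto simp: compactin_subtopology)
    have vim: "\<eta> -` C = inv \<eta> ` C"
      using topological_aut_inv[OF aut] by (auto simp: image_iff) (metis)+
    have "compact (inv \<eta> ` C)"
      using C' topological_aut_continuous(2)[OF aut]
      by (intro compact_continuous_image) (auto intro: continuous_on_subset)
    moreover have "inv \<eta> ` C \<subseteq> \<Gamma>" using C'(2) topological_aut_inv(1)[OF aut] by auto
    ultimately have "emeasure \<mu>\<Gamma> (inv \<eta> ` C) < \<infinity>"
      using haar by (simp add: haar_measure_def compactin_subtopology)
    moreover have "C \<in> sets (borel_of (top_of_set (\<eta> ` \<Gamma>)))"
      using C' by (intro closedin_in_borel_of) (auto intro: closed_subset compact_imp_closed)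
    ultimately show "emeasure ?\<nu> C < \<infinity>" using em vim by simp
  next
    fix U assume U: "openin (top_of_set (\<eta> ` \<Gamma>)) U \<and> U \<noteq> {}"
    then obtain V where V: "open V" "U = \<eta> ` \<Gamma> \<inter> V" by (auto simp: openin_open)
    have "open (\<eta> -` V)" by (rule open_vimage[OF V(1) topological_aut_continuous(1)[OF aut]])
    then have "openin (top_of_set \<Gamma>) (\<Gamma> \<inter> \<eta> -` V)" by (rule openin_open_Int)
    moreover have "\<eta> -` U = \<Gamma> \<inter> \<eta> -` V" using V(2) inj by (auto dest: injD)
    moreover have "\<eta> -` U \<noteq> {}" using U V(2) by auto
    ultimately have "emeasure \<mu>\<Gamma> (\<eta> -` U) > 0" using haar by (simp add: haar_measure_def)
    then show "emeasure ?\<nu> U > 0" using em openin_in_borel_of U by metis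
  qed
qed

section \<open>Tight sampling\<close>

lemma nn_integral_L2:
  "f \<in> L2 M \<Longrightarrow> (\<integral>\<^sup>+x. ennreal ((cmod (f x))\<^sup>2) \<partial>M) = ennreal (L2_norm_sq M f)"
  unfolding L2_norm_sq_def by (intro nn_integral_eq_integral L2_integrable) auto

locale sampling_family = plancherel_group \<mu>G \<mu>D
  for \<mu>G :: "'g::{topological_ab_group_add, t2_space, second_countable_topology} measure" and \<mu>D +
  fixes \<Gamma> :: "'g set" and \<mu>\<Gamma> :: "'g measure" and \<eta> :: "nat \<Rightarrow> 'g \<Rightarrow> 'g"
    and Q :: "nat \<Rightarrow> 'g set measure" and I :: "nat set" and E :: "('g \<Rightarrow> complex) set"
  assumes subgroup: "closed_subgroup \<Gamma>" and co_compact: "co_compact \<Gamma>"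
    and haar_\<Gamma>: "haar_measure (top_of_set \<Gamma>) (+) \<mu>\<Gamma>"
    and aut: "\<And>j. j \<in> I \<Longrightarrow> topological_aut (\<eta> j)"
    and weil: "\<And>j. j \<in> I \<Longrightarrow> weil_measure \<mu>G (\<eta> j ` \<Gamma>) (image_measure (\<eta> j) \<Gamma> \<mu>\<Gamma>) (Q j)"
    and band: "band \<mu>D E"
begin

abbreviation V where "V \<equiv> band_limited \<mu>G \<mu>D E"
abbreviation N where "N f \<equiv> L2_norm_sq \<mu>G f"
abbreviation sample where "sample f j \<equiv> sampling_transform \<mu>G \<eta> f j"
abbreviation \<nu> where "\<nu> j \<equiv> image_measure (\<eta> j) \<Gamma> \<mu>\<Gamma>"
abbreviation s where "s j \<equiv> measure (Q j) (cosets (\<eta> j ` \<Gamma>))"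

text \<open>
  The function \<open>|g|\<^sup>2\<close> whose periodizations are the squared norms of samples.
\<close>

definition density_of :: "('g \<Rightarrow> complex) \<Rightarrow> 'g \<Rightarrow> ennreal" where
  "density_of f x = ennreal ((cmod (continuous_rep \<mu>G f x))\<^sup>2)"

lemma weil_subgroup: "j \<in> I \<Longrightarrow> weil_subgroup \<mu>G (\<eta> j ` \<Gamma>) (\<nu> j) (Q j)"
  using aut weil
  by (intro weil_subgroup.intro weil_subgroup_axioms.intro haar_group_axioms closed_subgroup_image
      co_compact_image haar_measure_image subgroup co_compact haar_\<Gamma>)

lemma s_pos: "j \<in> I \<Longrightarrow> 0 < s j"
  by (rule weil_subgroup.covolume_pos[OF weil_subgroup])

lemma density_lower_semicont: "f \<in> V \<Longrightarrow> lower_semicont (density_of f)"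
  unfolding density_of_def
  by (intro lower_semicont_continuous continuous_on_ennreal continuous_on_power continuous_on_norm
      continuous_rep_continuous[OF band])

lemma nn_integral_density: "f \<in> V \<Longrightarrow> (\<integral>\<^sup>+x. density_of f x \<partial>\<mu>G) = ennreal (N f)"
proof -
  assume f: "f \<in> V"
  note fL = band_limited_L2[OF f]
  have "(\<integral>\<^sup>+x. density_of f x \<partial>\<mu>G) = (\<integral>\<^sup>+x. ennreal ((cmod (f x))\<^sup>2) \<partial>\<mu>G)"
    unfolding density_of_def
    by (intro nn_integral_cong_AE) (use continuous_rep_AE[OF band f] in eventually_elim, simp)
  then show ?thesis using nn_integral_L2[OF fL] by simp
qed

text \<open>
  Sampling a translate of \<open>f\<close> on \<open>\<eta>\<^sub>j\<Gamma>\<close> is sampling \<open>f\<close> on a coset of \<open>\<eta>\<^sub>j\<Gamma>\<close>.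
\<close>

lemma periodize_density:
  assumes f: "f \<in> V" and j: "j \<in> I"
  shows "periodize (\<nu> j) (density_of f) a
    = (\<integral>\<^sup>+l. ennreal ((cmod (sample (\<lambda>x. f (a + x)) j l))\<^sup>2) \<partial>\<mu>\<Gamma>)"
proof -
  have sets: "sets \<mu>\<Gamma> = sets (borel_of (top_of_set \<Gamma>))" using haar_\<Gamma> by (simp add: haar_measure_def)
  interpret W: weil_subgroup \<mu>G "\<eta> j ` \<Gamma>" "\<nu> j" "Q j" by (rule weil_subgroup[OF j])
  note dm = lower_semicont_measurable[OF density_lower_semicont[OF f]]
  have "(\<lambda>h. density_of f (a + h)) \<in> borel_measurable (borel_of (top_of_set (\<eta> j ` \<Gamma>)))"
    using W.shift_measurable[OF dm, of a] by (simp add: image_measure_def)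
  then show ?thesis
    unfolding periodize_def image_measure_def
    by (subst nn_integral_distr[OF topological_aut_measurable[OF aut[OF j] sets]])
      (simp_all add: sampling_transform_def density_of_def continuous_rep_translate[OF band f])
qed

lemma periodize_density_zero:
  assumes f: "f \<in> V" and j: "j \<in> I"
  shows "periodize (\<nu> j) (density_of f) 0 = (\<integral>\<^sup>+l. ennreal ((cmod (sample f j l))\<^sup>2) \<partial>\<mu>\<Gamma>)"
  using periodize_density[OF assms, of 0] by simp

text \<open>
  Tightness applied to all translates of \<open>f\<close> says that the sum of the periodizations is
  constant.
\<close>

lemma tight_imp_periodizations:
  assumes J: "finite J" "J \<subseteq> I" and tight: "tight_sampling \<mu>G \<mu>D \<mu>\<Gamma> E \<eta> J K"
    and f: "f \<in> V" and j: "j \<in> J"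
  shows "periodize (\<nu> j) (density_of f) x = ennreal (N f / s j)"
proof (rule constant_sum_imp_constant_periodizations[OF J(1) _ density_lower_semicont[OF f]
      nn_integral_density[OF f] L2_norm_sq_nonneg _ j])
  show "weil_subgroup \<mu>G (\<eta> i ` \<Gamma>) (\<nu> i) (Q i)" if "i \<in> J" for i
    using that J(2) weil_subgroup by auto
  fix a
  let ?f = "\<lambda>x. f (a + x)"
  have fa: "?f \<in> V" by (rule band_limited_translate[OF f])
  have L: "sample ?f i \<in> L2 \<mu>\<Gamma>" if "i \<in> J" for i
    using tight fa that unfolding tight_sampling_def set_of_sampling_def by blast
  have "(\<Sum>i\<in>J. periodize (\<nu> i) (density_of f) a) = (\<Sum>i\<in>J. ennreal (L2_norm_sq \<mu>\<Gamma> (sample ?f i)))"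
  proof (intro sum.cong refl)
    fix i assume i: "i \<in> J"
    then have "i \<in> I" using J(2) by auto
    then show "periodize (\<nu> i) (density_of f) a = ennreal (L2_norm_sq \<mu>\<Gamma> (sample ?f i))"
      using nn_integral_L2[OF L[OF i]] periodize_density[OF f] by simp
  qed
  also have "\<dots> = ennreal (\<Sum>i\<in>J. L2_norm_sq \<mu>\<Gamma> (sample ?f i))"
    by (simp add: sum_ennreal L2_norm_sq_nonneg)
  also have "(\<Sum>i\<in>J. L2_norm_sq \<mu>\<Gamma> (sample ?f i)) = K * N ?f"
    using tight fa unfolding tight_sampling_def by blast
  also have "N ?f = N f"
    by (rule L2_norm_sq_translate[OF L2_G_measurable[OF band_limited_L2[OF f]]])
  finally show "(\<Sum>i\<in>J. periodize (\<nu> i) (density_of f) a) = ennreal (K * N f)" .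
qed

lemma tight_imp_sample_norms:
  assumes J: "finite J" "J \<subseteq> I" and tight: "tight_sampling \<mu>G \<mu>D \<mu>\<Gamma> E \<eta> J K"
    and f: "f \<in> V" and j: "j \<in> J"
  shows "sample f j \<in> L2 \<mu>\<Gamma>" "L2_norm_sq \<mu>\<Gamma> (sample f j) = N f / s j"
proof -
  have jI: "j \<in> I" using J j by auto
  show L: "sample f j \<in> L2 \<mu>\<Gamma>"
    using tight f j unfolding tight_sampling_def set_of_sampling_def by blast
  have "ennreal (L2_norm_sq \<mu>\<Gamma> (sample f j)) = ennreal (N f / s j)"
    using tight_imp_periodizations[OF J tight f j, of 0] nn_integral_L2[OF L]
    by (simp add: periodize_density_zero[OF f jI])
  then show "L2_norm_sq \<mu>\<Gamma> (sample f j) = N f / s j"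
    using s_pos[OF jI] L2_norm_sq_nonneg[of \<mu>G f] L2_norm_sq_nonneg[of \<mu>\<Gamma>]
    by (subst (asm) ennreal_inj) (auto simp: less_imp_le)
qed

lemma sample_norms_imp_tight:
  assumes J: "finite J" "J \<noteq> {}" "J \<subseteq> I"
    and norms: "\<And>f j. f \<in> V \<Longrightarrow> j \<in> J \<Longrightarrow> sample f j \<in> L2 \<mu>\<Gamma> \<and> L2_norm_sq \<mu>\<Gamma> (sample f j) = N f / s j"
  shows "tight_sampling \<mu>G \<mu>D \<mu>\<Gamma> E \<eta> J (\<Sum>j\<in>J. 1 / s j)"
proof -
  have pos: "0 < (\<Sum>j\<in>J. 1 / s j)" using J s_pos by (intro sum_pos) auto
  have "(\<Sum>j\<in>J. L2_norm_sq \<mu>\<Gamma> (sample f j)) = (\<Sum>j\<in>J. 1 / s j) * N f" if "f \<in> V" for f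
    using norms[OF that] by (simp add: sum_distrib_right)
  then show ?thesis
    unfolding tight_sampling_def set_of_sampling_def
    by (intro conjI ballI exI[of _ "\<Sum>j\<in>J. 1 / s j"] pos) (simp_all add: norms)
qed

text \<open>
  If \<open>E\<close> is a null set, the only band-limited function is zero and every constant would do; a
  nonzero one determines \<open>K\<close>.
\<close>

lemma tight_constant:
  assumes J: "finite J" "J \<subseteq> I" and tight: "tight_sampling \<mu>G \<mu>D \<mu>\<Gamma> E \<eta> J K"
    and E: "emeasure \<mu>D E \<noteq> 0"
  shows "K = (\<Sum>j\<in>J. 1 / s j)"
proof -
  obtain f where f: "f \<in> V" "N f \<noteq> 0" using band_limited_nonzero[OF band E] by blast
  have "K * N f = (\<Sum>j\<in>J. L2_norm_sq \<mu>\<Gamma> (sample f j))"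
    using tight f(1) unfolding tight_sampling_def by simp
  also have "\<dots> = (\<Sum>j\<in>J. 1 / s j) * N f"
    using tight_imp_sample_norms(2)[OF J tight f(1)] by (simp add: sum_distrib_right)
  finally show ?thesis using f(2) by simp
qed

end

text \<open>
  Tightness of any nonempty set of indices is equivalent to the sample norms of each index
  being \<open>N f / s j\<close>. Both directions and the constants are instances for the index sets \<open>{1..n}\<close>
  and \<open>{j}\<close>.
\<close>

theorem theorem5p4:
  fixes \<mu>G :: "'g::{topological_ab_group_add, t2_space, second_countable_topology} measure"
    and \<mu>D :: "('g \<Rightarrow> complex) measure"
    and \<Gamma> :: "'g set" and \<mu>\<Gamma> :: "'g measure"
    and \<eta> :: "nat \<Rightarrow> 'g \<Rightarrow> 'g" and n :: nat
    and E :: "('g \<Rightarrow> complex) set"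
    and Q :: "nat \<Rightarrow> 'g set measure"
  assumes "locally_compact_space (euclidean :: 'g topology)"
    and "haar_measure euclidean (+) \<mu>G"
    and "dual_haar_measure \<mu>D"
    and "plancherel_normalized \<mu>G \<mu>D"
    and "closed_subgroup \<Gamma>"
    and "co_compact \<Gamma>"
    and "haar_measure (top_of_set \<Gamma>) (+) \<mu>\<Gamma>"
    and "n \<ge> 1"
    and "\<And>j. j \<in> {1..n} \<Longrightarrow> topological_aut (\<eta> j)"
    and "\<And>j. j \<in> {1..n} \<Longrightarrow> weil_measure \<mu>G (\<eta> j ` \<Gamma>) (image_measure (\<eta> j) \<Gamma> \<mu>\<Gamma>) (Q j)"
    and "band \<mu>D E"
  shows "((\<exists>K. tight_sampling \<mu>G \<mu>D \<mu>\<Gamma> E \<eta> {1..n} K) \<longleftrightarrow>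
            (\<forall>j\<in>{1..n}. \<exists>Kj. tight_sampling \<mu>G \<mu>D \<mu>\<Gamma> E \<eta> {j} Kj)) \<and>
         (emeasure \<mu>D E \<noteq> 0 \<longrightarrow>
            (\<forall>K \<kappa>. tight_sampling \<mu>G \<mu>D \<mu>\<Gamma> E \<eta> {1..n} K \<and>
                    (\<forall>j\<in>{1..n}. tight_sampling \<mu>G \<mu>D \<mu>\<Gamma> E \<eta> {j} (\<kappa> j)) \<longrightarrow>
               (\<forall>j\<in>{1..n}. \<kappa> j = 1 / measure (Q j) (cosets (\<eta> j ` \<Gamma>))) \<and>
               K = (\<Sum>j\<in>{1..n}. \<kappa> j)))"
proof -
  interpret sampling_family \<mu>G \<mu>D \<Gamma> \<mu>\<Gamma> \<eta> Q "{1..n}" E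
    using assms
    by (intro sampling_family.intro plancherel_group.intro haar_group.intro
        plancherel_group_axioms.intro sampling_family_axioms.intro) auto
  have "(\<exists>K. tight_sampling \<mu>G \<mu>D \<mu>\<Gamma> E \<eta> {1..n} K) \<longleftrightarrow>
      (\<forall>j\<in>{1..n}. \<exists>Kj. tight_sampling \<mu>G \<mu>D \<mu>\<Gamma> E \<eta> {j} Kj)"
  proof (intro iffI ballI)
    fix j assume "\<exists>K. tight_sampling \<mu>G \<mu>D \<mu>\<Gamma> E \<eta> {1..n} K" and j: "j \<in> {1..n}"
    then obtain K where "tight_sampling \<mu>G \<mu>D \<mu>\<Gamma> E \<eta> {1..n} K" by blast
    then have "sample f j \<in> L2 \<mu>\<Gamma> \<and> L2_norm_sq \<mu>\<Gamma> (sample f j) = N f / s j" if "f \<in> V" for f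
      using tight_imp_sample_norms[of "{1..n}" K f j] that j by simp
    then have "tight_sampling \<mu>G \<mu>D \<mu>\<Gamma> E \<eta> {j} (\<Sum>i\<in>{j}. 1 / s i)"
      using j by (intro sample_norms_imp_tight) auto
    then show "\<exists>Kj. tight_sampling \<mu>G \<mu>D \<mu>\<Gamma> E \<eta> {j} Kj" by blast
  next
    assume single: "\<forall>j\<in>{1..n}. \<exists>Kj. tight_sampling \<mu>G \<mu>D \<mu>\<Gamma> E \<eta> {j} Kj"
    have "sample f j \<in> L2 \<mu>\<Gamma> \<and> L2_norm_sq \<mu>\<Gamma> (sample f j) = N f / s j"
      if "f \<in> V" and j: "j \<in> {1..n}" for f j
    proof -
      obtain Kj where "tight_sampling \<mu>G \<mu>D \<mu>\<Gamma> E \<eta> {j} Kj" using single j by blast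
      then show ?thesis using tight_imp_sample_norms[of "{j}" Kj f j] that by simp
    qed
    then have "tight_sampling \<mu>G \<mu>D \<mu>\<Gamma> E \<eta> {1..n} (\<Sum>j\<in>{1..n}. 1 / s j)"
      using \<open>n \<ge> 1\<close> by (intro sample_norms_imp_tight) auto
    then show "\<exists>K. tight_sampling \<mu>G \<mu>D \<mu>\<Gamma> E \<eta> {1..n} K" by blast
  qed
  moreover have "(\<forall>j\<in>{1..n}. \<kappa> j = 1 / s j) \<and> K = (\<Sum>j\<in>{1..n}. \<kappa> j)"
    if "emeasure \<mu>D E \<noteq> 0" "tight_sampling \<mu>G \<mu>D \<mu>\<Gamma> E \<eta> {1..n} K"
      "\<forall>j\<in>{1..n}. tight_sampling \<mu>G \<mu>D \<mu>\<Gamma> E \<eta> {j} (\<kappa> j)" for K \<kappa>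
  proof -
    have \<kappa>: "\<kappa> j = 1 / s j" if "j \<in> {1..n}" for j
      using tight_constant[of "{j}" "\<kappa> j"] that \<open>emeasure \<mu>D E \<noteq> 0\<close>
        \<open>\<forall>j\<in>{1..n}. tight_sampling \<mu>G \<mu>D \<mu>\<Gamma> E \<eta> {j} (\<kappa> j)\<close> by simp
    moreover have "K = (\<Sum>j\<in>{1..n}. 1 / s j)"
      using tight_constant[of "{1..n}" K] that by simp
    ultimately show ?thesis by simp
  qed
  ultimately show ?thesis by blast
qed

end
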